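(* Let $n\ge 1$, let $\mu$ be a partition with at most $n$ parts, and let $l$ be an odd integer with $\ell(\mu)\le l\le 2n$. Then: (1) $$\bigsqcup_{\substack{\lambda\in Par_{\le 2n}\\ \ell(\lambda)=l\\ \mu\subseteq\lambda}}Rec^{1,0}_{2n}(\lambda/\mu)=\Big\{Q\setminus Q^{\mathsf{tail}}:\ Q\in\bigsqcup_{\substack{\lambda\in Par_{\le 2n}\\ \ell(\lambda)=l+1\\ \mu\subseteq\lambda}}Rec^{1,0}_{2n}(\lambda/\mu)\Big\}.$$ In other words, the recording tableaux in $\bigsqcup_{\lambda\in Par_{\le 2n},\,\ell(\lambda)=l,\,\mu\subseteq\lambda}Rec^{1,0}_{2n}(\lambda/\mu)$ are obtained from those in $\bigsqcup_{\lambda\in Par_{\le 2n},\,\ell(\lambda)=l+1,\,\mu\subseteq\lambda}Rec^{1,0}_{2n}(\lambda/\mu)$ by suppressing the tails. (2) Let $Q\in Rec^{1,0}_{2n}(\lambda/\mu)$ with $\ell(\lambda)=l+1$ be such that $\lambda-M\varpi_{l+1}$ has length $l$ for some $M>0$. Then (a) $S=(\mathsf{LR}^{AII})^{-1}(S^{H,\mu},Q)$ if and only if $S=(1,2,\dots,l,l+1)^M S'$ and $S'=(\mathsf{LR}^{AII})^{-1}(S^{H,\mu},Q\setminus Q^{\mathsf{tail}})$. In other words, for $S=(1,2,\dots,l+1)^MS'$, $S\in SST^{\mathfrak k\text{-hw}}_{2n}(\lambda,\mu)$ if and only if $S'\in SST^{\mathfrak k\text{-hw}}_{2n}(\lambda-M\varpi_{l+1},\mu)$.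 (b) When $l+1=2n$, and $S,S'$ are as in (a): $\Phi^{-1}(S)=\Phi^{-1}\big((\mathsf{LR}^{AII})^{-1}(S^{H,\mu},Q)\big)$ if and only if $\Phi^{-1}(S)=(1,2,\dots,2n)^M\,\Phi^{-1}(S')$ and $\Phi^{-1}(S')=\Phi^{-1}\big((\mathsf{LR}^{AII})^{-1}(S^{H,\mu},Q\setminus Q^{\mathsf{tail}})\big)$. One has $\mathrm{wt}_{\widehat{\mathfrak g}}(\Phi^{-1}(S'))=\mathrm{wt}_{\mathfrak k}(S')=\mu$ and, for the single column $(1,2,\dots,2n)$, $\mathrm{wt}_{\widehat{\mathfrak g}}(\Phi^{-1}(1,2,\dots,2n))=\mathrm{wt}_{\widehat{\mathfrak g}}(1,2,\dots,2n)=0=\mathrm{wt}_{\mathfrak k}(1,2,\dots,2n)$.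
   Context: Tableaux. $Par_{\le m}$ is the set of partitions with at most $m$ parts, $\ell(\lambda)$ the number of nonzero parts, and $\varpi_r=(1^r)$. $SST_{2n}(\lambda)$ is the set of semistandard Young tableaux (English convention) of shape $\lambda$ with entries in $\{1<\dots<2n\}$. $(1,2,\dots,r)^M S'$ is the tableau obtained by placing $M$ columns with entries $1,2,\dots,r$ to the left of $S'$. $T\in SST_{2n}(\lambda)$ is symplectic if the first entry of row $k$ is at least $2k-1$ for all $k\le\ell(\lambda)$; $SpT_{2n}(\lambda)$ is the set of these. Weights. For $1\le k\le n$ let $u_k=2k$, $v_k=2k-1$ if $k$ is odd, and $u_k=2k-1$, $v_k=2k$ if $k$ is even. With $S[i]$ the number of entries $i$ in $S$: $\mathrm{wt}_{\mathfrak k}(S)=(S[u_k]-S[v_k])_{k=1}^n$ and $\mathrm{wt}_{\widehat{\mathfrak g}}(S)=(S[k]-S[2n-k+1])_{k=1}^n$. For $\mu\in Par_{\le n}$, $S^{H,\mu}\in SpT_{2n}(\mu)$ is the tableau of shape $\mu$ with all entries of row $k$ equal to $u_k$. Promotion. For $1\le a\le b\le 2n$ the bijection $\mathbf{pr}^{-1}_{a,b}:SST_{2n}(\lambda)\to SST_{2n}(\lambda)$ is: (i) remove all boxes with entries outside $[a,b]$; (ii) in what remains decrease every entry different from $a$ by $1$ and replace every entry $a$ by $b$; (iii) apply jeu-de-taquin slides to these replaced boxes with entry $b$, from right to left, moving each outward (exchanging it with the smaller of its right and lower neighbours, the lower one in case of a tie) until the tableau is semistandard; (iv) put back the boxes removed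 in (i). Its inverse is $\mathbf{pr}_{a,b}$. With $\overline i=2n-i+1$, $$\Phi=\begin{cases}\mathbf{pr}_{1,\overline1}\circ\mathbf{pr}_{3,\overline2}\circ\mathbf{pr}_{3,\overline3}\circ\cdots\circ\mathbf{pr}_{n-1,\overline{n-2}}\circ\mathbf{pr}_{n-1,\overline{n-1}}& n\text{ even},\\ \mathbf{pr}_{1,\overline1}\circ\mathbf{pr}_{3,\overline2}\circ\mathbf{pr}_{3,\overline3}\circ\cdots\circ\mathbf{pr}_{n,\overline{n-1}}\circ\mathbf{pr}_{n,\overline n}& n\text{ odd}\end{cases}$$ (written from left to right: the factor $\mathbf{pr}_{1,\overline 1}$, then the pairs $\mathbf{pr}_{j,\overline{j-1}}\circ\mathbf{pr}_{j,\overline j}$ for odd $j$ with $3\le j\le n$). Inverse reduction for $t\in\{0,1\}$. For even $r$ put $\mathrm{red}_0^{-1}(())=(1,2,\dots,r)$ (column of length $r$). For odd $r\le 2n-1$ and $a\in\{1,\dots,2n\}$, $\mathrm{red}_1^{-1}(a)$ is the column of length $r$ $$\mathrm{red}_1^{-1}(a)=\begin{cases}(1,\dots,r_1,\,a,\,a+1,\dots,a+r-r_1-1)& a \text{ even},\ r_1=\min\{a-2,r-1\},\\ (1,\dots,r_1,\,a,\,a+2,\dots,a+r-r_1)& a\text{ odd},\ r_1=\min\{a-1,r-1\}.\end{cases}$$ Quantum Littlewood–Richardson map with $1$-$0$ slack. The quantum Littlewood–Richardson rule is a bijection $\mathsf{LR}^{AII}:T\mapsto(P^{AII}(T),Q^{AII}(T))$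 from $SST_{2n}(\lambda)$ onto the disjoint union, over $\mu\in Par_{\le n}$, $\mu\subseteq\lambda$, and $Q\in Rec_{2n}(\lambda/\mu)$, of $SpT_{2n}(\mu)\times\{Q\}$. A $1$-$0$ slack chain from $T\in SST_{2n}(\lambda)$ to $S^{H,\mu}$ is a sequence $T=T^{(0)},\dots,T^{(N)}=S^{H,\mu}$ ($N\ge0$) such that for each $1\le k\le N$, with $C$ the first column of $T^{(k-1)}$, $r$ its length and $T'$ the tableau of the remaining columns: if $r$ is even, $C=(1,2,\dots,r)$ and $T^{(k)}=T'$; if $r$ is odd, then $r\ge3$, $C=\mathrm{red}_1^{-1}(a)$ for some $a$, and $T^{(k)}$ is obtained by column-inserting $a$ into $T'$ (in the first column $a$ replaces the smallest entry $\ge a$, which is then inserted in the same way into the next column, and so on; if there is no entry $\ge a$ the inserted letter is appended at the bottom of the column). The recording tableau $Q$ of the chain is the filling of $\lambda/\mu$ in which the boxes of $\mathrm{shape}(T^{(k-1)})/\mathrm{shape}(T^{(k)})$ (a vertical strip) contain $k$. $Rec^{1,0}_{2n}(\lambda/\mu)$ is the set of recording tableaux so obtained, and for $Q$ in it $(\mathsf{LR}^{AII})^{-1}(S^{H,\mu},Q)$ is the unique $T\in SST_{2n}(\lambda)$ having such a chain with recording tableau $Q$. Tail. If $\ell(\lambda)$ is even, the tail $Q^{\mathsf{tail}}$ of $Q\in Rec^{1,0}_{2n}(\lambda/\mu)$ consists of its vertical strips of length $\ell(\lambda)$; these are the strips with labels $1,\dots,M$ for some $M$ (the length of the tail). $Q\setminus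 Q^{\mathsf{tail}}$ is the recording tableau formed by the remaining strips, relabelled by $k\mapsto k-M$; its outer shape is $\lambda-M\varpi_{\ell(\lambda)}$. $\mathfrak k$-highest weight tableaux. $SST^{\mathfrak k\text{-hw}}_{2n}(\lambda,\mu)=(\mathsf{LR}^{AII})^{-1}(\{S^{H,\mu}\}\times Rec_{2n}(\lambda/\mu))=\{T\in SST_{2n}(\lambda):P^{AII}(T)=S^{H,\mu}\}$. By a theorem of Naito–Suzuki–Watanabe (which may be used as the definition here) this set equals $\Phi(D)$, where $D$ is the set of $T\in SST_{2n}(\lambda)$ with $\mathrm{wt}_{\widehat{\mathfrak g}}(T)=\mu$ such that, reading the columns of $T$ from right to left and each from top to bottom, for every prefix of the word the vector ((number of $i$) $-$ (number of $2n-i+1$))$_{1\le i\le n}$ is a partition.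
   Formalization: In (1) the right-hand set is restricted to those Q for which Q∖Q^tail has outer shape of length l; without this the equality fails, e.g. n=1, μ=(), l=1, where the column (1,2) yields the empty recording tableau while the left side is empty. *)

theory Defs
  imports Main
begin

text \<open>
  Partitions are lists of their nonzero parts, so that \<open>length\<close> is the number of parts.
  A tableau is the list of its columns from left to right, each column being listed from top to
  bottom. Boxes are pairs (row, column), both counted from 0.
\<close>

type_synonym tableau = "nat list list"

section \<open>Partitions and semistandard tableaux\<close>

definition Par :: "nat \<Rightarrow> nat list set" where
  "Par m = {lam. sorted_wrt (\<ge>) lam \<and> 0 \<notin> set lam \<and> length lam \<le> m}"

definition part_le :: "nat list \<Rightarrow> nat list \<Rightarrow> bool" where
  "part_le mu lam \<longleftrightarrow> length mu \<le> length lam \<and> (\<forall>i<length mu. mu ! i \<le> lam ! i)"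

definition cells :: "nat list \<Rightarrow> (nat \<times> nat) set" where
  "cells lam = {(i, j). i < length lam \<and> j < lam ! i}"

text \<open>The partition \<open>\<lambda> - M (1\<^sup>r)\<close> with \<open>r = length \<lambda>\<close>; meaningful for \<open>M \<le> last \<lambda>\<close>
  (the subtraction is truncated).\<close>

definition sub_cols :: "nat list \<Rightarrow> nat \<Rightarrow> nat list" where
  "sub_cols lam M = filter (\<lambda>p. p \<noteq> 0) (map (\<lambda>p. p - M) lam)"

definition shape :: "tableau \<Rightarrow> nat list" where
  "shape T = map (\<lambda>i. length (filter (\<lambda>C. i < length C) T))
                 [0..<(if T = [] then 0 else length (hd T))]"

definition SST :: "nat \<Rightarrow> nat list \<Rightarrow> tableau set" where
  "SST m lam = {T. [] \<notin> set T
     \<and> (\<forall>C\<in>set T. sorted_wrt (<) C \<and> set C \<subseteq> {1..m})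
     \<and> (\<forall>j. Suc j < length T \<longrightarrow> length (T ! Suc j) \<le> length (T ! j)
            \<and> (\<forall>i<length (T ! Suc j). T ! j ! i \<le> T ! Suc j ! i))
     \<and> shape T = lam}"

text \<open>The tableau \<open>(1,2,\<dots>,r)\<^sup>M S\<close>.\<close>

definition prepend_cols :: "nat \<Rightarrow> nat \<Rightarrow> tableau \<Rightarrow> tableau" where
  "prepend_cols r M S = replicate M [1..<Suc r] @ S"

section \<open>Weights\<close>

definition u :: "nat \<Rightarrow> nat" where
  "u k = (if odd k then 2 * k else 2 * k - 1)"

definition v :: "nat \<Rightarrow> nat" where
  "v k = (if odd k then 2 * k - 1 else 2 * k)"

definition entry_count :: "tableau \<Rightarrow> nat \<Rightarrow> int" where
  "entry_count T i = int (count_list (concat T) i)"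

definition wt_k :: "nat \<Rightarrow> tableau \<Rightarrow> int list" where
  "wt_k n T = map (\<lambda>k. entry_count T (u k) - entry_count T (v k)) [1..<Suc n]"

definition wt_g :: "nat \<Rightarrow> tableau \<Rightarrow> int list" where
  "wt_g n T = map (\<lambda>k. entry_count T k - entry_count T (2 * n - k + 1)) [1..<Suc n]"

definition part_vec :: "nat \<Rightarrow> nat list \<Rightarrow> int list" where
  "part_vec n mu = map (\<lambda>i. if i < length mu then int (mu ! i) else 0) [0..<n]"

text \<open>The tableau \<open>S\<^sup>H\<close> of shape \<open>\<mu>\<close>: all entries of the \<open>k\<close>-th row (\<open>k \<ge> 1\<close>) are \<open>u k\<close>.\<close>

definition SH :: "nat list \<Rightarrow> tableau" where
  "SH mu = map (\<lambda>j. map u [1..<Suc (length (filter (\<lambda>p. j < p) mu))])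
               [0..<(if mu = [] then 0 else hd mu)]"

section \<open>Promotion\<close>

text \<open>\<open>slide b i j T\<close> moves the box \<open>(i, j)\<close>, which contains \<open>b\<close>, outward. After the relabelling
  below, the boxes with entries less than \<open>b\<close> to the right of or below such a box are exactly
  boxes kept in the restriction to \<open>[a,b]\<close>; boxes with larger entries have been removed there
  and are therefore ignored.\<close>

definition smaller_at :: "nat \<Rightarrow> nat \<Rightarrow> nat \<Rightarrow> tableau \<Rightarrow> bool" where
  "smaller_at b i j T \<longleftrightarrow> j < length T \<and> i < length (T ! j) \<and> T ! j ! i < b"

definition put :: "nat \<Rightarrow> nat \<Rightarrow> nat \<Rightarrow> tableau \<Rightarrow> tableau" where
  "put i j x T = T[j := (T ! j)[i := x]]"

lemma map_length_put [simp]: "map length (put i j x T) = map length T"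
  by (cases "j < length T"; simp add: put_def map_update list_update_same_conv list_update_beyond)

lemma length_put [simp]: "length (put i j x T) = length T"
  by (simp add: put_def)

function slide :: "nat \<Rightarrow> nat \<Rightarrow> nat \<Rightarrow> tableau \<Rightarrow> tableau" where
  "slide b i j T =
    (if smaller_at b (Suc i) j T
        \<and> (smaller_at b i (Suc j) T \<longrightarrow> T ! j ! Suc i \<le> T ! Suc j ! i)
     then slide b (Suc i) j (put i j (T ! j ! Suc i) (put (Suc i) j b T))
     else if smaller_at b i (Suc j) T
     then slide b i (Suc j) (put i j (T ! Suc j ! i) (put i (Suc j) b T))
     else T)"
  by pat_completeness auto
termination
proof (relation "measure (\<lambda>(b, i, j, T). sum_list (map length T) + length T - (i + j))",
    goal_cases)
  case 1
  show ?case by simp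
next
  case (2 b i j T)
  then have "j < length T" "Suc i < length (T ! j)"
    by (auto simp: smaller_at_def)
  moreover from this have "length (T ! j) \<le> sum_list (map length T)"
    by (intro member_le_sum_list) auto
  ultimately show ?case by simp
next
  case (3 b i j T)
  then have "Suc j < length T" "i < length (T ! Suc j)"
    by (auto simp: smaller_at_def)
  moreover from this have "length (T ! Suc j) \<le> sum_list (map length T)"
    by (intro member_le_sum_list) auto
  ultimately show ?case by simp
qed

declare slide.simps [simp del]

definition pr_inv :: "nat \<Rightarrow> nat \<Rightarrow> tableau \<Rightarrow> tableau" where
  "pr_inv a b T =
     fold (\<lambda>(i, j). slide b i j)
       [(i, j). j \<leftarrow> rev [0..<length T], i \<leftarrow> [0..<length (T ! j)], T ! j ! i = a]
       (map (map (\<lambda>x. if x = a then b else if a < x \<and> x \<le> b then x - 1 else x)) T)"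

text \<open>The index pairs of the factors of \<open>\<Phi> = pr\<^bsub>1,2n\<^esub> \<circ> \<dots>\<close>, from left to right.\<close>

definition Phi_factors :: "nat \<Rightarrow> (nat \<times> nat) list" where
  "Phi_factors n = (1, 2 * n) #
     concat (map (\<lambda>j. [(j, 2 * n - (j - 1) + 1), (j, 2 * n - j + 1)]) (filter odd [3..<Suc n]))"

text \<open>\<open>\<Phi>\<^sup>-\<^sup>1\<close>: the inverse factors composed in reverse order, so that the inverse of the leftmost
  factor of \<open>\<Phi>\<close> is applied first.\<close>

definition Phi_inv :: "nat \<Rightarrow> tableau \<Rightarrow> tableau" where
  "Phi_inv n T = fold (\<lambda>(a, b). pr_inv a b) (Phi_factors n) T"

section \<open>Column insertion and the tableau \<open>P\<^sup>A\<^sup>I\<^sup>I\<close>\<close>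

fun col_insert :: "nat \<Rightarrow> tableau \<Rightarrow> tableau" where
  "col_insert a [] = [[a]]"
| "col_insert a (C # T) =
     (case dropWhile (\<lambda>x. x < a) C of
        [] \<Rightarrow> (C @ [a]) # T
      | x # ys \<Rightarrow> (takeWhile (\<lambda>x. x < a) C @ a # ys) # col_insert x T)"

text \<open>Watanabe's removable letters of a column, computed on the column read from bottom to top.
  For a column \<open>(a\<^sub>1,\<dots>,a\<^sub>l)\<close> one has
  \<open>rem(a\<^sub>1,\<dots>,a\<^sub>l) = rem(a\<^sub>1,\<dots>,a\<^bsub>l-2\<^esub>) \<union> {a\<^bsub>l-1\<^esub>, a\<^sub>l}\<close> if \<open>a\<^sub>l\<close> is even, \<open>a\<^bsub>l-1\<^esub> = a\<^sub>l - 1\<close>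
  and \<open>a\<^sub>l < 2l - |rem(a\<^sub>1,\<dots>,a\<^bsub>l-2\<^esub>)| - 1\<close>, and
  \<open>rem(a\<^sub>1,\<dots>,a\<^sub>l) = rem(a\<^sub>1,\<dots>,a\<^bsub>l-1\<^esub>)\<close> otherwise. Deleting them yields the reduction of the
  column, a symplectic column.\<close>

fun rem_rev :: "nat list \<Rightarrow> nat list" where
  "rem_rev [] = []"
| "rem_rev [x] = []"
| "rem_rev (y # x # zs) =
     (if even y \<and> y = Suc x \<and> y + length (rem_rev zs) + 1 < 2 * length (y # x # zs)
      then y # x # rem_rev zs
      else rem_rev (x # zs))"

definition red :: "nat list \<Rightarrow> nat list" where
  "red C = filter (\<lambda>x. x \<notin> set (rem_rev (rev C))) C"

text \<open>The product of the reduced first column with the remaining columns.\<close>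

fun suc_tab :: "tableau \<Rightarrow> tableau" where
  "suc_tab [] = []"
| "suc_tab (C # T) = fold col_insert (red C) T"

text \<open>A tableau is fixed by \<open>suc_tab\<close> iff it is symplectic, and otherwise \<open>suc_tab\<close> removes
  boxes; hence as many iterations as there are boxes reach the stable value.\<close>

definition P_AII :: "tableau \<Rightarrow> tableau" where
  "P_AII T = (suc_tab ^^ length (concat T)) T"

definition SST_khw :: "nat \<Rightarrow> nat list \<Rightarrow> nat list \<Rightarrow> tableau set" where
  "SST_khw n lam mu = {T \<in> SST (2 * n) lam. P_AII T = SH mu}"

section \<open>Chains with slack 1-0 and recording tableaux\<close>

definition red1_inv :: "nat \<Rightarrow> nat \<Rightarrow> nat list" where
  "red1_inv r a =
     (if even a
      then (let r1 = min (a - 2) (r - 1) in [1..<Suc r1] @ [a..<a + r - r1])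
      else (let r1 = min (a - 1) (r - 1) in [1..<Suc r1] @ a # [a + 2..<Suc (a + r - r1)]))"

definition slack_step :: "nat \<Rightarrow> tableau \<Rightarrow> tableau \<Rightarrow> bool" where
  "slack_step n T T1 \<longleftrightarrow> (\<exists>C T0. T = C # T0 \<and>
     (even (length C) \<and> C = [1..<Suc (length C)] \<and> T1 = T0
      \<or> odd (length C) \<and> 3 \<le> length C
        \<and> (\<exists>a\<in>{1..2 * n}. C = red1_inv (length C) a \<and> T1 = col_insert a T0)))"

definition slack_chain :: "nat \<Rightarrow> tableau list \<Rightarrow> tableau \<Rightarrow> tableau \<Rightarrow> bool" where
  "slack_chain n Ts T S \<longleftrightarrow> Ts \<noteq> [] \<and> hd Ts = T \<and> last Ts = S
     \<and> (\<forall>k. Suc k < length Ts \<longrightarrow> slack_step n (Ts ! k) (Ts ! Suc k))"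

text \<open>A recording tableau carries its outer and inner shape; its filling is 0 outside the skew
  shape. Since the outer shape is part of it, unions over outer shapes are disjoint.\<close>

datatype rec_tab = RecTab (outer: "nat list") (inner: "nat list") (filling: "nat \<times> nat \<Rightarrow> nat")

definition records :: "tableau list \<Rightarrow> rec_tab \<Rightarrow> bool" where
  "records Ts Q \<longleftrightarrow> outer Q = shape (hd Ts) \<and> inner Q = shape (last Ts)
     \<and> (\<forall>k. Suc k < length Ts \<longrightarrow>
          (\<forall>b \<in> cells (shape (Ts ! k)) - cells (shape (Ts ! Suc k)). filling Q b = Suc k))
     \<and> (\<forall>b. b \<notin> cells (outer Q) - cells (inner Q) \<longrightarrow> filling Q b = 0)"

definition Rec10 :: "nat \<Rightarrow> nat list \<Rightarrow> nat list \<Rightarrow> rec_tab set" where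
  "Rec10 n lam mu =
     {Q. \<exists>T \<in> SST (2 * n) lam. \<exists>Ts. slack_chain n Ts T (SH mu) \<and> records Ts Q}"

text \<open>\<open>(LR\<^sup>A\<^sup>I\<^sup>I)\<^sup>-\<^sup>1(S\<^sup>H, Q)\<close> for \<open>S\<^sup>H\<close> of shape \<open>\<mu>\<close> and a recording tableau \<open>Q\<close> of a chain.\<close>

definition LR_inv :: "nat \<Rightarrow> nat list \<Rightarrow> rec_tab \<Rightarrow> tableau" where
  "LR_inv n mu Q =
     (THE T. T \<in> SST (2 * n) (outer Q) \<and> (\<exists>Ts. slack_chain n Ts T (SH mu) \<and> records Ts Q))"

section \<open>Tails\<close>

definition strip :: "rec_tab \<Rightarrow> nat \<Rightarrow> (nat \<times> nat) set" where
  "strip Q k = {b \<in> cells (outer Q) - cells (inner Q). filling Q b = k}"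

definition tail_labels :: "rec_tab \<Rightarrow> nat set" where
  "tail_labels Q = {k. 1 \<le> k \<and> card (strip Q k) = length (outer Q)}"

definition remove_tail :: "rec_tab \<Rightarrow> rec_tab" where
  "remove_tail Q = (let M = card (tail_labels Q) in
     RecTab (sub_cols (outer Q) M) (inner Q)
       (\<lambda>b. if filling Q b \<in> tail_labels Q then 0 else filling Q b - M))"

end

theory Submission
  imports Defs "HOL-Library.Multiset"
begin

text \<open>
  A step of a slack chain removes a vertical strip of \<open>r\<close> boxes if the first column has even length
  \<open>r\<close>, and of \<open>r - 1\<close> boxes if \<open>r\<close> is odd, and \<open>r\<close> never increases along the chain. So if the
  first column has even length \<open>r\<close>, greater than the length of \<open>\<mu>\<close>, the strips of length \<open>r\<close> come
  exactly from the initial columns of length \<open>r\<close>. Each of these must be \<open>(1,\<dots>,r)\<close>, and the rest of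
  the chain is a slack chain with the recording tableau without its tail; conversely a column
  \<open>(1,\<dots>,r)\<close> can be prepended to any chain whose columns are not longer. A recording tableau
  determines all shapes of its chain, and column insertion is injective once the shape is known,
  so the chain can be run backwards: this makes \<open>LR_inv\<close> well defined.

  For \<open>P\<^sup>A\<^sup>I\<^sup>I\<close> the column \<open>(1,\<dots>,r)\<close> reduces to the empty column. For \<open>\<Phi>\<^sup>-\<^sup>1\<close> one slides in a
  tableau with a column \<open>(1,\<dots>,2n)\<close> on the left: the letter moves straight down this column and
  restores it, provided that the slides in the other columns have produced a semistandard tableau.
  The weight statement holds since promotion permutes contents cyclically and the composite
  permutation maps \<open>u k\<close> to \<open>k\<close> and \<open>v k\<close> to \<open>2n - k + 1\<close>.
\<close>

section \<open>Semistandard tableaux\<close>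

text \<open>Promotion is defined by bare slides, so nothing in its definition says that the result
  is semistandard, while a slide in a column (1,...,2n) is known to go straight down only if every
  entry to its right is at least its row number. The obstacle is that several letters
  \<open>b\<close> move: a slide treats every letter not less than \<open>b\<close> as absent, so it
  might stop directly above another \<open>b\<close>. This is excluded by showing that each path
  stays strictly to the left of a barrier left by the preceding slides.

  For the weight mu, the point is that a column removed in a slack step consists of complete pairs
  {2k-1, 2k}, apart from the letter that is inserted again. Hence \<open>wt_k\<close> is constant
  along a chain and can be read off from \<open>SH mu\<close>.

  The parity of l enters twice: l + 1 is at most 2n, and a first column of length l + 1 can only be
  removed as a whole, with no letter left to insert.\<close>

definition dominates :: "nat list \<Rightarrow> nat list \<Rightarrow> bool" where
  "dominates C D \<longleftrightarrow> length D \<le> length C \<and> (\<forall>i<length D. C ! i \<le> D ! i)"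

text \<open>Any two columns are compared, not only neighbours, so that later arguments can jump over
  columns; transitivity of \<open>dominates\<close> makes this equivalent to the usual condition.
  The alphabet is left unbounded.\<close>

definition ssyt :: "tableau \<Rightarrow> bool" where
  "ssyt T \<longleftrightarrow> (\<forall>C\<in>set T. C \<noteq> [] \<and> sorted_wrt (<) C) \<and> sorted_wrt dominates T"

lemma transp_dominates: "transp dominates"
  unfolding transp_def dominates_def by (meson order_trans less_le_trans)

lemma ssyt_Nil [simp]: "ssyt []"
  by (simp add: ssyt_def)

lemma ssyt_Cons:
  "ssyt (C # T) \<longleftrightarrow> C \<noteq> [] \<and> sorted_wrt (<) C \<and> (T \<noteq> [] \<longrightarrow> dominates C (hd T)) \<and> ssyt T"
proof -
  have "(\<forall>D\<in>set T. dominates C D) \<longleftrightarrow> (T \<noteq> [] \<longrightarrow> dominates C (hd T))" if "sorted_wrt dominates T"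
    using that transp_dominates by (cases T) (auto dest: transpD)
  then show ?thesis
    by (auto simp: ssyt_def)
qed

lemma SST_iff: "T \<in> SST m lam \<longleftrightarrow> ssyt T \<and> set (concat T) \<subseteq> {1..m} \<and> shape T = lam"
  unfolding SST_def ssyt_def sorted_wrt_iff_nth_Suc_transp[OF transp_dominates]
  by (auto simp: dominates_def)

section \<open>Slides\<close>

lemma length_nth_put [simp]: "length (put i j x T ! c) = length (T ! c)"
  by (cases "c = j"; cases "j < length T"; simp add: put_def list_update_beyond)

lemma nth_put:
  assumes "j < length T" and "i < length (T ! j)"
  shows "put i j x T ! c ! r = (if c = j \<and> r = i then x else T ! c ! r)"
  using assms by (cases "c = j") (auto simp: put_def nth_list_update)

lemma mset_concat_put:
  assumes "j < length T" and "i < length (T ! j)"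
  shows "add_mset (T ! j ! i) (mset (concat (put i j x T))) = add_mset x (mset (concat T))"
proof -
  have T: "T = take j T @ T ! j # drop (Suc j) T"
    using assms by (simp add: id_take_nth_drop)
  have "put i j x T = take j T @ (T ! j)[i := x] # drop (Suc j) T"
    using assms by (simp add: put_def upd_conv_take_nth_drop)
  then have "mset (concat (put i j x T))
      = mset (concat (take j T)) + mset ((T ! j)[i := x]) + mset (concat (drop (Suc j) T))"
    by simp
  moreover have "mset (concat T)
      = mset (concat (take j T)) + mset (T ! j) + mset (concat (drop (Suc j) T))"
    by (subst T) simp
  moreover have "add_mset (T ! j ! i) (mset ((T ! j)[i := x])) = add_mset x (mset (T ! j))"
    using assms by (simp add: mset_update)
  ultimately show ?thesis
    by (metis union_mset_add_mset_left union_mset_add_mset_right)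
qed

text \<open>A slide only exchanges the moving letter with a neighbour, hence preserves the content;
  the nested calls of \<open>put\<close> are the exchange as it is written in
  \<open>slide\<close>.\<close>

lemma mset_concat_swap:
  assumes "j < length T" "i < length (T ! j)" "j' < length T" "i' < length (T ! j')"
    and "(i, j) \<noteq> (i', j')" and "T ! j ! i = b"
  shows "mset (concat (put i j (T ! j' ! i') (put i' j' b T))) = mset (concat T)"
proof -
  let ?U = "put i' j' b T"
  have "add_mset (?U ! j ! i) (mset (concat (put i j (T ! j' ! i') ?U)))
      = add_mset (T ! j' ! i') (mset (concat ?U))"
    using assms by (intro mset_concat_put) auto
  also have "\<dots> = add_mset b (mset (concat T))"
    using assms by (intro mset_concat_put) auto
  finally show ?thesis
    using assms by (auto simp: nth_put)
qed

text \<open>This packages the recursion of \<open>slide\<close>: what survives both exchanges holds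
  at the end, together with the two stopping conditions. The rule for ties is passed on to the
  exchanges, because strictness in the columns depends on it.\<close>

lemma slide_invariant:
  assumes "P i j T"
    and "\<And>i j T. P i j T \<Longrightarrow> smaller_at b (Suc i) j T
      \<Longrightarrow> (smaller_at b i (Suc j) T \<longrightarrow> T ! j ! Suc i \<le> T ! Suc j ! i)
      \<Longrightarrow> P (Suc i) j (put i j (T ! j ! Suc i) (put (Suc i) j b T))"
    and "\<And>i j T. P i j T \<Longrightarrow> smaller_at b i (Suc j) T
      \<Longrightarrow> (smaller_at b (Suc i) j T \<longrightarrow> T ! Suc j ! i < T ! j ! Suc i)
      \<Longrightarrow> P i (Suc j) (put i j (T ! Suc j ! i) (put i (Suc j) b T))"
  shows "\<exists>i' j'. P i' j' (slide b i j T) \<and> \<not> smaller_at b (Suc i') j' (slide b i j T)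
    \<and> \<not> smaller_at b i' (Suc j') (slide b i j T)"
  using assms
proof (induction b i j T rule: slide.induct)
  case (1 b i j T)
  note down = "1.prems"(2) and right = "1.prems"(3)
  consider (down) "smaller_at b (Suc i) j T \<and> (smaller_at b i (Suc j) T \<longrightarrow> T ! j ! Suc i \<le> T ! Suc j ! i)"
    | (right) "\<not> (smaller_at b (Suc i) j T \<and> (smaller_at b i (Suc j) T \<longrightarrow> T ! j ! Suc i \<le> T ! Suc j ! i))"
        "smaller_at b i (Suc j) T"
    | (stop) "\<not> smaller_at b (Suc i) j T" "\<not> smaller_at b i (Suc j) T"
    by blast
  then show ?case
  proof cases
    case down
    have "P (Suc i) j (put i j (T ! j ! Suc i) (put (Suc i) j b T))"
      using "1.prems"(1,2) down by blast
    from "1.IH"(1)[OF down this "1.prems"(2,3)] down show ?thesis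
      by (simp add: slide.simps[of b i j T])
  next
    case right
    have "P i (Suc j) (put i j (T ! Suc j ! i) (put i (Suc j) b T))"
      using "1.prems"(1,3) right by (meson linorder_not_le)
    moreover have "slide b i j T = slide b i (Suc j) (put i j (T ! Suc j ! i) (put i (Suc j) b T))"
      using right by (subst slide.simps) auto
    ultimately show ?thesis
      using "1.IH"(2)[OF right _ "1.prems"(2,3)] by simp
  next
    case stop
    then have "slide b i j T = T"
      by (simp add: slide.simps[of b i j T])
    with stop "1.prems"(1) show ?thesis
      by auto
  qed
qed

text \<open>The box (i, j) takes part in no comparison. Arbitrary pairs of boxes are compared, since
  with neighbours alone the order across the omitted box would be lost.\<close>

definition ss_off :: "nat \<Rightarrow> nat \<Rightarrow> tableau \<Rightarrow> bool" where
  "ss_off i j T \<longleftrightarrow>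
     (\<forall>c c'. c \<le> c' \<and> c' < length T \<longrightarrow> length (T ! c') \<le> length (T ! c)) \<and>
     (\<forall>r c c'. c < c' \<and> c' < length T \<and> r < length (T ! c') \<and> (r, c) \<noteq> (i, j) \<and> (r, c') \<noteq> (i, j)
        \<longrightarrow> T ! c ! r \<le> T ! c' ! r) \<and>
     (\<forall>r r' c. r < r' \<and> c < length T \<and> r' < length (T ! c) \<and> (r, c) \<noteq> (i, j) \<and> (r', c) \<noteq> (i, j)
        \<longrightarrow> T ! c ! r < T ! c ! r')"

lemma ss_off_row:
  "\<lbrakk>ss_off i j T; c < c'; c' < length T; r < length (T ! c'); (r, c) \<noteq> (i, j); (r, c') \<noteq> (i, j)\<rbrakk>
    \<Longrightarrow> T ! c ! r \<le> T ! c' ! r"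
  unfolding ss_off_def by blast

lemma ss_off_col:
  "\<lbrakk>ss_off i j T; r < r'; c < length T; r' < length (T ! c); (r, c) \<noteq> (i, j); (r', c) \<noteq> (i, j)\<rbrakk>
    \<Longrightarrow> T ! c ! r < T ! c ! r'"
  unfolding ss_off_def by blast

lemma ss_off_length:
  "\<lbrakk>ss_off i j T; c \<le> c'; c' < length T\<rbrakk> \<Longrightarrow> length (T ! c') \<le> length (T ! c)"
  unfolding ss_off_def by blast

text \<open>A path entering row \<open>r\<close> to the left of column \<open>c\<close> cannot reach \<open>(r, c)\<close>: it would turn down
  at \<open>(r, c - 1)\<close>. For \<open>c = 0\<close> the column to the left does not exist yet; its entries
  will be bounded by \<open>G\<close>.\<close>

definition blocked :: "nat \<Rightarrow> tableau \<Rightarrow> tableau \<Rightarrow> nat \<Rightarrow> nat \<Rightarrow> bool" where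
  "blocked b G T r c \<longleftrightarrow> (smaller_at b r c T \<longrightarrow>
     (if c = 0 then Suc r < length (T ! 0) \<and> G ! 0 ! Suc r \<le> T ! 0 ! r
      else Suc r < length (T ! (c - 1)) \<and> T ! (c - 1) ! Suc r \<le> T ! c ! r))"

definition below :: "tableau \<Rightarrow> tableau \<Rightarrow> bool" where
  "below G T \<longleftrightarrow> map length G = map length T
     \<and> (\<forall>c<length T. \<forall>r<length (T ! c). G ! c ! r \<le> T ! c ! r)"

lemma map_length_nth: "\<lbrakk>map length S = map length T; c < length T\<rbrakk> \<Longrightarrow> length (S ! c) = length (T ! c)"
  by (metis length_map nth_map)

lemma below_length: "below G T \<Longrightarrow> length G = length T"
  unfolding below_def by (blast dest: map_eq_imp_length_eq)

lemma below_length_nth: "\<lbrakk>below G T; c < length T\<rbrakk> \<Longrightarrow> length (G ! c) = length (T ! c)"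
  unfolding below_def by (blast intro: map_length_nth)

lemma below_le: "\<lbrakk>below G T; c < length T; r < length (T ! c)\<rbrakk> \<Longrightarrow> G ! c ! r \<le> T ! c ! r"
  unfolding below_def by blast

text \<open>This is what an entrywise lower bound needs in order to survive an exchange: the letter
  moving up or left comes from a box where the bound is at least as large.\<close>

definition weakly_increasing :: "tableau \<Rightarrow> bool" where
  "weakly_increasing G \<longleftrightarrow>
     (\<forall>c r. c < length G \<and> Suc r < length (G ! c) \<longrightarrow> G ! c ! r \<le> G ! c ! Suc r) \<and>
     (\<forall>c r. Suc c < length G \<and> r < length (G ! Suc c) \<longrightarrow> G ! c ! r \<le> G ! Suc c ! r)"

text \<open>The state of a slide started in row \<open>i0\<close>: \<open>t\<close> is a barrier left by an earlier slide, all
  letters \<open>b\<close> except the moving one are weakly to the right of column \<open>e\<close>, and \<open>s\<close> is the part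
  of the new barrier in the rows already left.\<close>

definition sliding :: "nat \<Rightarrow> tableau \<Rightarrow> nat \<Rightarrow> (nat \<Rightarrow> nat) \<Rightarrow> nat \<Rightarrow> nat \<Rightarrow> nat \<Rightarrow> tableau \<Rightarrow> bool" where
  "sliding b G i0 t e i j T \<longleftrightarrow>
     i0 \<le> i \<and> j < length T \<and> i < length (T ! j) \<and> T ! j ! i = b \<and> ss_off i j T \<and>
     (\<forall>c<j. T ! c ! i < b) \<and> (\<forall>r<i. T ! j ! r < b) \<and> below G T \<and>
     j < t i \<and> (\<forall>r\<ge>i. blocked b G T r (t r)) \<and>
     (\<forall>c r. c < e \<and> c < length T \<and> r < length (T ! c) \<and> (r, c) \<noteq> (i, j) \<longrightarrow> T ! c ! r \<noteq> b) \<and>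
     (\<exists>s. \<forall>r. i0 \<le> r \<and> r < i \<longrightarrow>
        s r \<le> j \<and> (Suc r < i \<longrightarrow> s r \<le> s (Suc r)) \<and> blocked b G T r (s r))"

text \<open>The letter moving up to (i, j) must fit into row i. To the right this is the rule for
  ties; to the left, each entry of row i is less than the entry below it, which is at most the
  moving letter.\<close>

lemma ss_off_down:
  assumes ss: "ss_off i j T" and j: "j < length T" and i: "Suc i < length (T ! j)"
    and tie: "smaller_at b i (Suc j) T \<longrightarrow> T ! j ! Suc i \<le> T ! Suc j ! i" and lt: "T ! j ! Suc i < b"
  shows "ss_off (Suc i) j (put i j (T ! j ! Suc i) (put (Suc i) j b T))" (is "ss_off _ _ ?U")
proof -
  have U: "?U ! c ! r = (if c = j \<and> r = i then T ! j ! Suc i else if c = j \<and> r = Suc i then b else T ! c ! r)" for c r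
    using i j by (simp add: nth_put)
  have right: "T ! j ! Suc i \<le> T ! c ! i" if "j < c" "c < length T" "i < length (T ! c)" for c
  proof -
    have "i < length (T ! Suc j)"
      using that ss_off_length[OF ss, of "Suc j" c] by simp
    moreover have "Suc j < length T" using that by simp
    ultimately have "T ! j ! Suc i \<le> T ! Suc j ! i"
      using tie lt by (cases "T ! Suc j ! i < b") (auto simp: smaller_at_def)
    also have "\<dots> \<le> T ! c ! i"
      using that ss_off_row[OF ss, of "Suc j" c i] by (cases "c = Suc j") auto
    finally show ?thesis .
  qed
  have left: "T ! c ! i \<le> T ! j ! Suc i" if "c < j" for c
  proof -
    have "Suc i < length (T ! c)"
      using that i j ss_off_length[OF ss, of c j] by simp
    then have "T ! c ! i < T ! c ! Suc i"
      using that j ss_off_col[OF ss, of i "Suc i" c] by simp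
    also have "\<dots> \<le> T ! j ! Suc i"
      using that i j ss_off_row[OF ss, of c j "Suc i"] by simp
    finally show ?thesis by simp
  qed
  show ?thesis
    unfolding ss_off_def
  proof (intro conjI allI impI)
    show "length (?U ! c') \<le> length (?U ! c)" if "c \<le> c' \<and> c' < length ?U" for c c'
      using that ss_off_length[OF ss] by simp
  next
    show "?U ! c ! r \<le> ?U ! c' ! r"
      if a: "c < c' \<and> c' < length ?U \<and> r < length (?U ! c') \<and> (r, c) \<noteq> (Suc i, j) \<and> (r, c') \<noteq> (Suc i, j)" for r c c'
    proof -
      consider "r = i" "c = j" | "r = i" "c' = j" | "(r, c) \<noteq> (i, j)" "(r, c') \<noteq> (i, j)"
        by blast
      then show ?thesis
      proof cases
        case 1 with a right[of c'] show ?thesis by (simp add: U)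
      next
        case 2 with a left[of c] show ?thesis by (simp add: U)
      next
        case 3
        with a have "?U ! c ! r = T ! c ! r" "?U ! c' ! r = T ! c' ! r" by (auto simp: U)
        with 3 a ss_off_row[OF ss, of c c' r] show ?thesis by simp
      qed
    qed
  next
    show "?U ! c ! r < ?U ! c ! r'"
      if a: "r < r' \<and> c < length ?U \<and> r' < length (?U ! c) \<and> (r, c) \<noteq> (Suc i, j) \<and> (r', c) \<noteq> (Suc i, j)" for r r' c
    proof (cases "c = j")
      case True
      with a show ?thesis
        using ss_off_col[OF ss, of r r' j] ss_off_col[OF ss, of r "Suc i" j]
          ss_off_col[OF ss, of "Suc i" r' j] i by (auto simp: U)
    qed (use a ss_off_col[OF ss, of r r' c] in \<open>auto simp: U\<close>)
  qed
qed

text \<open>Here the letter moving left must fit strictly into column j. Below, strictness comes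
  from the fact that a tie would have led downwards; above, one passes through row r from column j
  to the next column and then down.\<close>

lemma ss_off_right:
  assumes ss: "ss_off i j T" and j: "Suc j < length T" and i: "i < length (T ! Suc j)"
    and tie: "smaller_at b (Suc i) j T \<longrightarrow> T ! Suc j ! i < T ! j ! Suc i" and lt: "T ! Suc j ! i < b"
  shows "ss_off i (Suc j) (put i j (T ! Suc j ! i) (put i (Suc j) b T))" (is "ss_off _ _ ?U")
proof -
  have i': "i < length (T ! j)"
    using i j ss_off_length[OF ss, of j "Suc j"] by simp
  have U: "?U ! c ! r = (if c = j \<and> r = i then T ! Suc j ! i else if c = Suc j \<and> r = i then b else T ! c ! r)" for c r
    using i j i' by (simp add: nth_put)
  have lower: "T ! Suc j ! i < T ! j ! r" if "i < r" "r < length (T ! j)" for r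
  proof -
    have "T ! Suc j ! i < T ! j ! Suc i"
      using tie lt j that by (cases "T ! j ! Suc i < b") (auto simp: smaller_at_def)
    also have "\<dots> \<le> T ! j ! r"
      using that j ss_off_col[OF ss, of "Suc i" r j] by (cases "r = Suc i") auto
    finally show ?thesis .
  qed
  have upper: "T ! j ! r < T ! Suc j ! i" if "r < i" for r
    using that i j ss_off_row[OF ss, of j "Suc j" r] ss_off_col[OF ss, of r i "Suc j"] by simp
  show ?thesis
    unfolding ss_off_def
  proof (intro conjI allI impI)
    show "length (?U ! c') \<le> length (?U ! c)" if "c \<le> c' \<and> c' < length ?U" for c c'
      using that ss_off_length[OF ss] by simp
  next
    show "?U ! c ! r < ?U ! c ! r'"
      if a: "r < r' \<and> c < length ?U \<and> r' < length (?U ! c) \<and> (r, c) \<noteq> (i, Suc j) \<and> (r', c) \<noteq> (i, Suc j)" for r r' c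
    proof -
      consider "c = j" "r = i" | "c = j" "r' = i" | "(r, c) \<noteq> (i, j)" "(r', c) \<noteq> (i, j)"
        by blast
      then show ?thesis
      proof cases
        case 1 with a lower[of r'] show ?thesis by (simp add: U)
      next
        case 2 with a upper[of r] show ?thesis by (simp add: U)
      next
        case 3
        with a have "?U ! c ! r = T ! c ! r" "?U ! c ! r' = T ! c ! r'" by (auto simp: U)
        with 3 a ss_off_col[OF ss, of r r' c] show ?thesis by simp
      qed
    qed
  next
    show "?U ! c ! r \<le> ?U ! c' ! r"
      if a: "c < c' \<and> c' < length ?U \<and> r < length (?U ! c') \<and> (r, c) \<noteq> (i, Suc j) \<and> (r, c') \<noteq> (i, Suc j)" for r c c'
    proof (cases "r = i")
      case True
      with a show ?thesis
        using ss_off_row[OF ss, of c c' i] ss_off_row[OF ss, of c "Suc j" i]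
          ss_off_row[OF ss, of "Suc j" c' i] i j by (auto simp: U)
    qed (use a ss_off_row[OF ss, of c c' r] in \<open>auto simp: U\<close>)
  qed
qed

text \<open>Leaving row i in column j makes j the new barrier of that row: the letter now at (i, j)
  is at least the entry of row i + 1 in column j - 1, so a later path arriving at (i, j - 1) turns
  down. The old barrier stays ahead because \<open>t\<close> weakly increases with the row.\<close>

lemma sliding_down:
  assumes S: "sliding b G i0 t e i j T" and G: "weakly_increasing G"
    and t: "\<forall>r\<ge>i0. t r \<le> t (Suc r)"
    and down: "smaller_at b (Suc i) j T"
    and tie: "smaller_at b i (Suc j) T \<longrightarrow> T ! j ! Suc i \<le> T ! Suc j ! i"
  shows "sliding b G i0 t e (Suc i) j (put i j (T ! j ! Suc i) (put (Suc i) j b T))"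
    (is "sliding _ _ _ _ _ _ _ ?U")
proof -
  have j: "j < length T" and i: "Suc i < length (T ! j)" and lt: "T ! j ! Suc i < b"
    using down by (auto simp: smaller_at_def)
  have U: "?U ! c ! r = (if c = j \<and> r = i then T ! j ! Suc i else if c = j \<and> r = Suc i then b else T ! c ! r)" for c r
    using i j by (simp add: nth_put)
  have ss: "ss_off i j T" and GT: "below G T" and i0: "i0 \<le> i" and jt: "j < t i"
    and bt: "\<And>r. r \<ge> i \<Longrightarrow> blocked b G T r (t r)"
    and nb: "\<And>c r. \<lbrakk>c < e; c < length T; r < length (T ! c); (r, c) \<noteq> (i, j)\<rbrakk> \<Longrightarrow> T ! c ! r \<noteq> b"
    using S by (auto simp: sliding_def)
  obtain s where s: "\<And>r. \<lbrakk>i0 \<le> r; r < i\<rbrakk> \<Longrightarrow>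
        s r \<le> j \<and> (Suc r < i \<longrightarrow> s r \<le> s (Suc r)) \<and> blocked b G T r (s r)"
    using S unfolding sliding_def by blast
  have left: "T ! c ! Suc i \<le> T ! j ! Suc i" if "c < j" for c
    using that i j ss_off_row[OF ss, of c j "Suc i"] by simp
  have mono: "t i \<le> t r" if "i \<le> r" for r
    using that by (induction r rule: dec_induct) (use t i0 in \<open>auto intro: order_trans[of "t i"]\<close>)
  have "below G ?U"
    unfolding below_def
  proof (intro conjI allI impI)
    show "map length G = map length ?U" using GT by (simp add: below_def)
    have "G ! j ! i \<le> G ! j ! Suc i" "G ! j ! Suc i \<le> T ! j ! Suc i"
      using G i j below_length[OF GT] below_length_nth[OF GT j] below_le[OF GT j i]
      by (simp_all add: weakly_increasing_def)
    then show "G ! c ! r \<le> ?U ! c ! r" if "c < length ?U" "r < length (?U ! c)" for c r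
      using that below_le[OF GT, of c r] lt by (simp add: U)
  qed
  \<comment> \<open>Only rows i and i + 1 of column j have changed. The condition looks at column
    \<open>t r\<close>, which is to the right of j, and at column \<open>t r - 1\<close> only below
    row i + 1.\<close>
  moreover have "blocked b G ?U r (t r)" if "Suc i \<le> r" for r
  proof -
    have "j < t r" using mono[of r] jt that by simp
    then show ?thesis
      using bt[of r] that by (auto simp: blocked_def smaller_at_def U)
  qed
  moreover have "\<exists>s. \<forall>r. i0 \<le> r \<and> r < Suc i \<longrightarrow>
        s r \<le> j \<and> (Suc r < Suc i \<longrightarrow> s r \<le> s (Suc r)) \<and> blocked b G ?U r (s r)"
  proof (intro exI[of _ "s(i := j)"] allI impI)
    fix r assume r: "i0 \<le> r \<and> r < Suc i"
    show "(s(i := j)) r \<le> j \<and> (Suc r < Suc i \<longrightarrow> (s(i := j)) r \<le> (s(i := j)) (Suc r))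
        \<and> blocked b G ?U r ((s(i := j)) r)"
    proof (cases "r = i")
      case True
      have "blocked b G ?U i j"
        unfolding blocked_def
      proof (intro impI)
        have 1: "?U ! j ! i = T ! j ! Suc i" "j \<noteq> 0 \<Longrightarrow> ?U ! (j - 1) ! Suc i = T ! (j - 1) ! Suc i"
          by (auto simp: U)
        show "if j = 0 then Suc i < length (?U ! 0) \<and> G ! 0 ! Suc i \<le> ?U ! 0 ! i
          else Suc i < length (?U ! (j - 1)) \<and> ?U ! (j - 1) ! Suc i \<le> ?U ! j ! i"
        proof (cases "j = 0")
          case True
          with 1 i j GT show ?thesis by (simp add: below_def)
        next
          case False
          with 1 i j left[of "j - 1"] ss_off_length[OF ss, of "j - 1" j] show ?thesis
            by simp
        qed
      qed
      with True show ?thesis by simp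
    next
      case False
      then have "s r \<le> j \<and> (Suc r < i \<longrightarrow> s r \<le> s (Suc r)) \<and> blocked b G T r (s r)"
        using r s by simp
      with False r show ?thesis
        by (auto simp: blocked_def smaller_at_def U less_Suc_eq)
    qed
  qed
  moreover have "?U ! c ! r \<noteq> b"
    if "c < e \<and> c < length ?U \<and> r < length (?U ! c) \<and> (r, c) \<noteq> (Suc i, j)" for c r
    using that nb[of c r] lt by (auto simp: U)
  moreover have "?U ! j ! r < b" if "r < Suc i" for r
    using that lt ss_off_col[OF ss, of r "Suc i" j] i j by (auto simp: U less_Suc_eq)
  moreover have "?U ! c ! Suc i < b" if "c < j" for c
    using that lt left[of c] by (auto simp: U)
  moreover have "j < t (Suc i)"
    using mono[of "Suc i"] jt by simp
  moreover have "ss_off (Suc i) j ?U"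
    using ss_off_down[OF ss j i tie lt] .
  moreover have "i0 \<le> Suc i" "j < length ?U" "Suc i < length (?U ! j)" "?U ! j ! Suc i = b"
    using i j i0 by (simp_all add: U)
  ultimately show ?thesis
    unfolding sliding_def by blast
qed

lemma sliding_right:
  assumes S: "sliding b G i0 t e i j T" and G: "weakly_increasing G"
    and right: "smaller_at b i (Suc j) T"
    and tie: "smaller_at b (Suc i) j T \<longrightarrow> T ! Suc j ! i < T ! j ! Suc i"
  shows "sliding b G i0 t e i (Suc j) (put i j (T ! Suc j ! i) (put i (Suc j) b T))"
    (is "sliding _ _ _ _ _ _ _ ?U")
proof -
  have j: "Suc j < length T" and i: "i < length (T ! Suc j)" and lt: "T ! Suc j ! i < b"
    using right by (auto simp: smaller_at_def)
  have ss: "ss_off i j T" and GT: "below G T" and i0: "i0 \<le> i" and jt: "j < t i" and i': "i < length (T ! j)"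
    and bt: "\<And>r. r \<ge> i \<Longrightarrow> blocked b G T r (t r)"
    and nb: "\<And>c r. \<lbrakk>c < e; c < length T; r < length (T ! c); (r, c) \<noteq> (i, j)\<rbrakk> \<Longrightarrow> T ! c ! r \<noteq> b"
    and cl: "\<And>c. c < j \<Longrightarrow> T ! c ! i < b"
    using S by (auto simp: sliding_def)
  have U: "?U ! c ! r = (if c = j \<and> r = i then T ! Suc j ! i else if c = Suc j \<and> r = i then b else T ! c ! r)" for c r
    using i j i' by (simp add: nth_put)
  obtain s where s: "\<And>r. \<lbrakk>i0 \<le> r; r < i\<rbrakk> \<Longrightarrow>
        s r \<le> j \<and> (Suc r < i \<longrightarrow> s r \<le> s (Suc r)) \<and> blocked b G T r (s r)"
    using S unfolding sliding_def by blast
  \<comment> \<open>This is the place where paths are kept apart: at the left neighbour of the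
    barrier the entry below is at most the entry to the right, which contradicts a move to the
    right.\<close>
  have jt': "Suc j < t i"
  proof (rule ccontr)
    assume "\<not> Suc j < t i"
    with jt have "t i = Suc j" by simp
    with bt[of i] right have "Suc i < length (T ! j)" "T ! j ! Suc i \<le> T ! Suc j ! i"
      by (auto simp: blocked_def)
    with tie lt j show False by (auto simp: smaller_at_def)
  qed
  have "below G ?U"
    unfolding below_def
  proof (intro conjI allI impI)
    show "map length G = map length ?U" using GT by (simp add: below_def)
    have "G ! j ! i \<le> G ! Suc j ! i" "G ! Suc j ! i \<le> T ! Suc j ! i"
      using G i j below_length[OF GT] below_length_nth[OF GT j] below_le[OF GT j i]
      by (simp_all add: weakly_increasing_def)
    then show "G ! c ! r \<le> ?U ! c ! r" if "c < length ?U" "r < length (?U ! c)" for c r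
      using that below_le[OF GT, of c r] lt by (simp add: U)
  qed
  moreover have "blocked b G ?U r (t r)" if "i \<le> r" for r
    using bt[of r] that jt' by (cases "r = i") (auto simp: blocked_def smaller_at_def U)
  moreover have "\<exists>s. \<forall>r. i0 \<le> r \<and> r < i \<longrightarrow>
        s r \<le> Suc j \<and> (Suc r < i \<longrightarrow> s r \<le> s (Suc r)) \<and> blocked b G ?U r (s r)"
  proof (intro exI[of _ s] allI impI)
    fix r assume r: "i0 \<le> r \<and> r < i"
    then have sr: "s r \<le> j \<and> (Suc r < i \<longrightarrow> s r \<le> s (Suc r)) \<and> blocked b G T r (s r)"
      using s[of r] by simp
    have "?U ! c ! r = T ! c ! r" for c
      using r by (auto simp: U)
    moreover have "s r \<noteq> 0 \<Longrightarrow> ?U ! (s r - 1) ! Suc r = T ! (s r - 1) ! Suc r"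
      using sr by (auto simp: U)
    ultimately show "s r \<le> Suc j \<and> (Suc r < i \<longrightarrow> s r \<le> s (Suc r)) \<and> blocked b G ?U r (s r)"
      using sr by (auto simp: blocked_def smaller_at_def)
  qed
  moreover have "?U ! c ! i < b" if "c < Suc j" for c
    using that lt cl[of c] by (auto simp: U)
  moreover have "?U ! Suc j ! r < b" if "r < i" for r
    using that lt ss_off_col[OF ss, of r i "Suc j"] i j by (auto simp: U)
  moreover have "ss_off i (Suc j) ?U"
    using ss_off_right[OF ss j i tie lt] .
  moreover have "?U ! c ! r \<noteq> b"
    if "c < e \<and> c < length ?U \<and> r < length (?U ! c) \<and> (r, c) \<noteq> (i, Suc j)" for c r
    using that nb[of c r] lt by (auto simp: U)
  moreover have "i0 \<le> i" "Suc j < length ?U" "i < length (?U ! Suc j)" "?U ! Suc j ! i = b"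
    using i j i0 by (simp_all add: U)
  ultimately show ?thesis
    using jt' unfolding sliding_def by blast
qed

section \<open>Semistandardness at the end of a slide\<close>

lemma ssytI:
  assumes "\<And>C. C \<in> set T \<Longrightarrow> C \<noteq> []"
    and "\<And>c c'. \<lbrakk>c < c'; c' < length T\<rbrakk> \<Longrightarrow> length (T ! c') \<le> length (T ! c)"
    and "\<And>r c c'. \<lbrakk>c < c'; c' < length T; r < length (T ! c')\<rbrakk> \<Longrightarrow> T ! c ! r \<le> T ! c' ! r"
    and "\<And>r r' c. \<lbrakk>r < r'; c < length T; r' < length (T ! c)\<rbrakk> \<Longrightarrow> T ! c ! r < T ! c ! r'"
  shows "ssyt T"
  unfolding ssyt_def
proof (intro conjI ballI)
  fix C assume "C \<in> set T"
  then obtain c where "c < length T" "C = T ! c" by (auto simp: in_set_conv_nth)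
  with assms(4) show "sorted_wrt (<) C" by (auto simp: sorted_wrt_iff_nth_less)
  from \<open>C \<in> set T\<close> assms(1) show "C \<noteq> []" by blast
next
  show "sorted_wrt dominates T"
    using assms(2,3) by (auto simp: sorted_wrt_iff_nth_less dominates_def)
qed

lemma ssyt_col: "\<lbrakk>ssyt T; c < length T; r < r'; r' < length (T ! c)\<rbrakk> \<Longrightarrow> T ! c ! r < T ! c ! r'"
  unfolding ssyt_def by (meson nth_mem sorted_wrt_nth_less)

lemma ssyt_dominates: "\<lbrakk>ssyt T; c < c'; c' < length T\<rbrakk> \<Longrightarrow> dominates (T ! c) (T ! c')"
  by (simp add: ssyt_def sorted_wrt_iff_nth_less)

text \<open>Besides semistandardness, the slide has to hand a barrier to the next slide from the
  left. It is formed by the columns in which the path left its rows and, from the last row on, by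
  the column where it stopped.\<close>

lemma slide_spec:
  assumes S: "sliding b G i t e i j T" and G: "weakly_increasing G" and ne: "[] \<notin> set T"
    and t: "\<forall>r\<ge>i. t r \<le> t (Suc r) \<and> t r \<le> e"
  defines "U \<equiv> slide b i j T"
  shows "ssyt U" and "map length U = map length T" and "mset (concat U) = mset (concat T)"
    and "below G U"
    and "\<exists>t e. (\<forall>c r. c < e \<and> c < length U \<and> r < length (U ! c) \<longrightarrow> U ! c ! r \<noteq> b) \<and>
      (\<forall>r\<ge>i. t r \<le> e \<and> t r \<le> t (Suc r) \<and> blocked b G U r (t r))"
proof -
  let ?P = "\<lambda>i' j' T'. sliding b G i t e i' j' T' \<and> map length T' = map length T
    \<and> mset (concat T') = mset (concat T)"
  have "\<exists>i' j'. ?P i' j' U \<and> \<not> smaller_at b (Suc i') j' U \<and> \<not> smaller_at b i' (Suc j') U"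
    unfolding U_def
  proof (rule slide_invariant)
    show "?P i j T" using S by simp
  next
    fix i' j' T'
    assume P: "?P i' j' T'" and lt: "smaller_at b (Suc i') j' T'"
      and tie: "smaller_at b i' (Suc j') T' \<longrightarrow> T' ! j' ! Suc i' \<le> T' ! Suc j' ! i'"
    have "i' < length (T' ! j')" "T' ! j' ! i' = b" "j' < length T'"
      using P by (auto simp: sliding_def)
    with lt have "mset (concat (put i' j' (T' ! j' ! Suc i') (put (Suc i') j' b T'))) = mset (concat T')"
      by (intro mset_concat_swap) (auto simp: smaller_at_def)
    with P show "?P (Suc i') j' (put i' j' (T' ! j' ! Suc i') (put (Suc i') j' b T'))"
      using sliding_down[OF _ G _ lt tie] t by simp
  next
    fix i' j' T'
    assume P: "?P i' j' T'" and lt: "smaller_at b i' (Suc j') T'"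
      and tie: "smaller_at b (Suc i') j' T' \<longrightarrow> T' ! Suc j' ! i' < T' ! j' ! Suc i'"
    have "i' < length (T' ! j')" "T' ! j' ! i' = b" "j' < length T'"
      using P by (auto simp: sliding_def)
    with lt have "mset (concat (put i' j' (T' ! Suc j' ! i') (put i' (Suc j') b T'))) = mset (concat T')"
      by (intro mset_concat_swap) (auto simp: smaller_at_def)
    with P show "?P i' (Suc j') (put i' j' (T' ! Suc j' ! i') (put i' (Suc j') b T'))"
      using sliding_right[OF _ G lt tie] by simp
  qed
  then obtain i' j' where SU: "sliding b G i t e i' j' U" and len: "map length U = map length T"
    and ms: "mset (concat U) = mset (concat T)"
    and stop: "\<not> smaller_at b (Suc i') j' U" "\<not> smaller_at b i' (Suc j') U"
    by blast
  have ss: "ss_off i' j' U" and GU: "below G U" and i': "i \<le> i'" and jt: "j' < t i'"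
    and j: "j' < length U" and i'j': "i' < length (U ! j')" and b: "U ! j' ! i' = b"
    and nb: "\<And>c r. \<lbrakk>c < e; c < length U; r < length (U ! c); (r, c) \<noteq> (i', j')\<rbrakk> \<Longrightarrow> U ! c ! r \<noteq> b"
    and left: "\<And>c. c < j' \<Longrightarrow> U ! c ! i' < b" and upper: "\<And>r. r < i' \<Longrightarrow> U ! j' ! r < b"
    using SU by (auto simp: sliding_def)
  obtain s where s: "\<And>r. \<lbrakk>i \<le> r; r < i'\<rbrakk> \<Longrightarrow>
        s r \<le> j' \<and> (Suc r < i' \<longrightarrow> s r \<le> s (Suc r)) \<and> blocked b G U r (s r)"
    using SU unfolding sliding_def by blast
  \<comment> \<open>Since the path stayed to the left of \<open>t\<close>, it ends in a column
    without another letter \<open>b\<close>. This turns the stopping condition below the box into a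
    strict inequality.\<close>
  have je: "j' < e"
    using jt t i' by (meson less_le_trans)
  have lower: "b < U ! j' ! r" if "i' < r" "r < length (U ! j')" for r
  proof -
    have "b \<le> U ! j' ! Suc i'" "U ! j' ! Suc i' \<noteq> b"
      using stop(1) nb[of j' "Suc i'"] je j that by (auto simp: smaller_at_def)
    moreover have "U ! j' ! Suc i' \<le> U ! j' ! r"
      using ss_off_col[OF ss, of "Suc i'" r j'] j that by (cases "r = Suc i'") auto
    ultimately show ?thesis by simp
  qed
  have right: "b \<le> U ! c ! i'" if "j' < c" "c < length U" "i' < length (U ! c)" for c
  proof -
    have "i' < length (U ! Suc j')" "Suc j' < length U"
      using ss_off_length[OF ss, of "Suc j'" c] that by auto
    then have "b \<le> U ! Suc j' ! i'"
      using stop(2) by (auto simp: smaller_at_def)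
    moreover have "U ! Suc j' ! i' \<le> U ! c ! i'"
      using ss_off_row[OF ss, of "Suc j'" c i'] that by (cases "c = Suc j'") auto
    ultimately show ?thesis by simp
  qed
  show "ssyt U"
  proof (rule ssytI)
    have "[] \<notin> set U"
    proof
      assume "[] \<in> set U"
      then have "0 \<in> set (map length U)" by force
      with ne show False by (simp add: len image_iff)
    qed
    then show "C \<noteq> []" if "C \<in> set U" for C using that by blast
    show "length (U ! c') \<le> length (U ! c)" if "c < c'" "c' < length U" for c c'
      using ss_off_length[OF ss] that by simp
    show "U ! c ! r \<le> U ! c' ! r" if a: "c < c'" "c' < length U" "r < length (U ! c')" for r c c'
    proof -
      consider "r = i'" "c = j'" | "r = i'" "c' = j'" | "(r, c) \<noteq> (i', j')" "(r, c') \<noteq> (i', j')"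
        by blast
      then show ?thesis
        by cases (use a b right[of c'] left[of c] ss_off_row[OF ss, of c c' r] in simp_all)
    qed
    show "U ! c ! r < U ! c ! r'" if a: "r < r'" "c < length U" "r' < length (U ! c)" for r r' c
    proof -
      consider "c = j'" "r = i'" | "c = j'" "r' = i'" | "(r, c) \<noteq> (i', j')" "(r', c) \<noteq> (i', j')"
        by blast
      then show ?thesis
        by cases (use a b upper[of r] lower[of r'] ss_off_col[OF ss, of r r' c] in simp_all)
    qed
  qed
  show "map length U = map length T" "mset (concat U) = mset (concat T)" "below G U"
    by fact+
  show "\<exists>t e. (\<forall>c r. c < e \<and> c < length U \<and> r < length (U ! c) \<longrightarrow> U ! c ! r \<noteq> b) \<and>
      (\<forall>r\<ge>i. t r \<le> e \<and> t r \<le> t (Suc r) \<and> blocked b G U r (t r))"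
  \<comment> \<open>From row i' downwards column j' contains no letter less than \<open>b\<close>,
    so nothing there can be moved and j' is a barrier trivially. All columns to the left of j' are
    free of \<open>b\<close>.\<close>
  proof (intro exI[of _ "\<lambda>r. if r < i' then s r else j'"] exI[of _ j'] conjI allI impI)
    show "U ! c ! r \<noteq> b" if "c < j' \<and> c < length U \<and> r < length (U ! c)" for c r
      using that je by (intro nb) auto
    fix r assume r: "i \<le> r"
    show "(if r < i' then s r else j') \<le> j'"
      "(if r < i' then s r else j') \<le> (if Suc r < i' then s (Suc r) else j')"
      using s[of r] r by auto
    have "blocked b G U r j'" if "i' \<le> r"
      using that lower[of r] b by (cases "r = i'") (auto simp: blocked_def smaller_at_def)
    then show "blocked b G U r (if r < i' then s r else j')"
      using s[of r] r by auto
  qed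
qed

section \<open>Promotion column by column\<close>

definition relabel :: "nat \<Rightarrow> nat \<Rightarrow> nat \<Rightarrow> nat" where
  "relabel a b x = (if x = a then b else if a < x \<and> x \<le> b then x - 1 else x)"

text \<open>\<open>relabel\<close> is not monotone at the letter a. This variant leaves a in place
  and is weakly monotone everywhere, so it turns a semistandard tableau into a weakly increasing
  lower bound; strictness is lost only between a and a + 1.\<close>

definition shift_down :: "nat \<Rightarrow> nat \<Rightarrow> nat \<Rightarrow> nat" where
  "shift_down a b x = (if a < x \<and> x \<le> b then x - 1 else x)"

lemma relabel_eq_shift_down: "x \<noteq> a \<Longrightarrow> relabel a b x = shift_down a b x"
  by (simp add: relabel_def shift_down_def)

lemma shift_down_mono: "x \<le> y \<Longrightarrow> shift_down a b x \<le> shift_down a b y"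
  by (auto simp: shift_down_def)

lemma shift_down_strict_mono:
  "\<lbrakk>x < y; x \<noteq> a; y \<noteq> a\<rbrakk> \<Longrightarrow> shift_down a b x < shift_down a b y"
  by (auto simp: shift_down_def)

lemma smaller_at_Cons [simp]: "smaller_at b i (Suc j) (C # T) = smaller_at b i j T"
  by (simp add: smaller_at_def)

lemma put_Cons [simp]: "put i (Suc j) x (C # T) = C # put i j x T"
  by (simp add: put_def)

text \<open>A slide looks only to the right and down, so columns to the left of its start are
  neither read nor changed.\<close>

lemma slide_Cons: "slide b i (Suc j) (C # T) = C # slide b i j T"
proof (induction b i j T rule: slide.induct)
  case (1 b i j T)
  then show ?case
    unfolding slide.simps[of b i "Suc j" "C # T"] slide.simps[of b i j T] by auto
qed

lemma fold_slide_Cons: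
  "fold (\<lambda>(i, j). slide b i j) (map (\<lambda>(i, j). (i, Suc j)) xs) (C # T)
    = C # fold (\<lambda>(i, j). slide b i j) xs T"
  by (induction xs arbitrary: T) (auto simp: slide_Cons)

lemma pr_inv_Nil [simp]: "pr_inv a b [] = []"
  by (simp add: pr_inv_def)

text \<open>The slides run through the columns from right to left, so those of the first column come
  last, on top of the finished promotion of the others. This recursion is the basis of the
  inductions below.\<close>

lemma pr_inv_Cons:
  "pr_inv a b (C # T) = fold (\<lambda>i. slide b i 0) (filter (\<lambda>i. C ! i = a) [0..<length C])
     (map (relabel a b) C # pr_inv a b T)"
proof -
  let ?hs = "\<lambda>T j. map (\<lambda>i. (i, j)) (filter (\<lambda>i. T ! j ! i = a) [0..<length (T ! j)])"
  have eq: "pr_inv a b T = fold (\<lambda>(i, j). slide b i j) (concat (map (?hs T) (rev [0..<length T])))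
      (map (map (relabel a b)) T)" for T
  proof -
    have "concat (map (\<lambda>i. if P i then [(i, j)] else []) xs) = map (\<lambda>i. (i, j)) (filter P xs)"
      for P and xs :: "nat list" and j :: nat
      by (induction xs) auto
    then show ?thesis
      unfolding pr_inv_def relabel_def by simp
  qed
  have "rev [0..<length (C # T)] = map Suc (rev [0..<length T]) @ [0]"
    by (simp add: rev_map[symmetric] map_Suc_upt upt_conv_Cons del: upt_Suc)
  moreover have "map (?hs (C # T)) (map Suc js) = map (map (\<lambda>(i, j). (i, Suc j))) (map (?hs T) js)" for js
    by simp
  ultimately have "concat (map (?hs (C # T)) (rev [0..<length (C # T)]))
      = map (\<lambda>(i, j). (i, Suc j)) (concat (map (?hs T) (rev [0..<length T]))) @ ?hs (C # T) 0"
    by (simp add: map_concat comp_def del: upt_Suc)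
  then have "pr_inv a b (C # T) = fold (\<lambda>(i, j). slide b i j) (?hs (C # T) 0)
      (map (relabel a b) C # pr_inv a b T)"
    unfolding eq[of "C # T"] by (simp add: fold_slide_Cons eq[of T] del: upt_Suc)
  then show ?thesis
    by (simp add: fold_map comp_def)
qed

lemma filter_index_eq:
  assumes "sorted_wrt (<) C"
  shows "filter (\<lambda>i. C ! i = (a :: nat)) [0..<length C] = [] \<and> a \<notin> set C
    \<or> (\<exists>i<length C. C ! i = a \<and> filter (\<lambda>i. C ! i = a) [0..<length C] = [i])"
proof (cases "a \<in> set C")
  case True
  then obtain i where i: "i < length C" "C ! i = a" by (auto simp: in_set_conv_nth)
  have "distinct C" using assms by (simp add: strict_sorted_iff)
  have "filter (\<lambda>k. C ! k = a) [0..<length C] = filter (\<lambda>k. k = i) [0..<length C]"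
    using i \<open>distinct C\<close> by (intro filter_cong) (auto simp: nth_eq_iff_index_eq)
  also have "filter (\<lambda>k. k = i) [0..<n] = [i]" if "i < n" for n
    using that by (induction n) (auto simp: less_Suc_eq filter_empty_conv)
  finally show ?thesis using i by auto
next
  case False
  then show ?thesis by (auto simp: filter_empty_conv)
qed

text \<open>By induction on the columns from right to left. The entrywise lower bound and the barrier
  \<open>t\<close> carry what the slide starting in the next column has to know: the first bounds the columns
  to its left, and by the second its path stays strictly to the left of the previous one, so
  that no two letters \<open>b\<close> end up in one column.\<close>

lemma pr_inv_main:
  assumes "a \<le> b" and "ssyt T"
  defines "U \<equiv> pr_inv a b T" and "G \<equiv> map (map (shift_down a b)) T"
  shows "ssyt U \<and> map length U = map length T
    \<and> mset (concat U) = image_mset (relabel a b) (mset (concat T)) \<and> below G U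
    \<and> (\<exists>t e. (\<forall>c r. c < e \<and> c < length U \<and> r < length (U ! c) \<longrightarrow> U ! c ! r \<noteq> b) \<and>
        (\<forall>r. (\<forall>c<length T. \<forall>i<length (T ! c). T ! c ! i = a \<longrightarrow> i \<le> r)
          \<longrightarrow> t r \<le> e \<and> t r \<le> t (Suc r) \<and> blocked b G U r (t r)))"
  using assms(2) unfolding U_def G_def
proof (induction T)
  case Nil
  show ?case
    by (auto simp: below_def blocked_def smaller_at_def intro: exI[of _ "\<lambda>_. 0"])
next
  case (Cons C T)
  define T' where "T' = pr_inv a b T"
  define D where "D = map (relabel a b) C"
  define G where "G = map (map (shift_down a b)) T"
  define G2 where "G2 = map (map (shift_down a b)) (C # T)"
  let ?R = "D # T'"
  have C: "sorted_wrt (<) C" "C \<noteq> []" and T: "ssyt T" and CT: "ssyt (C # T)"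
    using Cons.prems by (auto simp: ssyt_Cons)
  note IH = Cons.IH[OF T, folded T'_def G_def]
  have T': "ssyt T'" "map length T' = map length T" "below G T'"
    and ms: "mset (concat T') = image_mset (relabel a b) (mset (concat T))"
    using IH by auto
  have lenT: "length T' = length T"
    using T'(2) by (rule map_eq_imp_length_eq)
  have lenc: "length (T' ! c) = length (T ! c)" if "c < length T" for c
    using T'(2) that lenT by (metis nth_map)
  have D: "D ! r = shift_down a b (C ! r)" if "r < length C" "C ! r \<noteq> a" for r
    using that by (simp add: D_def relabel_eq_shift_down)
  have dom: "length (T ! c) \<le> length C" "\<And>r. r < length (T ! c) \<Longrightarrow> C ! r \<le> T ! c ! r"
    if "c < length T" for c
    using ssyt_dominates[OF CT, of 0 "Suc c"] that by (auto simp: dominates_def)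
  have low: "shift_down a b (T ! c ! r) \<le> T' ! c ! r" if "c < length T" "r < length (T ! c)" for c r
    using T'(3) that lenT lenc by (auto simp: below_def G_def)
  have row: "D ! r \<le> T' ! c ! r" if "c < length T" "r < length (T ! c)" "C ! r \<noteq> a" for c r
    using that dom[of c] low[of c r] shift_down_mono[of "C ! r" "T ! c ! r" a b] D[of r] by simp
  have Ccol: "C ! r < C ! r'" if "r < r'" "r' < length C" for r r'
    using that C by (auto intro: sorted_wrt_nth_less)
  have col: "D ! r < D ! r'" if "r < r'" "r' < length C" "C ! r \<noteq> a" "C ! r' \<noteq> a" for r r'
    using that D Ccol[of r r'] by (simp add: shift_down_strict_mono)
  have lenD: "length D = length C" by (simp add: D_def)
  have belowR: "below G2 ?R"
  proof -
    have "shift_down a b x \<le> relabel a b x" for x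
      using assms(1) by (simp add: shift_down_def relabel_def)
    then have "G2 ! c ! r \<le> ?R ! c ! r" if "c < length ?R" "r < length (?R ! c)" for c r
      using that lenT lenc low by (cases c) (auto simp: G2_def D_def)
    then show ?thesis
      using T'(2) by (auto simp: below_def G2_def lenD comp_def)
  qed
  have Dnb: "D ! r \<noteq> b" if "r < length C" "C ! r \<noteq> a" for r
    using that assms(1) by (auto simp: D shift_down_def)
  from IH obtain t e
    where te: "\<forall>c r. c < e \<and> c < length T' \<and> r < length (T' ! c) \<longrightarrow> T' ! c ! r \<noteq> b"
      "\<forall>r. (\<forall>c<length T. \<forall>i<length (T ! c). T ! c ! i = a \<longrightarrow> i \<le> r)
        \<longrightarrow> t r \<le> e \<and> t r \<le> t (Suc r) \<and> blocked b G T' r (t r)"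
    by (elim conjE exE) (rule that)
  note nb = te(1)[rule_format, OF conjI[OF _ conjI]]
  have t: "t r \<le> e \<and> t r \<le> t (Suc r) \<and> blocked b G T' r (t r)"
    if "\<And>c i. \<lbrakk>c < length T; i < length (T ! c); T ! c ! i = a\<rbrakk> \<Longrightarrow> i \<le> r" for r
    using te(2) that by simp
  \<comment> \<open>The new column on the left raises all column numbers by one.\<close>
  define t2 where "t2 r = Suc (t r)" for r
  have t2: "t2 r \<le> Suc e \<and> t2 r \<le> t2 (Suc r) \<and> blocked b G2 ?R r (t2 r)"
    if holes: "\<And>c i. \<lbrakk>c < length T; i < length (T ! c); T ! c ! i = a\<rbrakk> \<Longrightarrow> i \<le> r"
      and nohole: "Suc r < length C \<Longrightarrow> C ! Suc r \<noteq> a" for r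
  proof -
    have bl: "blocked b G T' r (t r)" using t[OF holes] by simp
    have "blocked b G2 ?R r (Suc (t r))"
      unfolding blocked_def
    proof (intro impI)
      assume "smaller_at b r (Suc (t r)) ?R"
      then have sm: "smaller_at b r (t r) T'" by simp
      show "if Suc (t r) = 0 then Suc r < length (?R ! 0) \<and> G2 ! 0 ! Suc r \<le> ?R ! 0 ! r
        else Suc r < length (?R ! (Suc (t r) - 1)) \<and> ?R ! (Suc (t r) - 1) ! Suc r \<le> ?R ! Suc (t r) ! r"
      proof (cases "t r")
        \<comment> \<open>A barrier in the first column of \<open>T\<close> was stated with
          \<open>G\<close> in place of the missing left column. That column is now \<open>D\<close>,
          and its entry in the next row is bounded by that of \<open>G\<close>, provided that it
          does not come from the letter a.\<close>
        case 0
        with sm have "T \<noteq> []" using lenT by (auto simp: smaller_at_def)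
        with 0 sm bl have 1: "Suc r < length (T ! 0)" "G ! 0 ! Suc r \<le> T' ! 0 ! r"
          using lenc[of 0] by (auto simp: blocked_def)
        then have "D ! Suc r \<le> G ! 0 ! Suc r"
          using D[of "Suc r"] nohole dom[of 0] \<open>T \<noteq> []\<close> by (auto simp: G_def intro: shift_down_mono)
        with 0 1 dom(1)[of 0] \<open>T \<noteq> []\<close> show ?thesis by (simp add: lenD)
      next
        case (Suc c)
        with sm bl show ?thesis by (auto simp: blocked_def)
      qed
    qed
    then show ?thesis using t[OF holes] by (simp add: t2_def)
  qed
  have nb2: "?R ! c ! r \<noteq> b"
    if "c < Suc e" "c < length ?R" "r < length (?R ! c)" "c = 0 \<Longrightarrow> C ! r \<noteq> a" for c r
    using that nb Dnb by (cases c) (auto simp: lenD)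
  have msR: "mset (concat ?R) = image_mset (relabel a b) (mset (concat (C # T)))"
    by (simp add: ms D_def)
  have mlR: "map length ?R = map length (C # T)"
    by (simp add: T'(2) lenD)
  from filter_index_eq[OF C(1), of a] show ?case
  proof (elim disjE conjE exE)
    assume "filter (\<lambda>i. C ! i = a) [0..<length C] = []" and a: "a \<notin> set C"
    then have eq: "pr_inv a b (C # T) = ?R"
      by (simp add: pr_inv_Cons D_def T'_def)
    have na: "C ! r \<noteq> a" if "r < length C" for r using a that by auto
    have nT: "T' \<noteq> [] \<longleftrightarrow> T \<noteq> []" using lenT by auto
    have "sorted_wrt (<) D"
      using col na by (simp add: sorted_wrt_iff_nth_less lenD)
    moreover have "D \<noteq> []" using C by (simp add: D_def)
    moreover have "dominates D (hd T')" if "T' \<noteq> []"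
      using that nT row[of 0] dom[of 0] lenc[of 0] na
      by (auto simp: dominates_def hd_conv_nth lenD)
    ultimately have "ssyt ?R"
      using T' by (simp add: ssyt_Cons)
    moreover have "\<exists>t e. (\<forall>c r. c < e \<and> c < length ?R \<and> r < length (?R ! c) \<longrightarrow> ?R ! c ! r \<noteq> b) \<and>
        (\<forall>r. (\<forall>c<length (C # T). \<forall>i<length ((C # T) ! c). (C # T) ! c ! i = a \<longrightarrow> i \<le> r)
          \<longrightarrow> t r \<le> e \<and> t r \<le> t (Suc r) \<and> blocked b G2 ?R r (t r))"
    proof (intro exI[of _ t2] exI[of _ "Suc e"] conjI[OF _ allI] allI impI)
      show "?R ! c ! r \<noteq> b" if "c < Suc e \<and> c < length ?R \<and> r < length (?R ! c)" for c r
        using that na by (intro nb2) (auto simp: lenD)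
      fix r assume r: "\<forall>c<length (C # T). \<forall>i<length ((C # T) ! c). (C # T) ! c ! i = a \<longrightarrow> i \<le> r"
      show "t2 r \<le> Suc e \<and> t2 r \<le> t2 (Suc r) \<and> blocked b G2 ?R r (t2 r)"
      proof (rule t2)
        show "i \<le> r" if "c < length T" "i < length (T ! c)" "T ! c ! i = a" for c i
          using r[rule_format, of "Suc c" i] that by simp
      qed (use na in auto)
    qed
    ultimately show ?thesis
      unfolding eq using msR mlR belowR G2_def by blast
  next
    fix i assume i: "i < length C" "C ! i = a"
      and f: "filter (\<lambda>i. C ! i = a) [0..<length C] = [i]"
    then have eq: "pr_inv a b (C # T) = slide b i 0 ?R"
      by (simp add: pr_inv_Cons D_def T'_def)
    have na: "C ! r \<noteq> a" if "r < length C" "r \<noteq> i" for r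
      using that i Ccol[of r i] Ccol[of i r] by (cases r i rule: linorder_cases) auto
    \<comment> \<open>To the right of the letter a of \<open>C\<close>, row i has entries at least
      a, so a occurs there in rows up to i only. Hence the barrier is available in all rows which
      the new slide can visit.\<close>
    have holes: "i' \<le> r" if "c < length T" "i' < length (T ! c)" "T ! c ! i' = a" "i \<le> r" for c i' r
    proof (rule ccontr)
      assume "\<not> i' \<le> r"
      with that have "C ! i < C ! i'" "C ! i' \<le> a"
        using Ccol[of i i'] dom[of c] by auto
      with i show False by simp
    qed
    have t2i: "t2 r \<le> Suc e \<and> t2 r \<le> t2 (Suc r) \<and> blocked b G2 ?R r (t2 r)" if "i \<le> r" for r
      using that holes na by (intro t2) auto
    have "ss_off i 0 ?R"
      unfolding ss_off_def
    proof (intro conjI allI impI)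
      show "length (?R ! c') \<le> length (?R ! c)" if "c \<le> c' \<and> c' < length ?R" for c c'
        using that ssyt_dominates[OF CT, of c c'] lenT lenc
        by (cases c; cases c') (auto simp: dominates_def lenD le_less)
      show "?R ! c ! r \<le> ?R ! c' ! r"
        if "c < c' \<and> c' < length ?R \<and> r < length (?R ! c') \<and> (r, c) \<noteq> (i, 0) \<and> (r, c') \<noteq> (i, 0)" for r c c'
      proof (cases c)
        case 0
        with that obtain d where "c' = Suc d" "d < length T" by (cases c') (auto simp: lenT)
        with 0 that row[of d r] na[of r] dom[of d] lenc[of d] show ?thesis by auto
      next
        case (Suc d)
        with that obtain d' where "c' = Suc d'" "d < d'" "d' < length T'" by (cases c') auto
        with Suc that ssyt_dominates[OF T'(1), of d d'] show ?thesis by (auto simp: dominates_def)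
      qed
      show "?R ! c ! r < ?R ! c ! r'"
        if "r < r' \<and> c < length ?R \<and> r' < length (?R ! c) \<and> (r, c) \<noteq> (i, 0) \<and> (r', c) \<noteq> (i, 0)" for r r' c
        using that col[of r r'] na ssyt_col[OF T'(1), of "c - 1" r r'] by (cases c) (auto simp: lenD)
    qed
    moreover have "?R ! 0 ! r < b" if "r < i" for r
      using that i Ccol[of r i] assms(1) by (simp add: D_def relabel_def)
    moreover have "D ! i = b"
      using i by (simp add: D_def relabel_def)
    moreover have "?R ! c ! r \<noteq> b"
      if "c < Suc e \<and> c < length ?R \<and> r < length (?R ! c) \<and> (r, c) \<noteq> (i, 0)" for c r
      using that na by (intro nb2) (auto simp: lenD)
    ultimately have S: "sliding b G2 i t2 (Suc e) i 0 ?R"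
      using i t2i belowR unfolding sliding_def by (auto simp: lenD t2_def)
    have G2n: "G2 ! c = map (shift_down a b) ((C # T) ! c)" if "c < length (C # T)" for c
      unfolding G2_def using that by (rule nth_map)
    have lenG2: "length G2 = length (C # T)" by (simp add: G2_def)
    have G2: "weakly_increasing G2"
      unfolding weakly_increasing_def
    proof (intro conjI allI impI)
      show "G2 ! c ! r \<le> G2 ! c ! Suc r" if "c < length G2 \<and> Suc r < length (G2 ! c)" for c r
        using that ssyt_col[OF CT, of c r "Suc r"] G2n[of c]
        by (simp add: lenG2 shift_down_mono)
      show "G2 ! c ! r \<le> G2 ! Suc c ! r" if "Suc c < length G2 \<and> r < length (G2 ! Suc c)" for c r
      proof -
        have "dominates ((C # T) ! c) ((C # T) ! Suc c)"
          using that ssyt_dominates[OF CT, of c "Suc c"] by (simp add: lenG2)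
        with that G2n[of c] G2n[of "Suc c"] show ?thesis
          by (simp add: lenG2 dominates_def shift_down_mono)
      qed
    qed
    have ne: "[] \<notin> set ?R"
      using T'(1) C by (auto simp: D_def ssyt_def)
    note spec = slide_spec[OF S G2 ne, folded eq]
    have spec: "ssyt (pr_inv a b (C # T))" "map length (pr_inv a b (C # T)) = map length ?R"
      "mset (concat (pr_inv a b (C # T))) = mset (concat ?R)" "below G2 (pr_inv a b (C # T))"
      "\<exists>t e. (\<forall>c r. c < e \<and> c < length (pr_inv a b (C # T)) \<and> r < length (pr_inv a b (C # T) ! c)
          \<longrightarrow> pr_inv a b (C # T) ! c ! r \<noteq> b) \<and>
        (\<forall>r\<ge>i. t r \<le> e \<and> t r \<le> t (Suc r) \<and> blocked b G2 (pr_inv a b (C # T)) r (t r))"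
      using spec t2i by blast+
    have i_le: "i \<le> r" if "\<forall>c<length (C # T). \<forall>i<length ((C # T) ! c). (C # T) ! c ! i = a \<longrightarrow> i \<le> r" for r
      using that[rule_format, of 0 i] i by simp
    from spec(5) obtain t' e'
      where te': "\<forall>c r. c < e' \<and> c < length (pr_inv a b (C # T)) \<and> r < length (pr_inv a b (C # T) ! c)
          \<longrightarrow> pr_inv a b (C # T) ! c ! r \<noteq> b"
        "\<forall>r\<ge>i. t' r \<le> e' \<and> t' r \<le> t' (Suc r) \<and> blocked b G2 (pr_inv a b (C # T)) r (t' r)"
      by (elim conjE exE) (rule that)
    have "\<exists>t e. (\<forall>c r. c < e \<and> c < length (pr_inv a b (C # T)) \<and> r < length (pr_inv a b (C # T) ! c)
          \<longrightarrow> pr_inv a b (C # T) ! c ! r \<noteq> b) \<and>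
        (\<forall>r. (\<forall>c<length (C # T). \<forall>i<length ((C # T) ! c). (C # T) ! c ! i = a \<longrightarrow> i \<le> r)
          \<longrightarrow> t r \<le> e \<and> t r \<le> t (Suc r) \<and> blocked b G2 (pr_inv a b (C # T)) r (t r))"
      by (rule exI[of _ t'], rule exI[of _ e'], rule conjI[OF te'(1)])
        (intro allI impI, rule te'(2)[rule_format], rule i_le)
    with spec(1-4) msR mlR show ?thesis
      unfolding G2_def by simp
  qed
qed

section \<open>Promotion next to columns (1,...,m)\<close>

definition tableaux :: "nat \<Rightarrow> tableau set" where
  "tableaux m = {T. ssyt T \<and> set (concat T) \<subseteq> {1..m}}"

lemma ssyt_entry_ge:
  assumes "ssyt T" and "0 \<notin> set (concat T)" and "c < length T" and "r < length (T ! c)"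
  shows "Suc r \<le> T ! c ! r"
  using assms(4)
proof (induction r)
  case 0
  then have "T ! c ! 0 \<in> set (concat T)" using assms(3) by (auto intro!: bexI[of _ "T ! c"])
  with assms(2) show ?case by (metis One_nat_def Suc_leI gr0I)
next
  case (Suc r)
  with ssyt_col[OF assms(1,3), of r "Suc r"] show ?case by simp
qed

lemma pr_inv_spec:
  assumes "a \<le> b" and "ssyt T"
  shows "ssyt (pr_inv a b T)" and "mset (concat (pr_inv a b T)) = image_mset (relabel a b) (mset (concat T))"
  using pr_inv_main[OF assms] by blast+

lemma relabel_range: "\<lbrakk>1 \<le> a; a \<le> b; b \<le> m; x \<in> {1..m}\<rbrakk> \<Longrightarrow> relabel a b x \<in> {1..m}"
  by (auto simp: relabel_def)

lemma pr_inv_tableaux: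
  assumes "1 \<le> a" "a \<le> b" "b \<le> m" and "T \<in> tableaux m"
  shows "pr_inv a b T \<in> tableaux m"
proof -
  have "set (concat (pr_inv a b T)) = relabel a b ` set (concat T)"
    using pr_inv_spec(2)[OF assms(2), of T] assms(4)
    by (metis (no_types, lifting) mem_Collect_eq set_image_mset set_mset_mset tableaux_def)
  also have "\<dots> \<subseteq> {1..m}"
    using assms relabel_range[OF assms(1-3)] unfolding tableaux_def by blast
  finally show ?thesis
    using pr_inv_spec(1)[OF assms(2), of T] assms(4) by (simp add: tableaux_def)
qed

text \<open>\<open>K i\<close> is the relabelled column (1,...,m) once the letter \<open>b\<close>
  has come down to row i: above it stand 1,...,i, below it i+1,...,b-1 and b+1,...,m. The letter i+1
  directly below is at most the entry to the right, so even a tie leads downwards, and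
  \<open>K (b - 1)\<close> is (1,...,m) again.\<close>

lemma slide_initial_column:
  fixes b m :: nat
  defines "K \<equiv> \<lambda>i. map (\<lambda>r. if r < i then Suc r else if r = i then b else if r < b then r else Suc r) [0..<m]"
  assumes "i < b" and "b \<le> m"
    and T: "\<And>r. \<lbrakk>T \<noteq> []; r < length (T ! 0)\<rbrakk> \<Longrightarrow> Suc r \<le> T ! 0 ! r"
  shows "slide b i 0 (K i # T) = [1..<Suc m] # T"
  using assms(2)
proof (induction "b - Suc i" arbitrary: i)
  case 0
  then have b: "b = Suc i" by simp
  have "\<not> smaller_at b (Suc i) 0 (K i # T)"
    by (auto simp: smaller_at_def K_def b)
  moreover have "\<not> smaller_at b i (Suc 0) (K i # T)"
    using T[of i] by (auto simp: smaller_at_def b)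
  ultimately have "slide b i 0 (K i # T) = K i # T"
    by (simp add: slide.simps)
  moreover have "K i = [1..<Suc m]"
    by (rule nth_equalityI) (auto simp: K_def b simp del: upt_Suc)
  ultimately show ?case by simp
next
  case (Suc d)
  then have i: "Suc i < b" by simp
  have len: "length (K i) = m" and nthK: "K i ! Suc i = Suc i"
    using i \<open>b \<le> m\<close> by (simp_all add: K_def)
  have "smaller_at b (Suc i) 0 (K i # T)"
    using i \<open>b \<le> m\<close> by (simp add: smaller_at_def len nthK)
  moreover have "smaller_at b i (Suc 0) (K i # T) \<longrightarrow> Suc i \<le> T ! 0 ! i"
    using T[of i] by (auto simp: smaller_at_def)
  ultimately have "slide b i 0 (K i # T)
      = slide b (Suc i) 0 (put i 0 (Suc i) (put (Suc i) 0 b (K i # T)))"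
    by (subst slide.simps) (simp add: nthK)
  also have "put i 0 (Suc i) (put (Suc i) 0 b (K i # T)) = K (Suc i) # T"
    using i \<open>b \<le> m\<close>
    by (auto simp: put_def K_def nth_list_update intro!: nth_equalityI)
  also have "slide b (Suc i) 0 (K (Suc i) # T) = [1..<Suc m] # T"
    using Suc i by simp
  finally show ?case .
qed

lemma pr_inv_initial_column:
  assumes ab: "1 \<le> a" "a \<le> b" "b \<le> m" and T: "T \<in> tableaux m"
  shows "pr_inv a b ([1..<Suc m] # T) = [1..<Suc m] # pr_inv a b T"
proof -
  have "sorted_wrt (<) [1..<Suc m]" by (simp del: upt_Suc)
  moreover have "a \<in> set [1..<Suc m]" using ab by auto
  ultimately obtain i where "i < m" "[1..<Suc m] ! i = a"
    and "filter (\<lambda>i. [1..<Suc m] ! i = a) [0..<length [1..<Suc m]] = [i]"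
    using filter_index_eq[of "[1..<Suc m]" a] by (auto simp del: upt_Suc)
  moreover from this have "i = a - 1" by (simp del: upt_Suc)
  ultimately have "pr_inv a b ([1..<Suc m] # T)
      = slide b (a - 1) 0 (map (relabel a b) [1..<Suc m] # pr_inv a b T)"
    by (simp add: pr_inv_Cons del: upt_Suc)
  also have "map (relabel a b) [1..<Suc m]
      = map (\<lambda>r. if r < a - 1 then Suc r else if r = a - 1 then b else if r < b then r else Suc r) [0..<m]"
    using ab by (auto simp: relabel_def simp del: upt_Suc intro!: nth_equalityI)
  also have "slide b (a - 1) 0 (\<dots> # pr_inv a b T) = [1..<Suc m] # pr_inv a b T"
  proof (rule slide_initial_column)
    \<comment> \<open>The bound concerns the neighbouring column after its own slides; this is why
      promotion had to be shown to produce semistandard tableaux.\<close>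
    have "0 \<notin> set (concat (pr_inv a b T))" "ssyt (pr_inv a b T)"
      using pr_inv_tableaux[OF ab T] unfolding tableaux_def by auto
    then show "Suc r \<le> pr_inv a b T ! 0 ! r" if "pr_inv a b T \<noteq> []" "r < length (pr_inv a b T ! 0)" for r
      using that by (intro ssyt_entry_ge) auto
  qed (use ab in auto)
  finally show ?thesis .
qed

lemma tableaux_column_length:
  assumes "T \<in> tableaux m" "C \<in> set T"
  shows "length C \<le> m"
proof -
  have "sorted_wrt (<) C" "set C \<subseteq> {1..m}"
    using assms unfolding tableaux_def ssyt_def by fastforce+
  then show ?thesis
    using card_mono[of "{1..m}" "set C"] by (simp add: strict_sorted_iff distinct_card)
qed

lemma initial_column_tableaux:
  assumes "1 \<le> r" "r \<le> m" and "T \<in> tableaux m" and "\<And>C. C \<in> set T \<Longrightarrow> length C \<le> r"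
  shows "[1..<Suc r] # T \<in> tableaux m"
proof -
  have T: "ssyt T" "0 \<notin> set (concat T)" using assms(3) unfolding tableaux_def by fastforce+
  have "dominates [1..<Suc r] (hd T)" if "T \<noteq> []"
    using ssyt_entry_ge[OF T, of 0] that assms(4)[of "hd T"]
    by (auto simp: dominates_def hd_conv_nth simp del: upt_Suc)
  with assms show ?thesis
    by (auto simp: tableaux_def ssyt_Cons simp del: upt_Suc)
qed

lemma prepend_cols_tableaux:
  assumes "1 \<le> r" "r \<le> m" and "T \<in> tableaux m" and "\<And>C. C \<in> set T \<Longrightarrow> length C \<le> r"
  shows "prepend_cols r M T \<in> tableaux m"
proof (induction M)
  case (Suc M)
  have "[1..<Suc r] # prepend_cols r M T \<in> tableaux m"
    using assms(1,2) Suc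
    by (rule initial_column_tableaux) (use assms(4) in \<open>auto simp: prepend_cols_def simp del: upt_Suc\<close>)
  then show ?case by (simp add: prepend_cols_def del: upt_Suc)
qed (use assms in \<open>simp add: prepend_cols_def\<close>)

lemma pr_inv_prepend_cols:
  assumes ab: "1 \<le> a" "a \<le> b" "b \<le> m" and T: "T \<in> tableaux m"
  shows "pr_inv a b (prepend_cols m M T) = prepend_cols m M (pr_inv a b T)"
proof (induction M)
  case (Suc M)
  have "prepend_cols m M T \<in> tableaux m"
    using ab T tableaux_column_length[OF T] by (intro prepend_cols_tableaux) auto
  from pr_inv_initial_column[OF ab this] Suc show ?case
    by (simp add: prepend_cols_def del: upt_Suc)
qed (simp add: prepend_cols_def)

lemma Phi_factors_range:
  assumes "1 \<le> n" and "(a, b) \<in> set (Phi_factors n)"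
  shows "1 \<le> a \<and> a \<le> b \<and> b \<le> 2 * n"
  using assms by (auto simp: Phi_factors_def)

lemma fold_pr_inv_prepend_cols:
  assumes "\<And>a b. (a, b) \<in> set fs \<Longrightarrow> 1 \<le> a \<and> a \<le> b \<and> b \<le> m" and "T \<in> tableaux m"
  shows "fold (\<lambda>(a, b). pr_inv a b) fs (prepend_cols m M T)
    = prepend_cols m M (fold (\<lambda>(a, b). pr_inv a b) fs T)"
  using assms
proof (induction fs arbitrary: T)
  case (Cons f fs)
  obtain a b where f: "f = (a, b)" by fastforce
  with Cons.prems have ab: "1 \<le> a" "a \<le> b" "b \<le> m" by auto
  have "1 \<le> a \<and> a \<le> b \<and> b \<le> m" if "(a, b) \<in> set fs" for a b
    using Cons.prems(1)[of a b] that by auto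
  from Cons.IH[OF this pr_inv_tableaux[OF ab Cons.prems(2)]] show ?case
    using pr_inv_prepend_cols[OF ab Cons.prems(2)] by (simp add: f)
qed simp

lemma Phi_inv_prepend_cols:
  assumes "1 \<le> n" and "T \<in> tableaux (2 * n)"
  shows "Phi_inv n (prepend_cols (2 * n) M T) = prepend_cols (2 * n) M (Phi_inv n T)"
  unfolding Phi_inv_def
  by (rule fold_pr_inv_prepend_cols[OF Phi_factors_range[OF assms(1)] assms(2)])

section \<open>Weights\<close>

lemma inj_relabel: "\<lbrakk>1 \<le> a; a \<le> b\<rbrakk> \<Longrightarrow> inj (relabel a b)"
  by (rule injI) (auto simp: relabel_def split: if_splits)

lemma entry_count_mset: "entry_count T x = int (count (mset (concat T)) x)"
  by (simp add: entry_count_def count_mset)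

lemma entry_count_pr_inv:
  assumes "1 \<le> a" "a \<le> b" and "ssyt T"
  shows "entry_count (pr_inv a b T) (relabel a b x) = entry_count T x"
proof -
  have "count (image_mset (relabel a b) M) (relabel a b x) = count M x" for M
    using inj_relabel[OF assms(1,2)] by (induction M) (auto simp: inj_eq)
  then show ?thesis
    using pr_inv_spec(2)[OF assms(2,3)] by (simp only: entry_count_mset)
qed

lemma entry_count_fold_pr_inv:
  assumes "\<And>a b. (a, b) \<in> set fs \<Longrightarrow> 1 \<le> a \<and> a \<le> b" and "ssyt T"
  shows "entry_count (fold (\<lambda>(a, b). pr_inv a b) fs T) (fold (\<lambda>(a, b). relabel a b) fs x) = entry_count T x"
  using assms
proof (induction fs arbitrary: T x)
  case (Cons f fs)
  obtain a b where f: "f = (a, b)" by fastforce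
  with Cons.prems have ab: "1 \<le> a" "a \<le> b" by auto
  have "1 \<le> a \<and> a \<le> b" if "(a, b) \<in> set fs" for a b
    using Cons.prems(1)[of a b] that by auto
  from Cons.IH[OF this pr_inv_spec(1)[OF ab(2) Cons.prems(2)]] show ?case
    using entry_count_pr_inv[OF ab Cons.prems(2)] by (simp add: f)
qed simp

lemma filter_odd_upt: "filter odd [3..<Suc n] = map (\<lambda>i. 2 * i + 3) [0..<(n - 1) div 2]"
proof (induction n)
  case (Suc n)
  show ?case
  proof (cases "2 \<le> n \<and> even n")
    case True
    then obtain q where "n = 2 * Suc q" by (metis evenE not_numeral_le_zero old.nat.exhaust mult_0_right)
    with Suc show ?thesis by simp
  next
    case False
    then have "n div 2 = (n - 1) div 2" by (cases "n = 1") (auto elim!: oddE)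
    with False Suc show ?thesis by auto
  qed
qed simp

text \<open>After (1, 2n) and q pairs of factors, the letters with k \<le> 2q+1 have reached their
  final places, and all others have been lowered by 2q+1, one for each factor. In the next pair,
  with j = 2q+3, the letter \<open>v (2*q+2)\<close> is at j and is sent up by the first factor
  while its partner is already in place; the first factor also brings \<open>v (2*q+3)\<close> to j,
  and the second sends it up. The alternation of u and v with the parity of k makes the right letter
  arrive at j.\<close>

lemma fold_relabel_Phi_factors:
  assumes "1 \<le> n" and k: "1 \<le> k" "k \<le> n"
  shows "fold (\<lambda>(a, b). relabel a b) (Phi_factors n) (u k) = k"
    and "fold (\<lambda>(a, b). relabel a b) (Phi_factors n) (v k) = 2 * n - k + 1"
proof -
  let ?f = "\<lambda>j. [(j, 2 * n - (j - 1) + 1), (j, 2 * n - j + 1)]"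
  let ?F = "\<lambda>q. fold (\<lambda>(a, b). relabel a b) ((1, 2 * n) # concat (map ?f (map (\<lambda>i. 2 * i + 3) [0..<q])))"
  have F: "?F q (u k) = (if k \<le> 2 * q + 1 then k else u k - 1 - 2 * q) \<and>
      ?F q (v k) = (if k \<le> 2 * q + 1 then 2 * n - k + 1 else v k - 1 - 2 * q)"
    if "q \<le> (n - 1) div 2" for q
    using that
  proof (induction q)
    case 0
    then show ?case using assms by (auto simp: u_def v_def relabel_def)
  next
    case (Suc q)
    define j where "j = 2 * q + 3"
    have q: "j \<le> n" using Suc.prems by (simp add: j_def)
    have step: "?F (Suc q) x = relabel j (2 * n - j + 1) (relabel j (2 * n - (j - 1) + 1) (?F q x))" for x
      by (simp add: j_def add.commute)
    have IH: "?F q (u k) = (if k \<le> 2 * q + 1 then k else u k - 1 - 2 * q)"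
      "?F q (v k) = (if k \<le> 2 * q + 1 then 2 * n - k + 1 else v k - 1 - 2 * q)"
      using Suc by simp_all
    define c where "c = 2 * n - j + 1"
    have c: "2 * n - (j - 1) + 1 = Suc c" "j \<le> c" "2 * n - k + 1 = c + j - k"
      using q k by (simp_all add: c_def j_def)
    have fixed: "relabel j c (relabel j (Suc c) x) = x" if "x < j \<or> Suc c < x" for x
      using that c(2) by (auto simp: relabel_def)
    consider "k \<le> 2 * q + 1" | "k = 2 * q + 2" | "k = 2 * q + 3" | "k > 2 * q + 3" by linarith
    then show ?case (is ?goal)
    proof cases
      case 1
      moreover have "k < j" "Suc c < c + j - k" using 1 by (simp_all add: j_def)
      ultimately show ?goal unfolding step IH c c_def[symmetric] by (simp add: fixed)
    next
      case 2
      then have "u k = 4 * q + 3" "v k = 4 * q + 4" by (simp_all add: u_def v_def)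
      with 2 have uv: "u k - 1 - 2 * q = k" "v k - 1 - 2 * q = j" by (simp_all add: j_def)
      have "relabel j c (relabel j (Suc c) j) = Suc c" using c(2) by (simp add: relabel_def)
      with 2 fixed[of k] show ?goal unfolding step IH c c_def[symmetric] uv by (simp add: j_def)
    next
      case 3
      then have "u k = 4 * q + 6" "v k = 4 * q + 5" by (simp_all add: u_def v_def)
      with 3 have uv: "u k - 1 - 2 * q = j + 2" "v k - 1 - 2 * q = Suc j" by (simp_all add: j_def)
      have "j + 1 \<le> c" using q 3 k by (simp add: c_def j_def)
      then have "relabel j c (relabel j (Suc c) (j + 2)) = j" "relabel j c (relabel j (Suc c) (Suc j)) = c"
        using c(2) by (simp_all add: relabel_def)
      with 3 show ?goal unfolding step IH c c_def[symmetric] uv by (simp add: j_def)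
    next
      case 4
      moreover have "2 * k - 1 \<le> u k" "u k \<le> 2 * k" "2 * k - 1 \<le> v k" "v k \<le> 2 * k"
        by (simp_all add: u_def v_def)
      moreover from this 4 have "j + 3 \<le> u k - 1 - 2 * q" "u k - 1 - 2 * q \<le> Suc c"
        "j + 3 \<le> v k - 1 - 2 * q" "v k - 1 - 2 * q \<le> Suc c"
        using q k by (simp_all add: c_def j_def)
      moreover have "relabel j c (relabel j (Suc c) x) = x - 2"
        if "j + 3 \<le> x" "x \<le> Suc c" for x
        using that by (auto simp: relabel_def)
      ultimately show ?goal unfolding step IH c c_def[symmetric] by simp
    qed
  qed
  have P: "fold (\<lambda>(a, b). relabel a b) (Phi_factors n) = ?F ((n - 1) div 2)"
    unfolding Phi_factors_def filter_odd_upt by simp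
  show "fold (\<lambda>(a, b). relabel a b) (Phi_factors n) (u k) = k"
    "fold (\<lambda>(a, b). relabel a b) (Phi_factors n) (v k) = 2 * n - k + 1"
  proof -
    \<comment> \<open>For even n the index n belongs to no complete pair of factors; its letters,
      lowered by n - 1, already are n and n + 1.\<close>
    have "k \<le> 2 * ((n - 1) div 2) + 1 \<or> (even n \<and> k = n \<and> 2 * ((n - 1) div 2) + 2 = n)"
      using k by (cases "even n") (auto elim!: evenE oddE)
    then show "fold (\<lambda>(a, b). relabel a b) (Phi_factors n) (u k) = k"
      "fold (\<lambda>(a, b). relabel a b) (Phi_factors n) (v k) = 2 * n - k + 1"
      using F[of "(n - 1) div 2"] k unfolding P by (auto simp: u_def v_def)
  qed
qed

lemma wt_g_Phi_inv:
  assumes "1 \<le> n" and "ssyt T"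
  shows "wt_g n (Phi_inv n T) = wt_k n T"
proof -
  have "entry_count (Phi_inv n T) (fold (\<lambda>(a, b). relabel a b) (Phi_factors n) x) = entry_count T x" for x
    unfolding Phi_inv_def
    by (rule entry_count_fold_pr_inv) (use Phi_factors_range[OF assms(1)] assms(2) in blast)+
  note eq = this
  have "entry_count (Phi_inv n T) k = entry_count T (u k)"
    "entry_count (Phi_inv n T) (2 * n - k + 1) = entry_count T (v k)" if "1 \<le> k" "k \<le> n" for k
    using eq[of "u k"] eq[of "v k"] fold_relabel_Phi_factors[OF assms(1) that] by simp_all
  then show ?thesis
    unfolding wt_g_def wt_k_def by (auto simp del: upt_Suc)
qed

lemma count_list_upt: "count_list [a..<b] x = (if a \<le> x \<and> x < b then 1 else 0)"
  by (induction b) auto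

lemma wt_initial_column:
  shows "wt_g n [[1..<Suc (2 * n)]] = replicate n 0" and "wt_k n [[1..<Suc (2 * n)]] = replicate n 0"
  by (auto simp: wt_g_def wt_k_def entry_count_def count_list_upt u_def v_def simp del: upt_Suc
      intro!: nth_equalityI)

section \<open>Column insertion\<close>

text \<open>Insertion is rewritten in terms of positions, because neighbouring columns are compared
  row by row. A position equal to the length of the column means that the letter is
  appended.\<close>

definition insert_pos :: "nat \<Rightarrow> nat list \<Rightarrow> nat" where
  "insert_pos a C = length (takeWhile (\<lambda>x. x < a) C)"

definition insert_col :: "nat \<Rightarrow> nat list \<Rightarrow> nat list" where
  "insert_col a C = take (insert_pos a C) C @ a # drop (Suc (insert_pos a C)) C"

lemma insert_pos_le: "insert_pos a C \<le> length C"
  by (simp add: insert_pos_def length_takeWhile_le)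

lemma nth_less_insert_pos: "r < insert_pos a C \<Longrightarrow> C ! r < a"
  unfolding insert_pos_def by (metis nth_mem set_takeWhileD takeWhile_nth)

lemma nth_insert_pos: "insert_pos a C < length C \<Longrightarrow> a \<le> C ! insert_pos a C"
  unfolding insert_pos_def by (meson linorder_not_le nth_length_takeWhile)

lemma length_insert_col: "length (insert_col a C) = max (length C) (Suc (insert_pos a C))"
  using insert_pos_le[of a C] by (simp add: insert_col_def)

lemma nth_insert_col:
  "r < length (insert_col a C) \<Longrightarrow> insert_col a C ! r = (if r = insert_pos a C then a else C ! r)"
  using insert_pos_le[of a C]
  by (auto simp: insert_col_def nth_append nth_Cons' min_def length_insert_col)

lemma col_insert_Nil: "col_insert a [] = [insert_col a []]"
  by (simp add: insert_col_def insert_pos_def)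

lemma col_insert_Cons:
  "col_insert a (C # T) = insert_col a C #
     (if insert_pos a C < length C then col_insert (C ! insert_pos a C) T else T)"
proof (cases "dropWhile (\<lambda>x. x < a) C")
  case Nil
  then have "takeWhile (\<lambda>x. x < a) C = C" by (metis append_Nil2 takeWhile_dropWhile_id)
  then have "insert_pos a C = length C" by (simp only: insert_pos_def)
  moreover have "col_insert a (C # T) = (C @ [a]) # T"
    unfolding col_insert.simps(2) Nil by simp
  ultimately show ?thesis by (simp add: insert_col_def)
next
  case (Cons x ys)
  define p where "p = takeWhile (\<lambda>x. x < a) C"
  have pos: "insert_pos a C = length p" by (simp add: insert_pos_def p_def)
  have C: "C = p @ x # ys" unfolding p_def using Cons by (metis takeWhile_dropWhile_id)
  have "col_insert a (C # T) = (p @ a # ys) # col_insert x T"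
    unfolding col_insert.simps(2) Cons p_def by simp
  then show ?thesis
    unfolding insert_col_def pos by (simp add: C)
qed

declare col_insert.simps [simp del]

lemma sorted_insert_col:
  assumes "sorted_wrt (<) C"
  shows "sorted_wrt (<) (insert_col a C)"
  unfolding sorted_wrt_iff_nth_less
proof (intro allI impI)
  fix r r' assume r: "r < r'" "r' < length (insert_col a C)"
  let ?i = "insert_pos a C"
  have C: "C ! r < C ! r'" if "r < r'" "r' < length C" for r r'
    using assms that by (rule sorted_wrt_nth_less)
  consider "r' = ?i" | "r = ?i" | "r \<noteq> ?i" "r' \<noteq> ?i" by blast
  then show "insert_col a C ! r < insert_col a C ! r'"
  proof cases
    case 1
    with r nth_less_insert_pos[of r a C] show ?thesis by (simp add: nth_insert_col)
  next
    case 2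
    with r have "?i < length C" "r' < length C" by (auto simp: length_insert_col)
    with 2 r C[of r r'] nth_insert_pos[of a C] show ?thesis by (simp add: nth_insert_col)
  next
    case 3
    with r C[of r r'] insert_pos_le[of a C] show ?thesis
      by (auto simp: nth_insert_col length_insert_col max_def split: if_splits)
  qed
qed

text \<open>A bumped letter never moves down: in the row which it leaves, the next column has an
  entry at least as large or no entry at all. An empty \<open>D\<close> stands for a missing next
  column.\<close>

lemma dominates_insert_col:
  assumes C: "sorted_wrt (<) C" and dom: "dominates C D" and i: "insert_pos a C < length C"
  shows "dominates (insert_col a C) (insert_col (C ! insert_pos a C) D)"
proof -
  let ?i = "insert_pos a C"
  let ?x = "C ! ?i"
  let ?k = "insert_pos ?x D"
  have D: "C ! r \<le> D ! r" if "r < length D" for r using dom that by (simp add: dominates_def)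
  have k: "?k \<le> ?i"
  proof (rule ccontr)
    assume "\<not> ?k \<le> ?i"
    then have "D ! ?i < ?x" "?i < length D"
      using nth_less_insert_pos[of ?i ?x D] insert_pos_le[of ?x D] by auto
    with D[of ?i] show False by simp
  qed
  have len: "length D \<le> length C" using dom by (simp add: dominates_def)
  have "insert_col a C ! r \<le> insert_col ?x D ! r" if r: "r < length (insert_col ?x D)" for r
  proof -
    have r': "r < length (insert_col a C)"
      using r k i len by (auto simp: length_insert_col)
    show ?thesis
    proof (cases "r = ?k")
      case True
      then show ?thesis
        using k nth_less_insert_pos[of r a C] nth_insert_pos[OF i] nth_insert_col[OF r] nth_insert_col[OF r']
        by (cases "r = ?i") auto
    next
      case False
      then have "r < length D" using r insert_pos_le[of ?x D] by (auto simp: length_insert_col max_def split: if_splits)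
      with False show ?thesis
        using D[of r] nth_insert_pos[OF i] nth_insert_col[OF r] nth_insert_col[OF r'] by (cases "r = ?i") auto
    qed
  qed
  then show ?thesis
    using k i len by (simp add: dominates_def length_insert_col)
qed

lemma ssyt_col_insert: "ssyt T \<Longrightarrow> ssyt (col_insert a T)"
proof (induction T arbitrary: a)
  case Nil
  then show ?case by (simp add: col_insert_Nil ssyt_Cons insert_col_def insert_pos_def)
next
  case (Cons C T)
  let ?i = "insert_pos a C"
  have C: "sorted_wrt (<) C" "ssyt T" "T \<noteq> [] \<longrightarrow> dominates C (hd T)"
    using Cons.prems by (auto simp: ssyt_Cons)
  have ne: "insert_col a C \<noteq> []" by (simp add: insert_col_def)
  show ?case
  proof (cases "?i < length C")
    case True
    have "dominates C (if T = [] then [] else hd T)"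
      using C(3) by (simp add: dominates_def)
    moreover have "hd (col_insert (C ! ?i) T) = insert_col (C ! ?i) (if T = [] then [] else hd T)"
      by (cases T) (simp_all add: col_insert_Nil col_insert_Cons)
    ultimately show ?thesis
      using True Cons.IH[OF C(2)] sorted_insert_col[OF C(1)] ne dominates_insert_col[OF C(1) _ True]
      by (simp add: col_insert_Cons ssyt_Cons)
  next
    case False
    then have "insert_col a C = C @ [a]"
      using insert_pos_le[of a C] by (simp add: insert_col_def)
    with False C show ?thesis
      using sorted_insert_col[OF C(1), of a]
      by (auto simp: col_insert_Cons ssyt_Cons dominates_def nth_append)
  qed
qed

lemma mset_concat_col_insert: "mset (concat (col_insert a T)) = add_mset a (mset (concat T))"
proof (induction T arbitrary: a)
  case (Cons C T)
  let ?i = "insert_pos a C"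
  show ?case
  proof (cases "?i < length C")
    case True
    then have "mset C = mset (take ?i C) + add_mset (C ! ?i) (mset (drop (Suc ?i) C))"
      by (metis id_take_nth_drop mset.simps(2) mset_append)
    with True Cons show ?thesis
      by (simp add: col_insert_Cons insert_col_def)
  qed (simp add: col_insert_Cons insert_col_def)
qed (simp add: col_insert_Nil insert_col_def insert_pos_def)

lemma col_insert_tableaux: "\<lbrakk>T \<in> tableaux m; a \<in> {1..m}\<rbrakk> \<Longrightarrow> col_insert a T \<in> tableaux m"
  using mset_concat_col_insert[of a T] ssyt_col_insert[of T a]
  by (auto simp: tableaux_def simp flip: set_mset_mset)

text \<open>Comparing lengths before and after shows in which column the insertion ended. From there
  the bumped letters are recovered column by column, going back to the left.\<close>

lemma col_insert_inj:
  "\<lbrakk>col_insert a S = col_insert b T; map length S = map length T; ssyt S; ssyt T\<rbrakk> \<Longrightarrow> a = b \<and> S = T"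
proof (induction S arbitrary: a b T)
  case Nil
  then show ?case by (simp add: col_insert_Nil insert_col_def insert_pos_def)
next
  case (Cons C S)
  then obtain D U where T: "T = D # U" by (cases T) auto
  have len: "length C = length D" "map length S = map length U" using Cons.prems(2) by (auto simp: T)
  have ss: "sorted_wrt (<) C" "sorted_wrt (<) D" "ssyt S" "ssyt U"
    using Cons.prems(3,4) by (auto simp: T ssyt_Cons)
  let ?i = "insert_pos a C" and ?k = "insert_pos b D"
  have col: "insert_col a C = insert_col b D"
    using Cons.prems(1) by (simp add: T col_insert_Cons)
  then have iff: "?i < length C \<longleftrightarrow> ?k < length D"
    using length_insert_col[of a C] length_insert_col[of b D] insert_pos_le[of a C] insert_pos_le[of b D] len
    by (auto simp: max_def split: if_splits)
  show ?case
  proof (cases "?i < length C")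
    case True
    with iff have "col_insert (C ! ?i) S = col_insert (D ! ?k) U"
      using Cons.prems(1) by (simp add: T col_insert_Cons)
    from Cons.IH[OF this len(2) ss(3,4)] have x: "C ! ?i = D ! ?k" and SU: "S = U" by auto
    \<comment> \<open>Otherwise \<open>b\<close> would be an unchanged entry of \<open>C\<close>
      below the bumped letter, hence greater than it; but \<open>b\<close> bumped the same letter
      out of \<open>D\<close>, so it is at most that letter.\<close>
    have nlt: "\<not> insert_pos a C < insert_pos b D"
      if "insert_col a C = insert_col b D" "length C = length D" "insert_pos b D < length D"
        "C ! insert_pos a C = D ! insert_pos b D" "sorted_wrt (<) C" for a b and C D :: "nat list"
    proof
      assume lt: "insert_pos a C < insert_pos b D"
      have "b = insert_col b D ! insert_pos b D"
        using that(3) by (simp add: nth_insert_col length_insert_col)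
      also have "\<dots> = C ! insert_pos b D"
        using that(1,2,3) lt nth_insert_col[of "insert_pos b D" a C] by (simp add: length_insert_col)
      also have "\<dots> > C ! insert_pos a C"
        using lt that(2,3,5) by (simp add: sorted_wrt_nth_less)
      finally show False using nth_insert_pos[OF that(3)] that(4) by simp
    qed
    have ik: "?i = ?k"
      using nlt[OF col len(1) _ x ss(1)] nlt[OF col[symmetric] len(1)[symmetric] True x[symmetric] ss(2)] True iff
      by auto
    have nth: "insert_col a C ! r = insert_col b D ! r" for r by (simp add: col)
    have "C ! r = D ! r" if "r < length C" for r
      using nth[of r] that len ik x
      by (cases "r = ?i") (simp_all add: nth_insert_col length_insert_col)
    moreover have "a = b"
      using nth[of ?i] True len ik by (simp add: nth_insert_col length_insert_col)
    ultimately show ?thesis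
      using len SU T by (auto intro: nth_equalityI)
  next
    case False
    then have "insert_col a C = C @ [a]" "insert_col b D = D @ [b]"
      using iff insert_pos_le[of a C] insert_pos_le[of b D] by (auto simp: insert_col_def)
    with False iff col Cons.prems(1) show ?thesis
      by (simp add: T col_insert_Cons)
  qed
qed

text \<open>If a is appended to the next column, all entries of that column are less than a, so by
  the row condition the column ends above the row of a in \<open>C\<close>, and the new box does not
  exceed \<open>C\<close>. Otherwise a letter of the next column is passed on and the argument
  repeats. This bounds the shape after an odd step of a slack chain.\<close>

lemma col_insert_lengths:
  "\<lbrakk>ssyt (C # T); a \<in> set C\<rbrakk> \<Longrightarrow> length (col_insert a T) \<le> Suc (length T) \<and>
     (\<forall>j<length (col_insert a T). length (col_insert a T ! j) \<le> length ((C # T) ! j))"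
proof (induction T arbitrary: a C)
  case Nil
  then show ?case by (cases C) (auto simp: col_insert_Nil insert_col_def insert_pos_def)
next
  case (Cons D T)
  let ?i = "insert_pos a D"
  have DT: "ssyt (D # T)" and dom: "dominates C D" using Cons.prems by (auto simp: ssyt_Cons)
  have len: "length D \<le> length C" using dom by (simp add: dominates_def)
  show ?case
  proof (cases "?i < length D")
    case True
    with len Cons.IH[OF DT, of "D ! ?i"] show ?thesis
      by (auto simp: col_insert_Cons length_insert_col nth_Cons split: nat.split)
  next
    case False
    then have iD: "?i = length D" using insert_pos_le[of a D] by simp
    obtain r where r: "r < length C" "C ! r = a" using Cons.prems(2) by (auto simp: in_set_conv_nth)
    have "length D \<le> r"
    proof (rule ccontr)
      assume "\<not> length D \<le> r"
      then have "C ! r \<le> D ! r" "D ! r < a"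
        using dom nth_less_insert_pos[of r a D] iD by (auto simp: dominates_def)
      with r show False by simp
    qed
    then have "Suc (length D) \<le> length C" using r by simp
    moreover have "length (T ! j) \<le> length ((D # T) ! j)" if "j < length T" for j
      using ssyt_dominates[OF DT, of j "Suc j"] that by (simp add: dominates_def)
    ultimately show ?thesis
      using False iD by (auto simp: col_insert_Cons length_insert_col nth_Cons split: nat.split)
  qed
qed

text \<open>\<open>P\<close> is the part of the new column already inserted, \<open>D\<close> the
  part of the old column still below it. Each further letter takes the place of the first letter of
  \<open>D\<close>, so the old column is passed on letter by letter; once it is used up, the
  remaining letters are appended.\<close>

lemma fold_col_insert:
  "\<lbrakk>sorted_wrt (<) (P @ C); sorted_wrt (<) (P @ D); dominates C D\<rbrakk>
    \<Longrightarrow> fold col_insert C ((P @ D) # T) = (P @ C) # fold col_insert D T"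
proof (induction C arbitrary: P D T)
  case Nil
  then show ?case by (simp add: dominates_def)
next
  case (Cons c C)
  have P: "takeWhile (\<lambda>x. x < c) (P @ D) = P @ takeWhile (\<lambda>x. x < c) D"
    using Cons.prems(1) by (intro takeWhile_append2) (auto simp: sorted_wrt_append)
  show ?case
  proof (cases D)
    case Nil
    have pos: "insert_pos c (P @ D) = length P"
      unfolding insert_pos_def P by (simp add: Nil)
    then have "col_insert c ((P @ D) # T) = ((P @ [c]) @ []) # T"
      unfolding col_insert_Cons insert_col_def pos by (simp add: Nil)
    with Nil Cons.IH[of "P @ [c]" "[]" T] Cons.prems show ?thesis
      by (simp add: dominates_def sorted_wrt_append)
  next
    case (Cons d E)
    have cd: "c \<le> d" and CE: "dominates C E"
      using Cons.prems(3) unfolding Cons dominates_def by (auto simp: nth_Cons split: nat.splits)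
    have pos: "insert_pos c (P @ D) = length P"
      using P cd by (simp add: Cons insert_pos_def)
    have "col_insert c ((P @ D) # T) = ((P @ [c]) @ E) # col_insert d T"
      by (simp add: col_insert_Cons insert_col_def pos) (simp add: Cons)
    moreover have "sorted_wrt (<) ((P @ [c]) @ E)"
      using Cons.prems(1,2) cd unfolding Cons by (auto simp: sorted_wrt_append)
    ultimately show ?thesis
      using Cons.IH[of "P @ [c]" E "col_insert d T"] Cons.prems(1) CE by (simp add: Cons)
  qed
qed

text \<open>Inserting a column passes on the next one unchanged, so the tableau is rebuilt column
  after column. Hence \<open>suc_tab\<close> fixes a tableau whose first column has no removable
  letters.\<close>

lemma fold_col_insert_first_column: "ssyt (C # T) \<Longrightarrow> fold col_insert C T = C # T"
proof (induction T arbitrary: C)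
  case Nil
  then obtain c C' where C: "C = c # C'" by (auto simp: ssyt_Cons neq_Nil_conv)
  with Nil have "fold col_insert C' (([c] @ []) # []) = ([c] @ C') # fold col_insert [] []"
    by (intro fold_col_insert) (auto simp: ssyt_Cons dominates_def)
  then show ?case by (simp add: C col_insert_Nil insert_col_def insert_pos_def)
next
  case (Cons D T)
  then have "fold col_insert C (([] @ D) # T) = ([] @ C) # fold col_insert D T"
    by (intro fold_col_insert) (auto simp: ssyt_Cons)
  with Cons show ?case by (simp add: ssyt_Cons)
qed

section \<open>The tableau \<open>P\<^sup>A\<^sup>I\<^sup>I\<close>\<close>

lemma ssyt_suc_tab: "ssyt T \<Longrightarrow> ssyt (suc_tab T)"
proof (cases T)
  case (Cons C T0)
  assume "ssyt T"
  then have "ssyt T0" by (simp add: Cons ssyt_Cons)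
  then have "ssyt (fold col_insert xs T0)" for xs
    by (induction xs arbitrary: T0) (auto intro: ssyt_col_insert)
  then show ?thesis by (simp add: Cons)
qed simp

lemma length_concat_fold_col_insert:
  "length (concat (fold col_insert xs T)) = length xs + length (concat T)"
proof (induction xs arbitrary: T)
  case (Cons x xs)
  have "length (concat (col_insert x T)) = Suc (length (concat T))"
    using arg_cong[OF mset_concat_col_insert[of x T], of size] by simp
  with Cons show ?case by simp
qed simp

lemma suc_tab_fixed_or_smaller:
  assumes "ssyt T"
  shows "suc_tab T = T \<or> length (concat (suc_tab T)) < length (concat T)"
proof (cases T)
  case (Cons C T0)
  show ?thesis
  proof (cases "red C = C")
    case True
    with Cons assms fold_col_insert_first_column show ?thesis by simp
  next
    case False
    then have "length (red C) < length C"
      unfolding red_def by (metis filter_True length_filter_less filter_id_conv)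
    with Cons show ?thesis by (simp add: length_concat_fold_col_insert)
  qed
qed simp

text \<open>The number of iterations in \<open>P_AII\<close> depends on the number of boxes. Surplus
  iterations are harmless, which allows tableaux of different sizes to be compared.\<close>

lemma funpow_suc_tab_stable:
  "\<lbrakk>ssyt T; length (concat T) \<le> N\<rbrakk> \<Longrightarrow> (suc_tab ^^ (k + N)) T = (suc_tab ^^ N) T"
proof (induction N arbitrary: T)
  case 0
  then have "T = []" by (cases T) (auto simp: ssyt_Cons)
  moreover have "(suc_tab ^^ k) [] = []" by (induction k) auto
  ultimately show ?case by simp
next
  case (Suc N)
  show ?case
  proof (cases "suc_tab T = T")
    case True
    then have "(suc_tab ^^ j) T = T" for j by (induction j) auto
    then show ?thesis by (simp only:)
  next
    case False
    with Suc.prems suc_tab_fixed_or_smaller[of T] have "length (concat (suc_tab T)) \<le> N" by auto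
    from Suc.IH[OF ssyt_suc_tab[OF Suc.prems(1)] this] show ?thesis
      by (simp only: add_Suc_right funpow_Suc_right o_apply)
  qed
qed

text \<open>When the r - 2 letters above the last two are all removable, the inequality in
  \<open>rem_rev\<close> reads r + (r - 2) + 1 < 2r. It just holds, so the column disappears pair by
  pair.\<close>

lemma rem_rev_upt: "even r \<Longrightarrow> rem_rev (rev [1..<Suc r]) = rev [1..<Suc r]"
proof (induction r rule: less_induct)
  case (less r)
  show ?case
  proof (cases "r = 0")
    case False
    with less.prems obtain q where r: "r = Suc (Suc q)" "even q"
      by (metis even_Suc odd_Suc_minus_one even_zero not0_implies_Suc)
    have rev: "rev [1..<Suc r] = r # Suc q # rev [1..<Suc q]" by (simp add: r)
    from less.IH[of q] r less.prems show ?thesis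
      unfolding rev by (simp del: upt_Suc)
  qed simp
qed

lemma red_upt: "even r \<Longrightarrow> red [1..<Suc r] = []"
  by (simp add: red_def rem_rev_upt[unfolded One_nat_def] filter_empty_conv del: upt_Suc)

lemma P_AII_prepend_cols:
  assumes "even r" "0 < r" and "ssyt T"
  shows "P_AII (prepend_cols r M T) = P_AII T"
proof -
  have pow: "(suc_tab ^^ M) (prepend_cols r M T) = T"
    by (induction M) (simp_all add: prepend_cols_def red_upt[unfolded One_nat_def] assms(1) funpow_swap1 del: upt_Suc)
  have "length (concat (prepend_cols r M T)) = M * r + length (concat T)"
    by (induction M) (simp_all add: prepend_cols_def del: upt_Suc)
  \<comment> \<open>M iterations are spent on the prepended columns, which contribute M r
    iterations; at least as many as \<open>T\<close> has boxes remain.\<close>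
  moreover have "M \<le> M * r" using assms(2) by simp
  ultimately have "length (concat (prepend_cols r M T)) = ((M * r - M) + length (concat T)) + M"
    by linarith
  then have "P_AII (prepend_cols r M T) = (suc_tab ^^ ((M * r - M) + length (concat T))) T"
    by (simp only: P_AII_def funpow_add o_apply pow)
  also have "\<dots> = P_AII T"
    unfolding P_AII_def by (rule funpow_suc_tab_stable) (use assms in auto)
  finally show ?thesis .
qed

section \<open>Boxes and shapes\<close>

text \<open>The columnwise counterpart of \<open>cells\<close>. Agreement of the two on semistandard
  tableaux keeps conjugate partitions out of the arguments on chains.\<close>

definition boxes :: "tableau \<Rightarrow> (nat \<times> nat) set" where
  "boxes T = {(i, j). j < length T \<and> i < length (T ! j)}"

text \<open>Conjugation of a partition, box by box; it serves for column lengths of tableaux as well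
  as for the parts of mu.\<close>

lemma less_length_filter_iff:
  "sorted_wrt (\<ge>) xs \<Longrightarrow> i < length (filter (\<lambda>p. j < p) xs) \<longleftrightarrow> i < length xs \<and> j < xs ! i" for xs :: "nat list"
proof (induction xs arbitrary: i)
  case (Cons x xs)
  show ?case
  proof (cases "j < x")
    case True
    with Cons show ?thesis by (cases i) auto
  next
    case False
    with Cons.prems have "\<forall>y\<in>set (x # xs). \<not> j < y" by auto
    then show ?thesis
      by (metis filter_False length_0_conv not_less_zero nth_mem)
  qed
qed simp

lemma ssyt_lengths_sorted: "ssyt T \<Longrightarrow> sorted_wrt (\<ge>) (map length T)"
  unfolding ssyt_def sorted_wrt_map by (auto elim!: sorted_wrt_mono_rel[rotated] simp: dominates_def)

lemma less_row_length_iff: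
  assumes "ssyt T"
  shows "j < length (filter (\<lambda>C. i < length C) T) \<longleftrightarrow> (i, j) \<in> boxes T"
  using less_length_filter_iff[OF ssyt_lengths_sorted[OF assms], of j i]
  by (auto simp: boxes_def filter_map comp_def)

lemma ssyt_hd_ge: "\<lbrakk>ssyt T; j < length T\<rbrakk> \<Longrightarrow> length (T ! j) \<le> length (hd T)"
  using ssyt_dominates[of T 0 j] by (cases T; cases "j = 0") (auto simp: dominates_def)

lemma cells_shape:
  assumes "ssyt T"
  shows "cells (shape T) = boxes T"
proof -
  have "(i, j) \<in> cells (shape T) \<longleftrightarrow> T \<noteq> [] \<and> i < length (hd T) \<and> (i, j) \<in> boxes T" for i j
    unfolding less_row_length_iff[OF assms, symmetric] by (auto simp: cells_def shape_def)
  moreover have "T \<noteq> [] \<and> i < length (hd T)" if "(i, j) \<in> boxes T" for i j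
    using that ssyt_hd_ge[OF assms, of j] by (auto simp: boxes_def)
  ultimately show ?thesis by auto
qed

lemma length_shape: "length (shape T) = (if T = [] then 0 else length (hd T))"
  by (simp add: shape_def)

lemma nth_shape: "i < length (shape T) \<Longrightarrow> shape T ! i = length (filter (\<lambda>C. i < length C) T)"
  by (simp add: shape_def)

lemma finite_boxes: "finite (boxes T)"
  and card_boxes: "card (boxes T) = length (concat T)"
proof -
  have eq: "boxes T = prod.swap ` (SIGMA j:{..<length T}. {..<length (T ! j)})"
    by (auto simp: boxes_def)
  show "finite (boxes T)" unfolding eq by simp
  have "card (boxes T) = (\<Sum>j<length T. length (T ! j))"
    unfolding eq by (simp add: card_image)
  also have "\<dots> = length (concat T)"
    by (simp add: length_concat sum_list_sum_nth atLeast0LessThan)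
  finally show "card (boxes T) = length (concat T)" .
qed

lemma boxes_eq_imp_lengths:
  assumes "boxes S = boxes T" and "[] \<notin> set S" "[] \<notin> set T"
  shows "map length S = map length T"
proof -
  have len: "length S \<le> length T" if "boxes S \<subseteq> boxes T" "[] \<notin> set S" for S T
  proof (cases S rule: rev_cases)
    case (snoc S' C)
    with that have "(0, length S') \<in> boxes S" by (auto simp: boxes_def)
    with that have "(0, length S') \<in> boxes T" by blast
    then show ?thesis by (simp add: boxes_def snoc)
  qed simp
  show ?thesis
  proof (rule nth_equalityI)
    show "length (map length S) = length (map length T)"
      using len[of S T] len[of T S] assms by simp
    fix j assume "j < length (map length S)"
    then have j: "j < length S" "j < length T" using \<open>length (map length S) = _\<close> by auto
    have "i < length (S ! j) \<longleftrightarrow> i < length (T ! j)" for i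
      using assms(1) j by (auto simp: boxes_def set_eq_iff)
    then show "map length S ! j = map length T ! j"
      using j by (metis nth_map linorder_less_linear less_irrefl)
  qed
qed

lemma boxes_subset_hd:
  assumes "boxes S \<subseteq> boxes T" and "ssyt S" "ssyt T" "S \<noteq> []"
  shows "T \<noteq> [] \<and> length (hd S) \<le> length (hd T)"
proof -
  have "hd S \<noteq> []" using assms by (cases S) (auto simp: ssyt_Cons)
  then have "(length (hd S) - 1, 0) \<in> boxes S"
    using assms(4) by (simp add: boxes_def hd_conv_nth)
  with assms(1) have "(length (hd S) - 1, 0) \<in> boxes T" by blast
  then show ?thesis by (auto simp: boxes_def hd_conv_nth)
qed

lemma SST_iff_tableaux: "T \<in> SST m lam \<longleftrightarrow> T \<in> tableaux m \<and> shape T = lam"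
  by (simp add: SST_iff tableaux_def)

lemma shape_Par:
  assumes "T \<in> tableaux m"
  shows "shape T \<in> Par m"
proof -
  have T: "ssyt T" using assms by (simp add: tableaux_def)
  have "length (shape T) \<le> m"
    using tableaux_column_length[OF assms] by (simp add: length_shape)
  moreover have "shape T ! i' \<le> shape T ! i" if "i < i'" "i' < length (shape T)" for i i'
  proof -
    have "length (filter (\<lambda>C. i' < length C) T) \<le> length (filter (\<lambda>C. i < length C) T)"
      using that(1) by (induction T) auto
    with that show ?thesis by (simp add: nth_shape)
  qed
  moreover have "0 \<notin> set (shape T)"
  proof
    assume "0 \<in> set (shape T)"
    then obtain i where i: "i < length (shape T)" "shape T ! i = 0" by (auto simp: in_set_conv_nth)
    then have "(i, 0) \<in> boxes T" by (auto simp: boxes_def length_shape hd_conv_nth split: if_splits)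
    with i nth_shape[OF i(1)] less_row_length_iff[OF T, of 0 i] show False by simp
  qed
  ultimately show ?thesis by (auto simp: Par_def sorted_wrt_iff_nth_less)
qed

lemma part_le_if_cells:
  assumes "0 \<notin> set mu" and "cells mu \<subseteq> cells lam"
  shows "part_le mu lam"
proof -
  have i: "i < length lam \<and> mu ! i \<le> lam ! i" if "i < length mu" for i
  proof -
    have "0 < mu ! i" using assms(1) that by (metis gr0I nth_mem)
    with that have "(i, mu ! i - 1) \<in> cells mu" by (simp add: cells_def)
    with assms(2) have "(i, mu ! i - 1) \<in> cells lam" by blast
    then show ?thesis by (auto simp: cells_def)
  qed
  moreover have "length mu \<le> length lam"
    using i[of "length mu - 1"] by (cases mu) auto
  ultimately show ?thesis by (simp add: part_le_def)
qed

lemma filter_nonzero_sorted: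
  "sorted_wrt (\<ge>) xs \<Longrightarrow> filter (\<lambda>p. p \<noteq> 0) xs = take (length (filter (\<lambda>p. p \<noteq> 0) xs)) xs" for xs :: "nat list"
proof (induction xs)
  case (Cons x xs)
  then show ?case by (cases "x = 0") (auto simp: filter_empty_conv)
qed simp

lemma shape_prepend_cols:
  assumes "0 < M"
  shows "shape (prepend_cols r M T) = map (\<lambda>i. M + length (filter (\<lambda>C. i < length C) T)) [0..<r]"
proof -
  have "prepend_cols r M T \<noteq> []" "hd (prepend_cols r M T) = [1..<Suc r]"
    using assms by (cases M; simp add: prepend_cols_def del: upt_Suc)+
  then show ?thesis
    using assms unfolding shape_def by (simp add: prepend_cols_def filter_replicate del: upt_Suc)
qed

lemma sub_cols_shape_prepend_cols:
  assumes T: "ssyt T" and "0 < M" and le: "\<And>C. C \<in> set T \<Longrightarrow> length C \<le> r"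
  shows "sub_cols (shape (prepend_cols r M T)) M = shape T"
proof -
  let ?k = "if T = [] then 0 else length (hd T)"
  let ?f = "\<lambda>i. length (filter (\<lambda>C. i < length C) T)"
  have k: "?k \<le> r" using le[of "hd T"] by simp
  have nz: "?f i \<noteq> 0 \<longleftrightarrow> i < ?k" for i
    using less_row_length_iff[OF T, of 0 i] by (auto simp: boxes_def hd_conv_nth)
  have "sub_cols (shape (prepend_cols r M T)) M = map ?f (filter (\<lambda>i. ?f i \<noteq> 0) [0..<r])"
    unfolding sub_cols_def shape_prepend_cols[OF assms(2)] by (simp add: filter_map comp_def)
  also have "\<dots> = map ?f (filter (\<lambda>i. i < ?k) [0..<r])"
    unfolding nz ..
  also have "filter (\<lambda>i. i < k) [0..<r] = [0..<k]" if "k \<le> r" for k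
    using that by (induction r) (auto simp: le_Suc_eq)
  note this[OF k]
  finally show ?thesis by (simp add: shape_def)
qed

section \<open>Slack chains\<close>

lemma slack_step_cases:
  assumes "slack_step n T U"
  obtains (even) C where "T = C # U" "even (length C)" "C = [1..<Suc (length C)]"
  | (odd) C T0 a where "T = C # T0" "odd (length C)" "3 \<le> length C" "a \<in> {1..2 * n}"
      "C = red1_inv (length C) a" "U = col_insert a T0"
  using assms unfolding slack_step_def by blast

lemma mem_red1_inv: "\<lbrakk>1 \<le> a; 1 \<le> r\<rbrakk> \<Longrightarrow> a \<in> set (red1_inv r a)"
  by (auto simp: red1_inv_def Let_def simp del: upt_Suc)

text \<open>In an odd step the inserted letter belongs to the removed column, so the insertion stays
  inside the old shape and gives back one box.\<close>

lemma slack_step_props: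
  assumes step: "slack_step n T U" and T: "T \<in> tableaux (2 * n)"
  shows "U \<in> tableaux (2 * n)" "T \<noteq> []" "boxes U \<subseteq> boxes T"
    "length (concat T) = length (concat U) + (if even (length (hd T)) then length (hd T) else length (hd T) - 1)"
    "length (concat U) < length (concat T)"
proof -
  have U: "U \<in> tableaux (2 * n) \<and> boxes U \<subseteq> boxes T \<and>
    length (concat T) = length (concat U) + (if even (length (hd T)) then length (hd T) else length (hd T) - 1)"
    using step
  proof (cases rule: slack_step_cases)
    case (even C)
    have "length (U ! j) \<le> length (T ! j)" if "j < length U" for j
      using ssyt_dominates[of T j "Suc j"] T that by (auto simp: tableaux_def dominates_def even(1))
    then have "boxes U \<subseteq> boxes T"
      by (auto simp: boxes_def even(1) dest: less_le_trans)
    with even T show ?thesis by (auto simp: tableaux_def ssyt_Cons)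
  next
    case (odd C T0 a)
    have CT: "ssyt (C # T0)" "T0 \<in> tableaux (2 * n)"
      using T by (auto simp: odd(1) tableaux_def ssyt_Cons)
    have "a \<in> set C" using mem_red1_inv[of a "length C"] odd by auto
    from col_insert_lengths[OF CT(1) this] have "boxes U \<subseteq> boxes T"
      by (auto simp: boxes_def odd(1,6) intro: less_le_trans)
    moreover have "length (concat U) = Suc (length (concat T0))"
      unfolding odd(6) using arg_cong[OF mset_concat_col_insert[of a T0], of size] by simp
    ultimately show ?thesis
      using col_insert_tableaux[OF CT(2) odd(4)] odd by auto
  qed
  then show "U \<in> tableaux (2 * n)" "boxes U \<subseteq> boxes T"
    "length (concat T) = length (concat U) + (if even (length (hd T)) then length (hd T) else length (hd T) - 1)"
    by blast+
  show "T \<noteq> []" using step by (cases rule: slack_step_cases) auto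
  then have "hd T \<noteq> []" using T by (auto simp: tableaux_def ssyt_def)
  \<comment> \<open>An odd column of length 1 would lose no box; the bound in the definition of a
    step excludes it.\<close>
  moreover have "3 \<le> length (hd T)" if "odd (length (hd T))"
    using step that by (cases rule: slack_step_cases) auto
  ultimately show "length (concat U) < length (concat T)"
    using U by (auto split: if_splits)
qed

text \<open>The boxes give the length of the first column. Its parity decides the kind of step, and
  an even column is then known; for an odd one the injectivity of insertion returns the letter a,
  which together with the length determines the column.\<close>

lemma slack_step_inj:
  assumes "slack_step n S U" "slack_step n T U" and "S \<in> tableaux (2 * n)" "T \<in> tableaux (2 * n)"
    and "boxes S = boxes T"
  shows "S = T"
proof -
  have ss: "ssyt S" "ssyt T" using assms(3,4) by (auto simp: tableaux_def)
  then have len: "map length S = map length T"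
    using assms(5) by (intro boxes_eq_imp_lengths) (auto simp: ssyt_def)
  from assms(1) show ?thesis
  proof (cases rule: slack_step_cases)
    case S: (even C)
    from assms(2) show ?thesis
    proof (cases rule: slack_step_cases)
      case T: (even D)
      then have "length C = length D" using S len by simp
      with S T show ?thesis by metis
    next
      case T: (odd D T0 b)
      with S len show ?thesis by auto
    qed
  next
    case S: (odd C S0 a)
    from assms(2) show ?thesis
    proof (cases rule: slack_step_cases)
      case T: (even D)
      with S len show ?thesis by auto
    next
      case T: (odd D T0 b)
      have "col_insert a S0 = col_insert b T0" "map length S0 = map length T0" "ssyt S0" "ssyt T0"
        using S T len ss by (auto simp: ssyt_Cons)
      from col_insert_inj[OF this] S T len show ?thesis by auto
    qed
  qed
qed

text \<open>The letters \<open>u k\<close> and \<open>v k\<close> are 2k-1 and 2k in some order, and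
  an interval beginning with an odd and ending with an even number contains both or neither.\<close>

lemma count_balanced_upt:
  "\<lbrakk>even p; even q; 1 \<le> k\<rbrakk> \<Longrightarrow> count_list [Suc p..<Suc q] (u k) = count_list [Suc p..<Suc q] (v k)"
proof -
  assume "even p" "even q" and k: "1 \<le> k"
  then obtain b c where "p = 2 * b" "q = 2 * c" by (auto elim!: evenE)
  moreover have "Suc (2 * b) \<le> 2 * k - 1 \<longleftrightarrow> Suc (2 * b) \<le> 2 * k" "2 * k - 1 < Suc (2 * c) \<longleftrightarrow> 2 * k < Suc (2 * c)"
    using k by presburger+
  ultimately show ?thesis
    unfolding count_list_upt u_def v_def by (simp del: One_nat_def)
qed

text \<open>Apart from a, the column splits into such balanced intervals, possibly empty: the length
  \<open>r1\<close> is even for both parities of a, and the letters after a begin with an odd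
  number.\<close>

lemma count_red1_inv:
  assumes r: "odd r" and "1 \<le> a" and k: "1 \<le> k"
  shows "int (count_list (red1_inv r a) (u k)) - int (count_list (red1_inv r a) (v k))
    = (if a = u k then 1 else 0) - (if a = v k then 1 else 0)"
proof -
  have key: "int (count_list (A @ a # B) (u k)) - int (count_list (A @ a # B) (v k))
      = (if a = u k then 1 else 0) - (if a = v k then 1 else 0)"
    if "count_list A (u k) = count_list A (v k)" "count_list B (u k) = count_list B (v k)" for A B
    using that by simp
  show ?thesis
  proof (cases "even a")
    case True
    define r1 where "r1 = min (a - 2) (r - 1)"
    have r1: "even r1" "r1 < r" using True r odd_pos[OF r] by (auto simp: r1_def min_def)
    have "red1_inv r a = [Suc 0..<Suc r1] @ [a..<a + r - r1]"
      using True by (simp add: red1_inv_def r1_def Let_def)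
    also have "[a..<a + r - r1] = a # [Suc a..<Suc (a + r - r1 - 1)]"
      using r1 by (subst upt_conv_Cons) (simp_all add: Suc_diff_Suc)
    finally have eq: "red1_inv r a = [Suc 0..<Suc r1] @ a # [Suc a..<Suc (a + r - r1 - 1)]" .
    have "even (a + r - r1 - 1)" using r1 r True by auto
    then show ?thesis
      unfolding eq by (intro key count_balanced_upt) (use r1 k True in simp_all)
  next
    case False
    define r1 where "r1 = min (a - 1) (r - 1)"
    have r1: "even r1" "r1 < r" using False r odd_pos[OF r] by (auto simp: r1_def min_def)
    have eq: "red1_inv r a = [Suc 0..<Suc r1] @ a # [Suc (Suc a)..<Suc (a + r - r1)]"
      using False by (simp add: red1_inv_def r1_def Let_def)
    have "even (a + r - r1)" using r1 r False by auto
    then show ?thesis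
      unfolding eq using False by (intro key count_balanced_upt) (use r1 k in simp_all)
  qed
qed

lemma wt_k_slack_step:
  assumes "slack_step n T U"
  shows "wt_k n T = wt_k n U"
proof -
  have "entry_count T (u k) - entry_count T (v k) = entry_count U (u k) - entry_count U (v k)"
    if k: "1 \<le> k" for k
    using assms
  proof (cases rule: slack_step_cases)
    case (even C)
    then have "count_list C (u k) = count_list C (v k)"
      using count_balanced_upt[of 0 "length C" k] k by simp
    then show ?thesis by (simp add: entry_count_def even(1))
  next
    case (odd C T0 a)
    have "entry_count U x = (if a = x then 1 else 0) + entry_count T0 x" for x
      by (simp add: odd(6) entry_count_mset mset_concat_col_insert)
    moreover have "int (count_list C (u k)) - int (count_list C (v k))
        = (if a = u k then 1 else 0) - (if a = v k then 1 else 0)"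
      using count_red1_inv[of "length C" a k] odd k by simp
    ultimately show ?thesis by (simp add: entry_count_def odd(1))
  qed
  then show ?thesis by (simp add: wt_k_def del: upt_Suc)
qed

section \<open>Chains of tableaux and their recording tableaux\<close>

definition tableau_chain :: "nat \<Rightarrow> tableau list \<Rightarrow> bool" where
  "tableau_chain n Ts \<longleftrightarrow> Ts \<noteq> [] \<and> hd Ts \<in> tableaux (2 * n)
     \<and> (\<forall>k. Suc k < length Ts \<longrightarrow> slack_step n (Ts ! k) (Ts ! Suc k))"

lemma tableau_chain_iff:
  "T \<in> tableaux (2 * n) \<and> slack_chain n Ts T S \<longleftrightarrow> tableau_chain n Ts \<and> hd Ts = T \<and> last Ts = S"
  by (auto simp: tableau_chain_def slack_chain_def)

lemma chain_tableaux:
  assumes "tableau_chain n Ts" and "k < length Ts"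
  shows "Ts ! k \<in> tableaux (2 * n)"
  using assms(2)
proof (induction k)
  case 0
  with assms(1) show ?case by (auto simp: tableau_chain_def hd_conv_nth)
next
  case (Suc k)
  with assms(1) slack_step_props(1) show ?case by (auto simp: tableau_chain_def)
qed

lemma chain_ssyt: "\<lbrakk>tableau_chain n Ts; k < length Ts\<rbrakk> \<Longrightarrow> ssyt (Ts ! k)"
  using chain_tableaux by (auto simp: tableaux_def)

lemma chain_step: "\<lbrakk>tableau_chain n Ts; Suc k < length Ts\<rbrakk> \<Longrightarrow> slack_step n (Ts ! k) (Ts ! Suc k)"
  by (simp add: tableau_chain_def)

lemma chain_drop: "\<lbrakk>tableau_chain n Ts; k < length Ts\<rbrakk> \<Longrightarrow> tableau_chain n (drop k Ts)"
  using chain_tableaux[of n Ts k] by (simp add: tableau_chain_def hd_drop_conv_nth)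

lemma chain_boxes_mono:
  assumes "tableau_chain n Ts" and "k \<le> k'" and "k' < length Ts"
  shows "boxes (Ts ! k') \<subseteq> boxes (Ts ! k)"
  using assms(2,3)
proof (induction k' rule: dec_induct)
  case (step k')
  then show ?case
    using slack_step_props(3)[OF chain_step[OF assms(1)] chain_tableaux[OF assms(1)], of k'] by simp
qed simp

lemma chain_boxes_strict_mono:
  assumes "tableau_chain n Ts" and "k < k'" and "k' < length Ts"
  shows "boxes (Ts ! k') \<noteq> boxes (Ts ! k)"
proof
  assume eq: "boxes (Ts ! k') = boxes (Ts ! k)"
  have "boxes (Ts ! k') \<subseteq> boxes (Ts ! Suc k)" "boxes (Ts ! Suc k) \<subseteq> boxes (Ts ! k)"
    using chain_boxes_mono[OF assms(1), of "Suc k" k'] chain_boxes_mono[OF assms(1), of k "Suc k"] assms(2,3)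
    by simp_all
  with eq have "boxes (Ts ! Suc k) = boxes (Ts ! k)" by blast
  then have "length (concat (Ts ! Suc k)) = length (concat (Ts ! k))"
    by (metis card_boxes)
  moreover have "length (concat (Ts ! Suc k)) < length (concat (Ts ! k))"
    using assms by (intro slack_step_props(5)[OF chain_step chain_tableaux]) auto
  ultimately show False by simp
qed

lemma chain_cells:
  assumes "tableau_chain n Ts" and "k < length Ts"
  shows "cells (shape (Ts ! k)) = boxes (Ts ! k)"
  using cells_shape chain_ssyt[OF assms] by blast

lemma records_chain:
  assumes "tableau_chain n Ts" and "records Ts Q"
  shows "cells (outer Q) = boxes (hd Ts)" "cells (inner Q) = boxes (last Ts)"
    "\<And>k b. \<lbrakk>Suc k < length Ts; b \<in> boxes (Ts ! k); b \<notin> boxes (Ts ! Suc k)\<rbrakk> \<Longrightarrow> filling Q b = Suc k"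
    "\<And>b. b \<notin> boxes (hd Ts) \<or> b \<in> boxes (last Ts) \<Longrightarrow> filling Q b = 0"
proof -
  have ne: "Ts \<noteq> []" using assms(1) by (simp add: tableau_chain_def)
  show 1: "cells (outer Q) = boxes (hd Ts)" "cells (inner Q) = boxes (last Ts)"
    using assms(2) ne chain_cells[OF assms(1), of 0] chain_cells[OF assms(1), of "length Ts - 1"]
    by (simp_all add: records_def hd_conv_nth last_conv_nth)
  show "filling Q b = Suc k" if "Suc k < length Ts" "b \<in> boxes (Ts ! k)" "b \<notin> boxes (Ts ! Suc k)" for k b
    using assms(2) that chain_cells[OF assms(1)] by (simp add: records_def)
  show "filling Q b = 0" if "b \<notin> boxes (hd Ts) \<or> b \<in> boxes (last Ts)" for b
    using assms(2) that 1 unfolding records_def by blast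
qed

lemma chain_leaves:
  assumes "tableau_chain n Ts" and "k \<le> k'" "k' < length Ts"
    and "b \<in> boxes (Ts ! k)" "b \<notin> boxes (Ts ! k')"
  shows "\<exists>j. k \<le> j \<and> j < k' \<and> b \<in> boxes (Ts ! j) \<and> b \<notin> boxes (Ts ! Suc j)"
  using assms(2,3,5)
proof (induction k' rule: dec_induct)
  case base
  with assms(4) show ?case by simp
next
  case (step k')
  then show ?case by (cases "b \<in> boxes (Ts ! k')") (auto intro: less_SucI)
qed

text \<open>Boxes only disappear along a chain, and the label of a box is the number of the step in
  which it does. So the boxes with a label above k are those still to be removed at time k, and
  \<open>Q\<close> encodes every shape of the chain.\<close>

lemma chain_boxes_eq:
  assumes ch: "tableau_chain n Ts" and rec: "records Ts Q" and k: "k < length Ts"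
  shows "boxes (Ts ! k) = boxes (last Ts) \<union> {b \<in> boxes (hd Ts). k < filling Q b}"
proof -
  have ne: "Ts \<noteq> []" using k by auto
  note R = records_chain[OF ch rec]
  have last: "last Ts = Ts ! (length Ts - 1)" and hd: "hd Ts = Ts ! 0"
    using ne by (simp_all add: last_conv_nth hd_conv_nth)
  have "b \<in> boxes (hd Ts) \<and> k < filling Q b" if b: "b \<in> boxes (Ts ! k)" "b \<notin> boxes (last Ts)" for b
  proof -
    have "k \<le> length Ts - 1" "length Ts - 1 < length Ts" using k by auto
    then obtain j where "k \<le> j" "j < length Ts - 1" "b \<in> boxes (Ts ! j)" "b \<notin> boxes (Ts ! Suc j)"
      using chain_leaves[OF ch, of k "length Ts - 1" b] b last by auto
    moreover have "b \<in> boxes (hd Ts)"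
      using chain_boxes_mono[OF ch, of 0 k] k b hd by auto
    ultimately show ?thesis using R(3)[of j b] by simp
  qed
  moreover have "b \<in> boxes (Ts ! k)" if b: "b \<in> boxes (hd Ts)" "k < filling Q b" for b
  proof (rule ccontr)
    assume "b \<notin> boxes (Ts ! k)"
    then obtain j where "j < k" "b \<in> boxes (Ts ! j)" "b \<notin> boxes (Ts ! Suc j)"
      using chain_leaves[OF ch, of 0 k b] b k hd by auto
    with R(3)[of j b] k b(2) show False by simp
  qed
  moreover have "boxes (last Ts) \<subseteq> boxes (Ts ! k)"
    unfolding last using k by (intro chain_boxes_mono[OF ch]) auto
  ultimately show ?thesis by blast
qed

lemma filling_less_length:
  assumes ch: "tableau_chain n Ts" and rec: "records Ts Q"
  shows "filling Q b < length Ts"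
proof (rule ccontr)
  assume *: "\<not> filling Q b < length Ts"
  have ne: "Ts \<noteq> []" using ch by (simp add: tableau_chain_def)
  with * have "filling Q b \<noteq> 0" by (cases Ts) auto
  then have b: "b \<in> boxes (hd Ts)" "b \<notin> boxes (last Ts)"
    using records_chain(4)[OF ch rec, of b] by auto
  have eq: "boxes (last Ts) = boxes (last Ts) \<union> {b \<in> boxes (hd Ts). length Ts - 1 < filling Q b}"
    using chain_boxes_eq[OF ch rec, of "length Ts - 1"] ne by (simp add: last_conv_nth)
  have "length Ts - 1 < filling Q b" using * ne by (cases Ts) auto
  with b have "b \<in> boxes (last Ts) \<union> {b \<in> boxes (hd Ts). length Ts - 1 < filling Q b}" by simp
  with b(2) show False by (simp only: eq[symmetric])
qed

lemma strip_chain: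
  assumes ch: "tableau_chain n Ts" and rec: "records Ts Q" and "Suc k < length Ts"
  shows "strip Q (Suc k) = boxes (Ts ! k) - boxes (Ts ! Suc k)"
proof -
  have "b \<in> strip Q (Suc k) \<longleftrightarrow> b \<in> boxes (hd Ts) \<and> b \<notin> boxes (last Ts) \<and> filling Q b = Suc k" for b
    using records_chain(1,2)[OF ch rec] by (auto simp: strip_def)
  moreover have "boxes (last Ts) \<subseteq> boxes (hd Ts)"
    using chain_boxes_eq[OF ch rec, of 0] assms(3) hd_conv_nth[of Ts] by fastforce
  ultimately show ?thesis
    using chain_boxes_eq[OF ch rec, of k] chain_boxes_eq[OF ch rec, of "Suc k"] assms(3) by auto
qed

lemma records_unique:
  assumes ch: "tableau_chain n Ts" and "records Ts Q" "records Ts R"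
  shows "Q = R"
proof (rule rec_tab.expand)
  have "filling Q b = filling R b" for b
  proof (cases "b \<in> boxes (hd Ts) \<and> b \<notin> boxes (last Ts)")
    case True
    have ne: "Ts \<noteq> []" using ch by (simp add: tableau_chain_def)
    then obtain j where "j < length Ts - 1" "b \<in> boxes (Ts ! j)" "b \<notin> boxes (Ts ! Suc j)"
      using chain_leaves[OF ch, of 0 "length Ts - 1" b] True by (auto simp: hd_conv_nth last_conv_nth)
    then show ?thesis
      using records_chain(3)[OF ch assms(2), of j b] records_chain(3)[OF ch assms(3), of j b] by simp
  next
    case False
    then show ?thesis
      using records_chain(4)[OF ch assms(2), of b] records_chain(4)[OF ch assms(3), of b] by auto
  qed
  then show "outer Q = outer R \<and> inner Q = inner R \<and> filling Q = filling R"
    using assms(2,3) by (auto simp: records_def)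
qed

text \<open>A recording tableau does not carry the number of steps. If one chain were shorter, its
  length would bound all labels, and the other would reach its last shape too early, although each
  step loses a box. With equal lengths the steps can be undone from the common last tableau.\<close>

lemma chain_determined_by_record:
  assumes chS: "tableau_chain n Ss" and chT: "tableau_chain n Ts"
    and recS: "records Ss Q" and recT: "records Ts Q" and last: "last Ss = last Ts"
  shows "hd Ss = hd Ts"
proof -
  have ne: "Ss \<noteq> []" "Ts \<noteq> []" using chS chT by (auto simp: tableau_chain_def)
  have hd: "boxes (hd Ss) = boxes (hd Ts)"
    using records_chain(1)[OF chS recS] records_chain(1)[OF chT recT] by simp
  have boxes: "boxes (Ss ! k) = boxes (Ts ! k)" if "k < length Ss" "k < length Ts" for k
    using chain_boxes_eq[OF chS recS that(1)] chain_boxes_eq[OF chT recT that(2)] last hd by simp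
  have le: "length Ts \<le> length Ss"
    if chS: "tableau_chain n Ss" and chT: "tableau_chain n Ts"
      and recS: "records Ss Q" and recT: "records Ts Q" and last: "last Ss = last Ts" for Ss Ts
  proof (rule ccontr)
    assume lt: "\<not> length Ts \<le> length Ss"
    have ne: "Ss \<noteq> []" "Ts \<noteq> []" using chS chT by (auto simp: tableau_chain_def)
    let ?N = "length Ss - 1"
    have N: "?N < length Ts - 1" using lt ne by (cases Ss) auto
    have "boxes (Ts ! ?N) = boxes (last Ts)"
    proof -
      have "\<not> ?N < filling Q b" for b
        using filling_less_length[OF chS recS, of b] by simp
      then show ?thesis using chain_boxes_eq[OF chT recT, of ?N] N by simp
    qed
    with chain_boxes_strict_mono[OF chT N] ne show False by (simp add: last_conv_nth)
  qed
  have len: "length Ss = length Ts"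
    using le[OF chS chT recS recT last] le[OF chT chS recT recS last[symmetric]] by simp
  \<comment> \<open>The index counts from the end; for larger k the truncated subtraction stays at
    0.\<close>
  have "Ss ! (length Ss - 1 - k) = Ts ! (length Ss - 1 - k)" for k
  proof (induction k)
    case 0
    then show ?case using last len ne by (simp add: last_conv_nth)
  next
    case (Suc k)
    show ?case
    proof (cases "Suc k \<le> length Ss - 1")
      case True
      define j where "j = length Ss - 1 - Suc k"
      have j: "Suc j < length Ss" "length Ss - 1 - k = Suc j" using True by (simp_all add: j_def)
      show ?thesis
        unfolding j_def[symmetric]
      proof (rule slack_step_inj)
        show "slack_step n (Ss ! j) (Ss ! Suc j)" using chS j by (simp add: chain_step)
        show "slack_step n (Ts ! j) (Ss ! Suc j)" using chain_step[OF chT, of j] j len Suc by simp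
        show "Ss ! j \<in> tableaux (2 * n)" "Ts ! j \<in> tableaux (2 * n)"
          using chain_tableaux[OF chS, of j] chain_tableaux[OF chT, of j] j len by simp_all
        show "boxes (Ss ! j) = boxes (Ts ! j)" using boxes j len by simp
      qed
    next
      case False
      then show ?thesis using Suc by simp
    qed
  qed
  from this[of "length Ss - 1"] show ?thesis
    using ne by (simp add: hd_conv_nth)
qed

lemma Rec10_iff:
  "Q \<in> Rec10 n lam mu \<longleftrightarrow>
    (\<exists>Ts. tableau_chain n Ts \<and> shape (hd Ts) = lam \<and> last Ts = SH mu \<and> records Ts Q)"
proof
  assume "Q \<in> Rec10 n lam mu"
  then obtain T Ts where "T \<in> tableaux (2 * n)" "shape T = lam" "slack_chain n Ts T (SH mu)" "records Ts Q"
    by (auto simp: Rec10_def SST_iff_tableaux)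
  with tableau_chain_iff[of T n Ts "SH mu"]
  show "\<exists>Ts. tableau_chain n Ts \<and> shape (hd Ts) = lam \<and> last Ts = SH mu \<and> records Ts Q"
    by (intro exI[of _ Ts]) simp
next
  assume "\<exists>Ts. tableau_chain n Ts \<and> shape (hd Ts) = lam \<and> last Ts = SH mu \<and> records Ts Q"
  then obtain Ts where "tableau_chain n Ts" "shape (hd Ts) = lam" "last Ts = SH mu" "records Ts Q"
    by (elim exE conjE) (rule that)
  with tableau_chain_iff[of "hd Ts" n Ts "SH mu"] show "Q \<in> Rec10 n lam mu"
    unfolding Rec10_def SST_iff_tableaux by (intro CollectI bexI[of _ "hd Ts"] exI[of _ Ts]) (simp_all add: SST_iff_tableaux)
qed

lemma LR_inv_eq:
  assumes "tableau_chain n Ts" and "last Ts = SH mu" and "records Ts Q"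
  shows "LR_inv n mu Q = hd Ts"
  unfolding LR_inv_def
proof (rule the_equality)
  show "hd Ts \<in> SST (2 * n) (outer Q) \<and> (\<exists>Ts'. slack_chain n Ts' (hd Ts) (SH mu) \<and> records Ts' Q)"
    using assms tableau_chain_iff[of "hd Ts" n Ts "SH mu"] by (auto simp: SST_iff_tableaux records_def)
next
  fix T assume "T \<in> SST (2 * n) (outer Q) \<and> (\<exists>Ts'. slack_chain n Ts' T (SH mu) \<and> records Ts' Q)"
  then obtain Ts' where "tableau_chain n Ts'" "hd Ts' = T" "last Ts' = SH mu" "records Ts' Q"
    using tableau_chain_iff by (metis SST_iff_tableaux)
  then show "T = hd Ts"
    using chain_determined_by_record assms by metis
qed

lemma wt_k_chain:
  assumes "tableau_chain n Ts"
  shows "wt_k n (hd Ts) = wt_k n (last Ts)"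
proof -
  have "wt_k n (Ts ! 0) = wt_k n (Ts ! k)" if "k < length Ts" for k
    using that
  proof (induction k)
    case (Suc k)
    with wt_k_slack_step[OF chain_step[OF assms]] show ?case by simp
  qed simp
  moreover have "Ts \<noteq> []" using assms by (simp add: tableau_chain_def)
  ultimately show ?thesis by (simp add: hd_conv_nth last_conv_nth)
qed

section \<open>Tails\<close>

lemma chain_tail:
  assumes ch: "tableau_chain n Ts" and rec: "records Ts Q"
    and r: "even r" "0 < r" "length (shape (hd Ts)) = r" "length (shape (last Ts)) < r"
  defines "M \<equiv> length (filter (\<lambda>C. r - 1 < length C) (hd Ts))"
  shows "0 < M" "M < length Ts" "hd Ts = prepend_cols r M (Ts ! M)" "length (shape (Ts ! M)) < r"
    "tail_labels Q = {1..M}" "records (drop M Ts) (remove_tail Q)"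
proof -
  let ?T = "hd Ts"
  have ne: "Ts \<noteq> []" using ch by (simp add: tableau_chain_def)
  have T: "ssyt ?T" using chain_ssyt[OF ch, of 0] ne by (simp add: hd_conv_nth)
  have hdT: "?T \<noteq> []" "length (hd ?T) = r" using r by (auto simp: length_shape split: if_splits)
  \<comment> \<open>No column is longer than r, so the columns reaching row r - 1 are those of
    length r, and they come first.\<close>
  have M_iff: "j < M \<longleftrightarrow> j < length ?T \<and> length (?T ! j) = r" for j
    using less_row_length_iff[OF T, of j "r - 1"] ssyt_hd_ge[OF T, of j] hdT r(2)
    by (auto simp: M_def boxes_def)
  show M0: "0 < M" using M_iff[of 0] hdT by (simp add: hd_conv_nth)
  have prefix: "k < length Ts \<and> Ts ! k = drop k ?T \<and> take k ?T = replicate k [1..<Suc r]" if "k \<le> M" for k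
    using that
  proof (induction k)
    case 0
    then show ?case using ne by (simp add: hd_conv_nth)
  next
    case (Suc k)
    then have IH: "k < length Ts" "Ts ! k = drop k ?T" "take k ?T = replicate k [1..<Suc r]"
      and k: "k < length ?T" "length (?T ! k) = r"
      using M_iff[of k] by auto
    have Tk: "Ts ! k = ?T ! k # drop (Suc k) ?T"
      using IH(2) k by (simp add: Cons_nth_drop_Suc)
    \<comment> \<open>The chain cannot end while a column of length r is present, because its last
      tableau has fewer than r rows.\<close>
    have sk: "Suc k < length Ts"
    proof (rule ccontr)
      assume "\<not> Suc k < length Ts"
      then have "k = length Ts - 1" using IH(1) by simp
      then have "last Ts = Ts ! k" using ne by (simp add: last_conv_nth)
      with r(4) k Tk show False by (simp add: length_shape)
    qed
    from chain_step[OF ch sk] have "?T ! k = [1..<Suc r] \<and> Ts ! Suc k = drop (Suc k) ?T"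
    proof (cases rule: slack_step_cases)
      case (even C)
      with Tk k show ?thesis by simp
    next
      case (odd C T0 a)
      with Tk k r(1) show ?thesis by simp
    qed
    with sk IH(3) k show ?case
      by (simp add: take_Suc_conv_app_nth replicate_append_same del: upt_Suc)
  qed
  show Mlt: "M < length Ts" using prefix[of M] by simp
  show eqM: "hd Ts = prepend_cols r M (Ts ! M)"
    using prefix[OF order_refl] append_take_drop_id[of M ?T] unfolding prepend_cols_def by metis
  show lM: "length (shape (Ts ! M)) < r"
  proof (cases "Ts ! M = []")
    case False
    then have "M < length ?T" using prefix[of M] by simp
    moreover have "hd (Ts ! M) = ?T ! M" using prefix[of M] calculation by (simp add: hd_drop_conv_nth)
    moreover have "length (?T ! M) \<le> r" using ssyt_hd_ge[OF T, of M] calculation(1) hdT by simp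
    ultimately show ?thesis using M_iff[of M] False by (simp add: length_shape)
  qed (use r in \<open>simp add: length_shape\<close>)
  have card_strip: "card (strip Q (Suc k)) = r \<longleftrightarrow> k < M" if k: "Suc k < length Ts" for k
  proof -
    let ?S = "Ts ! k"
    note props = slack_step_props[OF chain_step[OF ch k] chain_tableaux[OF ch Suc_lessD[OF k]]]
    have "card (strip Q (Suc k)) = length (concat ?S) - length (concat (Ts ! Suc k))"
      unfolding strip_chain[OF ch rec k] using props(3) by (simp add: card_Diff_subset finite_boxes card_boxes)
    then have card: "card (strip Q (Suc k)) = (if even (length (hd ?S)) then length (hd ?S) else length (hd ?S) - 1)"
      using props(4) by simp
    show ?thesis
    proof (cases "k < M")
      case True
      then have "Ts ! k = drop k ?T" "k < length ?T" "length (?T ! k) = r"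
        using prefix[of k] M_iff[of k] by auto
      then have "length (hd ?S) = r" by (simp add: hd_drop_conv_nth)
      with True card r show ?thesis by simp
    next
      case False
      \<comment> \<open>Shapes shrink, so from time M on the first column is shorter than r, and no
        strip is larger than the first column.\<close>
      then have "boxes ?S \<subseteq> boxes (Ts ! M)" using k by (intro chain_boxes_mono[OF ch]) auto
      then have "Ts ! M \<noteq> [] \<and> length (hd ?S) \<le> length (hd (Ts ! M))"
        using chain_ssyt[OF ch] k Mlt props(2) by (intro boxes_subset_hd) auto
      then have "length (hd ?S) < r" using lM by (simp add: length_shape)
      with False card show ?thesis by auto
    qed
  qed
  have outer: "outer Q = shape ?T" "inner Q = shape (last Ts)" using rec by (simp_all add: records_def)
  have "k \<in> tail_labels Q \<longleftrightarrow> k \<in> {1..M}" for k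
  proof (cases "1 \<le> k \<and> k < length Ts")
    case True
    then obtain j where "k = Suc j" "Suc j < length Ts" by (cases k) auto
    with card_strip[of j] show ?thesis by (auto simp: tail_labels_def outer r)
  next
    case False
    \<comment> \<open>No box carries a label beyond the number of steps, and an empty strip does not
      count as part of the tail because r is positive.\<close>
    then have "strip Q k = {} \<or> k = 0"
      using filling_less_length[OF ch rec] by (auto simp: strip_def)
    with False Mlt r show ?thesis by (auto simp: tail_labels_def outer)
  qed
  then show tl: "tail_labels Q = {1..M}" by blast
  have rt: "remove_tail Q = RecTab (shape (Ts ! M)) (shape (last Ts))
      (\<lambda>b. if filling Q b \<in> {1..M} then 0 else filling Q b - M)"
  proof -
    have "length C \<le> r" if "C \<in> set (Ts ! M)" for C
    proof -
      have "C \<in> set ?T" using that prefix[of M] by (metis in_set_dropD order_refl)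
      then show ?thesis using ssyt_hd_ge[OF T] hdT(2) by (auto simp: in_set_conv_nth)
    qed
    then have "sub_cols (shape ?T) M = shape (Ts ! M)"
      using sub_cols_shape_prepend_cols[of "Ts ! M" M r] chain_ssyt[OF ch Mlt] M0 eqM by simp
    then show ?thesis by (simp add: remove_tail_def tl outer)
  qed
  have chM: "tableau_chain n (drop M Ts)" using chain_drop[OF ch Mlt] .
  have last: "last (drop M Ts) = last Ts" "hd (drop M Ts) = Ts ! M"
    using Mlt by (simp_all add: hd_drop_conv_nth)
  show "records (drop M Ts) (remove_tail Q)"
    unfolding records_def
  proof (intro conjI allI impI ballI)
    show "outer (remove_tail Q) = shape (hd (drop M Ts))" "inner (remove_tail Q) = shape (last (drop M Ts))"
      by (simp_all add: rt last)
  next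
    fix k b assume k: "Suc k < length (drop M Ts)"
      and "b \<in> cells (shape (drop M Ts ! k)) - cells (shape (drop M Ts ! Suc k))"
    then have "b \<in> boxes (Ts ! (M + k))" "b \<notin> boxes (Ts ! Suc (M + k))"
      using chain_cells[OF ch, of "M + k"] chain_cells[OF ch, of "Suc (M + k)"] by auto
    with k records_chain(3)[OF ch rec, of "M + k" b] have "filling Q b = Suc (M + k)" by simp
    then show "filling (remove_tail Q) b = Suc k" by (simp add: rt)
  next
    fix b assume "b \<notin> cells (outer (remove_tail Q)) - cells (inner (remove_tail Q))"
    then have b: "b \<notin> boxes (Ts ! M) \<or> b \<in> boxes (last Ts)"
      using chain_cells[OF ch Mlt] records_chain(2)[OF ch rec] outer by (simp add: rt)
    \<comment> \<open>Labels up to M all become 0: the positive ones as tail labels, the label 0 by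
      truncated subtraction.\<close>
    have "filling Q b \<le> M"
    proof (rule ccontr)
      assume "\<not> filling Q b \<le> M"
      moreover from this have "b \<in> boxes (hd Ts)" "b \<notin> boxes (last Ts)"
        using records_chain(4)[OF ch rec, of b] by auto
      ultimately have "b \<in> boxes (Ts ! M)"
        by (subst chain_boxes_eq[OF ch rec Mlt]) simp
      with b \<open>b \<notin> boxes (last Ts)\<close> show False by blast
    qed
    then show "filling (remove_tail Q) b = 0" by (simp add: rt)
  qed
qed

text \<open>Existence of some recording tableau suffices: that removal of its tail gives back the
  old one will follow from \<open>chain_tail\<close> and the uniqueness of records.\<close>

lemma chain_prepend:
  assumes ch: "tableau_chain n Ts" and rec: "records Ts Q" and r: "even r" "0 < r" "r \<le> 2 * n"
    and le: "length (shape (hd Ts)) \<le> r"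
  shows "\<exists>Q'. tableau_chain n (([1..<Suc r] # hd Ts) # Ts) \<and> records (([1..<Suc r] # hd Ts) # Ts) Q'"
proof -
  let ?T = "[1..<Suc r] # hd Ts"
  have ne: "Ts \<noteq> []" using ch by (simp add: tableau_chain_def)
  have hdT: "hd Ts \<in> tableaux (2 * n)" using ch by (simp add: tableau_chain_def)
  then have ss: "ssyt (hd Ts)" by (simp add: tableaux_def)
  have "length C \<le> r" if "C \<in> set (hd Ts)" for C
    using that ssyt_hd_ge[OF ss] le by (fastforce simp: in_set_conv_nth length_shape split: if_splits)
  with hdT r have T: "?T \<in> tableaux (2 * n)"
    by (intro initial_column_tableaux) auto
  have step: "slack_step n ?T (hd Ts)"
    using r by (auto simp: slack_step_def simp del: upt_Suc)
  have ch': "tableau_chain n (?T # Ts)"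
    unfolding tableau_chain_def
  proof (intro conjI allI impI)
    fix k assume "Suc k < length (?T # Ts)"
    with step ne chain_step[OF ch, of "k - 1"]
    show "slack_step n ((?T # Ts) ! k) ((?T # Ts) ! Suc k)"
      by (cases k) (auto simp: hd_conv_nth simp del: upt_Suc)
  qed (use T in auto)
  define B where "B = cells (shape ?T)"
  \<comment> \<open>Boxes gained from the new column get the label 1, older labels go up by one, and
    the inner shape keeps 0.\<close>
  define f where "f b = (if b \<in> cells (outer Q) then (if b \<in> cells (inner Q) then 0 else Suc (filling Q b))
      else if b \<in> B then 1 else 0)" for b
  have outer: "outer Q = shape (hd Ts)" "inner Q = shape (last Ts)" using rec by (simp_all add: records_def)
  have cells: "cells (shape (Ts ! k)) \<subseteq> cells (outer Q)" "cells (inner Q) \<subseteq> cells (shape (Ts ! k))"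
    if "k < length Ts" for k
    using chain_boxes_mono[OF ch, of 0 k] chain_boxes_mono[OF ch, of k "length Ts - 1"] that ne
      chain_cells[OF ch that] records_chain(1,2)[OF ch rec] by (simp_all add: hd_conv_nth last_conv_nth)
  have "records (?T # Ts) (RecTab (shape ?T) (inner Q) f)"
    unfolding records_def
  proof (intro conjI allI impI ballI)
    show "outer (RecTab (shape ?T) (inner Q) f) = shape (hd (?T # Ts))" by simp
    show "inner (RecTab (shape ?T) (inner Q) f) = shape (last (?T # Ts))" using ne outer by simp
  next
    fix k b assume k: "Suc k < length (?T # Ts)"
      and b: "b \<in> cells (shape ((?T # Ts) ! k)) - cells (shape ((?T # Ts) ! Suc k))"
    show "filling (RecTab (shape ?T) (inner Q) f) b = Suc k"
    proof (cases k)
      case 0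
      with b ne show ?thesis by (simp add: f_def B_def outer hd_conv_nth)
    next
      case (Suc j)
      with k b have j: "Suc j < length Ts" "b \<in> cells (shape (Ts ! j))" "b \<notin> cells (shape (Ts ! Suc j))"
        by auto
      then have "filling Q b = Suc j" using rec by (simp add: records_def)
      moreover have "b \<in> cells (outer Q)" "b \<notin> cells (inner Q)"
        using cells[of j] cells[of "Suc j"] j by auto
      ultimately show ?thesis by (simp add: f_def Suc)
    qed
  next
    fix b assume "b \<notin> cells (outer (RecTab (shape ?T) (inner Q) f)) - cells (inner (RecTab (shape ?T) (inner Q) f))"
    then have b: "b \<notin> B \<or> b \<in> cells (inner Q)" by (simp add: B_def)
    have "cells (outer Q) \<subseteq> B"
      using chain_boxes_mono[OF ch', of 0 1] ne cells_shape[of ?T] cells_shape[OF ss] T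
      by (auto simp: B_def outer tableaux_def hd_conv_nth simp del: upt_Suc)
    with b cells(2)[of 0] cells(1)[of 0] ne show "filling (RecTab (shape ?T) (inner Q) f) b = 0"
      by (auto simp: f_def)
  qed
  with ch' show ?thesis by blast
qed

section \<open>The tableau \<open>S\<^sup>H\<close>\<close>

text \<open>For the weight: \<open>u k\<close> occurs once in every column of length at least k, the
  number of these columns is the k-th part of mu, and no letter \<open>v k\<close> occurs.\<close>

lemma SH_props:
  assumes "mu \<in> Par n"
  shows "boxes (SH mu) = cells mu" and "length (shape (SH mu)) = length mu"
    and "wt_k n (SH mu) = part_vec n mu"
proof -
  have mu: "sorted_wrt (\<ge>) mu" "0 \<notin> set mu" "length mu \<le> n" using assms by (auto simp: Par_def)
  let ?h = "if mu = [] then 0 else hd mu"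
  let ?f = "\<lambda>j. length (filter (\<lambda>p. j < p) mu)"
  have f: "i < ?f j \<longleftrightarrow> i < length mu \<and> j < mu ! i" for i j
    by (rule less_length_filter_iff[OF mu(1)])
  have h: "mu ! i \<le> ?h" if "i < length mu" for i
    using that mu(1) by (cases mu; cases i) auto
  have col: "length (SH mu ! j) = ?f j" if "j < ?h" for j
    using that by (simp add: SH_def del: upt_Suc)
  have len: "length (SH mu) = ?h" by (simp add: SH_def)
  show "boxes (SH mu) = cells mu"
    using f h col by (fastforce simp: boxes_def cells_def len)
  have "?f 0 = length mu" using mu(2) by (intro arg_cong[of _ _ length] filter_True) (auto intro: gr0I)
  show "length (shape (SH mu)) = length mu"
  proof (cases mu)
    case (Cons x xs)
    with mu have "0 < ?h" by auto
    then have "SH mu \<noteq> []" using len by auto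
    moreover from this have "length (hd (SH mu)) = ?f 0" using \<open>0 < ?h\<close> col[of 0] by (simp add: hd_conv_nth)
    ultimately show ?thesis using \<open>?f 0 = length mu\<close> by (simp add: length_shape)
  qed (simp add: SH_def shape_def)
  have u_inj: "u i = u k \<longleftrightarrow> i = k" "u i \<noteq> v k" if "1 \<le> i" "1 \<le> k" for i k
    using that by (auto simp: u_def v_def; presburger)+
  have count_u: "count_list (map u [1..<Suc m]) (u k) = (if k \<le> m then 1 else 0)"
    and count_v: "count_list (map u [1..<Suc m]) (v k) = 0" if "1 \<le> k" for k m
    using that by (induction m) (auto simp: u_inj)
  have sum: "entry_count (SH mu) x = (\<Sum>j<?h. int (count_list (map u [1..<Suc (?f j)]) x))" for x
  proof -
    have "count_list (concat (map g [0..<m])) x = (\<Sum>j<m. count_list (g j) x)" for g m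
      by (induction m) auto
    then show ?thesis by (simp add: entry_count_def SH_def del: upt_Suc)
  qed
  have "entry_count (SH mu) (u k) - entry_count (SH mu) (v k) = (if k - 1 < length mu then int (mu ! (k - 1)) else 0)"
    if k: "1 \<le> k" for k
  proof -
    have "entry_count (SH mu) (u k) = (\<Sum>j<?h. if k - 1 < ?f j then 1 else 0)"
      unfolding sum count_u[OF k] using k by (intro sum.cong) auto
    also have "\<dots> = int (card ({..<?h} \<inter> {j. k - 1 < ?f j}))"
      by (simp add: sum.If_cases)
    also have "{..<?h} \<inter> {j. k - 1 < ?f j} = (if k - 1 < length mu then {..<mu ! (k - 1)} else {})"
      using f h[of "k - 1"] by auto
    finally show ?thesis using count_v[OF k] by (simp add: sum del: upt_Suc)
  qed
  then show "wt_k n (SH mu) = part_vec n mu"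
    unfolding wt_k_def part_vec_def by (intro nth_equalityI) (simp_all del: upt_Suc)
qed

section \<open>Removing tails\<close>

text \<open>Subtracting less than the smallest part keeps all parts. This identifies the M of the
  theorem with the length of the tail.\<close>

lemma sub_cols_eq_last:
  assumes lam: "sorted_wrt (\<ge>) lam" "lam \<noteq> []" and M: "M \<le> last lam"
    and len: "length (sub_cols lam M) < length lam"
  shows "M = last lam"
proof (rule ccontr)
  assume "M \<noteq> last lam"
  moreover have "last lam \<le> p" if "p \<in> set lam" for p
    using lam that by (induction lam rule: rev_induct) (auto simp: sorted_wrt_append)
  ultimately have "M < p" if "p \<in> set lam" for p
    using M that by fastforce
  then have "sub_cols lam M = map (\<lambda>p. p - M) lam"
    unfolding sub_cols_def by (intro filter_True) auto
  with len show False by simp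
qed

text \<open>Since M is the last part, it is at most every part of lam, so the truncated subtraction
  in \<open>sub_cols\<close> is undone by adding M columns of full length.\<close>

lemma prepend_cols_SST_iff:
  assumes lam: "lam \<in> Par m" "length lam = r" and r: "0 < r" and M: "0 < M" "M \<le> last lam"
    and len: "length (sub_cols lam M) < r"
  shows "prepend_cols r M T \<in> SST m lam \<longleftrightarrow> T \<in> SST m (sub_cols lam M)"
proof
  assume "prepend_cols r M T \<in> SST m lam"
  then have S: "ssyt (replicate M [1..<Suc r] @ T)" "set (concat (prepend_cols r M T)) \<subseteq> {1..m}"
    "shape (prepend_cols r M T) = lam"
    by (simp_all only: SST_iff prepend_cols_def)
  have "ssyt T" using S(1) by (simp add: ssyt_def sorted_wrt_append del: upt_Suc)
  moreover have "length C \<le> r" if "C \<in> set T" for C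
    using S(1) that M(1) by (auto simp: ssyt_def sorted_wrt_append dominates_def simp del: upt_Suc)
  ultimately have "shape T = sub_cols lam M"
    using sub_cols_shape_prepend_cols[of T M r] M(1) S(3) by simp
  with S(2) \<open>ssyt T\<close> show "T \<in> SST m (sub_cols lam M)"
    by (simp add: SST_iff prepend_cols_def del: upt_Suc)
next
  assume "T \<in> SST m (sub_cols lam M)"
  then have T: "T \<in> tableaux m" "shape T = sub_cols lam M" by (simp_all add: SST_iff_tableaux)
  have ss: "ssyt T" using T by (simp add: tableaux_def)
  have sorted: "sorted_wrt (\<ge>) lam" and rm: "r \<le> m" and ne: "lam \<noteq> []"
    using lam r by (auto simp: Par_def)
  have last: "last lam = M" using sub_cols_eq_last[OF sorted ne M(2)] len lam(2) by simp
  have "length (hd T) < r" if "T \<noteq> []" using len T(2)[symmetric] that by (simp add: length_shape)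
  then have short: "length C < r" if "C \<in> set T" for C
    using that ssyt_hd_ge[OF ss] by (fastforce simp: in_set_conv_nth)
  have "prepend_cols r M T \<in> tableaux m"
    using r rm T short by (intro prepend_cols_tableaux) (auto intro: less_imp_le)
  moreover have "shape (prepend_cols r M T) = lam"
  proof (rule nth_equalityI)
    show "length (shape (prepend_cols r M T)) = length lam"
      by (simp add: shape_prepend_cols[OF M(1)] lam)
    fix i assume "i < length (shape (prepend_cols r M T))"
    then have i: "i < r" by (simp add: shape_prepend_cols[OF M(1)])
    let ?f = "length (filter (\<lambda>C. i < length C) T)"
    have Mi: "M \<le> lam ! i"
      using sorted i lam(2) last ne by (cases "i = r - 1") (auto simp: last_conv_nth sorted_wrt_iff_nth_less)
    have "sorted_wrt (\<ge>) (map (\<lambda>p. p - M) lam)"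
      unfolding sorted_wrt_map by (rule sorted_wrt_mono_rel[OF _ sorted]) auto
    note xs = this
    from filter_nonzero_sorted[OF xs]
    have take: "shape T = take (length (shape T)) (map (\<lambda>p. p - M) lam)"
      unfolding T(2) sub_cols_def .
    have "?f = lam ! i - M"
    proof (cases "i < length (shape T)")
      case True
      have "shape T ! i = map (\<lambda>p. p - M) lam ! i"
        by (subst take) (use True in simp)
      with True i lam(2) show ?thesis by (simp add: nth_shape)
    next
      case False
      have "?f = 0"
        using False less_row_length_iff[OF ss, of 0 i] by (auto simp: boxes_def length_shape hd_conv_nth split: if_splits)
      moreover have "lam ! i - M = 0"
        using False less_length_filter_iff[OF xs, of i 0] i lam(2)
        by (simp add: T(2) sub_cols_def)
      ultimately show ?thesis by simp
    qed
    with Mi i show "shape (prepend_cols r M T) ! i = lam ! i"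
      by (simp add: shape_prepend_cols[OF M(1)])
  qed
  ultimately show "prepend_cols r M T \<in> SST m lam"
    by (simp add: SST_iff_tableaux)
qed

lemma SST_khw_prepend_cols_iff:
  assumes "lam \<in> Par (2 * n)" "length lam = r" and "even r" "0 < r" and "0 < M" "M \<le> last lam"
    and "length (sub_cols lam M) < r"
  shows "prepend_cols r M T \<in> SST_khw n lam mu \<longleftrightarrow> T \<in> SST_khw n (sub_cols lam M) mu"
proof -
  have "P_AII (prepend_cols r M T) = P_AII T" if "T \<in> SST (2 * n) (sub_cols lam M)"
    using that by (intro P_AII_prepend_cols[OF assms(3,4)]) (simp add: SST_iff)
  then show ?thesis
    using prepend_cols_SST_iff[OF assms(1,2,4-7), of T] unfolding SST_khw_def by auto
qed

lemma part_le_chain: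
  assumes "tableau_chain n Ts" "last Ts = SH mu" "mu \<in> Par n" and "k < length Ts"
  shows "part_le mu (shape (Ts ! k))"
proof (rule part_le_if_cells)
  show "0 \<notin> set mu" using assms(3) by (simp add: Par_def)
  have "boxes (Ts ! (length Ts - 1)) \<subseteq> boxes (Ts ! k)"
    using assms(4) by (intro chain_boxes_mono[OF assms(1)]) auto
  moreover have "Ts ! (length Ts - 1) = SH mu"
    using assms(2,4) by (subst last_conv_nth[symmetric]) auto
  ultimately show "cells mu \<subseteq> cells (shape (Ts ! k))"
    using SH_props(1)[OF assms(3)] chain_cells[OF assms(1,4)] by simp
qed

lemma Rec10_remove_tail:
  assumes Q: "Q \<in> Rec10 n lam mu" and mu: "mu \<in> Par n" and r: "even r" "0 < r" "length lam = r" "length mu < r"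
  obtains T where "T \<in> tableaux (2 * n)" "LR_inv n mu Q = prepend_cols r (last lam) T" "LR_inv n mu (remove_tail Q) = T"
    "remove_tail Q \<in> Rec10 n (shape T) mu" "shape T = sub_cols lam (last lam)" "outer (remove_tail Q) = shape T"
    "shape T \<in> Par (2 * n)" "part_le mu (shape T)" "wt_k n T = part_vec n mu"
proof -
  obtain Ts where ch: "tableau_chain n Ts" and lam: "shape (hd Ts) = lam" and last: "last Ts = SH mu" and rec: "records Ts Q"
    using Q unfolding Rec10_iff by (elim exE conjE) (rule that)
  define M where "M = length (filter (\<lambda>C. r - 1 < length C) (hd Ts))"
  have "length (shape (hd Ts)) = r" "length (shape (last Ts)) < r"
    using r lam last SH_props(2)[OF mu] by auto
  note tail = chain_tail[OF ch rec r(1,2) this, folded M_def]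
  have "lam \<noteq> []" using r by auto
  \<comment> \<open>Row r - 1 of the shape counts the columns of length r, so the tail has length
    \<open>last lam\<close>.\<close>
  then have M: "M = last lam"
    using nth_shape[of "r - 1" "hd Ts"] r lam by (simp add: M_def last_conv_nth)
  have ch': "tableau_chain n (drop M Ts)" by (rule chain_drop[OF ch tail(2)])
  have drop: "hd (drop M Ts) = Ts ! M" "last (drop M Ts) = SH mu"
    using tail(2) last by (simp_all add: hd_drop_conv_nth)
  have T: "Ts ! M \<in> tableaux (2 * n)" by (rule chain_tableaux[OF ch tail(2)])
  show ?thesis
  proof (rule that[of "Ts ! M"])
    show "LR_inv n mu Q = prepend_cols r (last lam) (Ts ! M)"
      using LR_inv_eq[OF ch last rec] tail(3) M by simp
    show "LR_inv n mu (remove_tail Q) = Ts ! M"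
      using LR_inv_eq[OF ch' drop(2) tail(6)] drop(1) by simp
    show "remove_tail Q \<in> Rec10 n (shape (Ts ! M)) mu"
      unfolding Rec10_iff using ch' drop tail(6) by auto
    show out: "outer (remove_tail Q) = shape (Ts ! M)"
      using tail(6) drop(1) by (simp add: records_def)
    have "outer (remove_tail Q) = sub_cols lam M"
      using rec lam by (simp add: remove_tail_def tail(5) records_def)
    then show "shape (Ts ! M) = sub_cols lam (last lam)"
      using out M by simp
    show "shape (Ts ! M) \<in> Par (2 * n)" by (rule shape_Par[OF T])
    show "part_le mu (shape (Ts ! M))" by (rule part_le_chain[OF ch last mu tail(2)])
    show "wt_k n (Ts ! M) = part_vec n mu"
      using wt_k_chain[OF ch'] drop SH_props(3)[OF mu] by simp
  qed (rule T)
qed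

text \<open>One additional column (1,...,r) suffices: all other columns are shorter than r, so the
  extended recording tableau has a tail of length 1.\<close>

lemma Rec10_is_remove_tail:
  assumes Q: "Q \<in> Rec10 n lam mu" and mu: "mu \<in> Par n" and r: "even r" "r \<le> 2 * n"
    and lam: "Suc (length lam) = r" and lmu: "length mu < r"
  shows "\<exists>lam' Q'. lam' \<in> Par (2 * n) \<and> length lam' = r \<and> part_le mu lam' \<and> Q' \<in> Rec10 n lam' mu
    \<and> Q = remove_tail Q'"
proof -
  obtain Ts where ch: "tableau_chain n Ts" and sh: "shape (hd Ts) = lam" and last: "last Ts = SH mu" and rec: "records Ts Q"
    using Q unfolding Rec10_iff by (elim exE conjE) (rule that)
  have ne: "Ts \<noteq> []" using ch by (simp add: tableau_chain_def)
  have r0: "0 < r" using lam by simp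
  let ?T = "[1..<Suc r] # hd Ts"
  obtain Q' where ch': "tableau_chain n (?T # Ts)" and rec': "records (?T # Ts) Q'"
    using chain_prepend[OF ch rec r(1) r0 r(2)] sh lam by auto
  have short: "\<not> r - 1 < length C" if "C \<in> set (hd Ts)" for C
  proof -
    have "ssyt (hd Ts)" using ch by (simp add: tableau_chain_def tableaux_def)
    then show ?thesis
      using that ssyt_hd_ge[of "hd Ts"] sh lam
      by (fastforce simp: in_set_conv_nth length_shape split: if_splits)
  qed
  have "filter (\<lambda>C. r - 1 < length C) (hd Ts) = []"
    using short by (simp add: filter_empty_conv)
  then have M: "length (filter (\<lambda>C. r - 1 < length C) (hd (?T # Ts))) = 1"
    using lam by (simp del: upt_Suc)
  have "length (shape (hd (?T # Ts))) = r" "length (shape (last (?T # Ts))) < r"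
    using ne last lmu SH_props(2)[OF mu] by (simp_all add: length_shape del: upt_Suc)
  from chain_tail(6)[OF ch' rec' r(1) r0 this] have "records Ts (remove_tail Q')"
    unfolding M by (simp del: upt_Suc)
  then have "Q = remove_tail Q'" using records_unique[OF ch rec] by blast
  moreover have "Q' \<in> Rec10 n (shape ?T) mu"
    unfolding Rec10_iff using ch' rec' last ne by (intro exI[of _ "?T # Ts"]) (simp del: upt_Suc)
  moreover have "shape ?T \<in> Par (2 * n)"
    using ch' by (intro shape_Par) (simp add: tableau_chain_def del: upt_Suc)
  moreover have "part_le mu (shape ?T)"
    using part_le_chain[OF ch' _ mu, of 0] ne last by (simp del: upt_Suc)
  moreover have "length (shape ?T) = r"
    by (simp add: length_shape del: upt_Suc)
  ultimately show ?thesis by blast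
qed

text \<open>In the first part only remainders with outer length l are collected, since removing a
  tail may cost more than one row: for n = l = 1 and empty mu, the column (1,2) leaves the empty
  shape, whereas no chain starts from a shape of length 1.\<close>

theorem lemma2:
  fixes n l :: nat and mu :: "nat list"
  assumes "1 \<le> n" and "mu \<in> Par n" and "odd l" and "length mu \<le> l" and "l \<le> 2 * n"
  shows
    "(\<Union>lam \<in> {lam \<in> Par (2 * n). length lam = l \<and> part_le mu lam}. Rec10 n lam mu)
       = {remove_tail Q | Q.
            Q \<in> (\<Union>lam \<in> {lam \<in> Par (2 * n). length lam = l + 1 \<and> part_le mu lam}. Rec10 n lam mu)
            \<and> length (outer (remove_tail Q)) = l}
     \<and>
     (\<forall>lam Q M.
       lam \<in> Par (2 * n) \<and> part_le mu lam \<and> length lam = l + 1 \<and> Q \<in> Rec10 n lam mu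
       \<and> 0 < M \<and> M \<le> last lam \<and> length (sub_cols lam M) = l \<longrightarrow>
         (\<forall>S. S = LR_inv n mu Q \<longleftrightarrow>
            (\<exists>S'. S = prepend_cols (l + 1) M S' \<and> S' = LR_inv n mu (remove_tail Q)))
       \<and> (\<forall>S S'. S = prepend_cols (l + 1) M S' \<longrightarrow>
            (S \<in> SST_khw n lam mu \<longleftrightarrow> S' \<in> SST_khw n (sub_cols lam M) mu))
       \<and> (l + 1 = 2 * n \<longrightarrow>
            (\<forall>S \<in> SST (2 * n) lam.
               Phi_inv n S = Phi_inv n (LR_inv n mu Q) \<longleftrightarrow>
               (\<exists>S' \<in> SST (2 * n) (sub_cols lam M).
                  Phi_inv n S = prepend_cols (2 * n) M (Phi_inv n S')
                  \<and> Phi_inv n S' = Phi_inv n (LR_inv n mu (remove_tail Q))))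
          \<and> (\<forall>S. \<forall>S' \<in> SST (2 * n) (sub_cols lam M). S = prepend_cols (2 * n) M S' \<longrightarrow>
               (Phi_inv n S = Phi_inv n (LR_inv n mu Q) \<longleftrightarrow>
                  Phi_inv n S = prepend_cols (2 * n) M (Phi_inv n S')
                  \<and> Phi_inv n S' = Phi_inv n (LR_inv n mu (remove_tail Q))))
          \<and> (\<forall>S'. S' = LR_inv n mu (remove_tail Q) \<longrightarrow>
               wt_g n (Phi_inv n S') = wt_k n S' \<and> wt_k n S' = part_vec n mu)))
     \<and>
     (wt_g n (Phi_inv n [[1..<Suc (2 * n)]]) = wt_g n [[1..<Suc (2 * n)]]
       \<and> wt_g n [[1..<Suc (2 * n)]] = replicate n 0
       \<and> wt_k n [[1..<Suc (2 * n)]] = replicate n 0)"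
    (is "?A = ?B \<and> ?C \<and> ?D")
proof (intro conjI)
  \<comment> \<open>An odd number that is at most 2n leaves room for one more row.\<close>
  have r: "even (l + 1)" "0 < l + 1" "l + 1 \<le> 2 * n" "length mu < l + 1"
    using assms(3-5) by (simp, simp, presburger, simp)
  show "?A = ?B"
  proof
    show "?A \<subseteq> ?B"
    proof
      fix Q assume "Q \<in> ?A"
      then obtain lam where lam: "length lam = l" "Q \<in> Rec10 n lam mu" by auto
      then obtain lam' Q' where "lam' \<in> Par (2 * n)" "length lam' = l + 1" "part_le mu lam'" "Q' \<in> Rec10 n lam' mu"
        and "Q = remove_tail Q'"
        using Rec10_is_remove_tail[OF lam(2) assms(2) r(1,3) _ r(4)] by auto
      moreover have "length (outer Q) = l"
        using lam by (auto simp: Rec10_iff records_def)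
      ultimately show "Q \<in> ?B" by blast
    qed
    show "?B \<subseteq> ?A"
    proof
      fix R assume "R \<in> ?B"
      then obtain lam Q where R: "R = remove_tail Q" "length (outer R) = l" and Q: "Q \<in> Rec10 n lam mu"
        and lam: "length lam = l + 1"
        by auto
      obtain T where "R \<in> Rec10 n (shape T) mu" "outer R = shape T" "shape T \<in> Par (2 * n)" "part_le mu (shape T)"
        using Rec10_remove_tail[OF Q assms(2) r(1,2) lam r(4)] unfolding R(1) by metis
      with R(2) show "R \<in> ?A" by auto
    qed
  qed
  have Phi: "Phi_inv n (prepend_cols (2 * n) M T) = prepend_cols (2 * n) M (Phi_inv n T)"
    if "T \<in> tableaux (2 * n)" for M T
    by (rule Phi_inv_prepend_cols[OF assms(1) that])
  show ?C
  proof (intro allI impI, elim conjE)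
    fix lam Q M
    assume lam: "lam \<in> Par (2 * n)" "length lam = l + 1" and Q: "Q \<in> Rec10 n lam mu"
      and M: "0 < M" "M \<le> last lam" and len: "length (sub_cols lam M) = l"
    have "sorted_wrt (\<ge>) lam" "lam \<noteq> []" using lam by (auto simp: Par_def)
    then have Ml: "last lam = M" using sub_cols_eq_last[of lam M] M len lam by simp
    obtain T where T: "T \<in> tableaux (2 * n)" and LR: "LR_inv n mu Q = prepend_cols (l + 1) M T"
        "LR_inv n mu (remove_tail Q) = T"
      and sh: "shape T = sub_cols lam M" and wt: "wt_k n T = part_vec n mu"
      using Rec10_remove_tail[OF Q assms(2) r(1,2) lam(2) r(4)] unfolding Ml by metis
    have TS: "T \<in> SST (2 * n) (sub_cols lam M)" using T sh by (simp add: SST_iff_tableaux)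
    have SSTD: "S \<in> tableaux (2 * n)" if "S \<in> SST (2 * n) nu" for S nu
      using that by (simp add: SST_iff_tableaux)
    have wt': "wt_g n (Phi_inv n T) = wt_k n T"
      using T by (intro wt_g_Phi_inv[OF assms(1)]) (simp add: tableaux_def)
    have khw: "prepend_cols (l + 1) M S' \<in> SST_khw n lam mu \<longleftrightarrow> S' \<in> SST_khw n (sub_cols lam M) mu" for S'
      using SST_khw_prepend_cols_iff[OF lam r(1,2) M] len by simp
    have cancel: "prepend_cols (2 * n) M X = prepend_cols (2 * n) M Y \<longleftrightarrow> X = Y" for X Y
      by (simp add: prepend_cols_def)
    show "(\<forall>S. S = LR_inv n mu Q \<longleftrightarrow>
            (\<exists>S'. S = prepend_cols (l + 1) M S' \<and> S' = LR_inv n mu (remove_tail Q)))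
       \<and> (\<forall>S S'. S = prepend_cols (l + 1) M S' \<longrightarrow>
            (S \<in> SST_khw n lam mu \<longleftrightarrow> S' \<in> SST_khw n (sub_cols lam M) mu))
       \<and> (l + 1 = 2 * n \<longrightarrow>
            (\<forall>S \<in> SST (2 * n) lam.
               Phi_inv n S = Phi_inv n (LR_inv n mu Q) \<longleftrightarrow>
               (\<exists>S' \<in> SST (2 * n) (sub_cols lam M).
                  Phi_inv n S = prepend_cols (2 * n) M (Phi_inv n S')
                  \<and> Phi_inv n S' = Phi_inv n (LR_inv n mu (remove_tail Q))))
          \<and> (\<forall>S. \<forall>S' \<in> SST (2 * n) (sub_cols lam M). S = prepend_cols (2 * n) M S' \<longrightarrow>
               (Phi_inv n S = Phi_inv n (LR_inv n mu Q) \<longleftrightarrow>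
                  Phi_inv n S = prepend_cols (2 * n) M (Phi_inv n S')
                  \<and> Phi_inv n S' = Phi_inv n (LR_inv n mu (remove_tail Q))))
          \<and> (\<forall>S'. S' = LR_inv n mu (remove_tail Q) \<longrightarrow>
               wt_g n (Phi_inv n S') = wt_k n S' \<and> wt_k n S' = part_vec n mu))"
      unfolding LR
    proof (intro conjI impI)
      show "\<forall>S. S = prepend_cols (l + 1) M T \<longleftrightarrow> (\<exists>S'. S = prepend_cols (l + 1) M S' \<and> S' = T)"
        by simp
      show "\<forall>S S'. S = prepend_cols (l + 1) M S' \<longrightarrow>
            (S \<in> SST_khw n lam mu \<longleftrightarrow> S' \<in> SST_khw n (sub_cols lam M) mu)"
        using khw by simp
    next
      assume l: "l + 1 = 2 * n"
      show "\<forall>S \<in> SST (2 * n) lam.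
               Phi_inv n S = Phi_inv n (prepend_cols (l + 1) M T) \<longleftrightarrow>
               (\<exists>S' \<in> SST (2 * n) (sub_cols lam M).
                  Phi_inv n S = prepend_cols (2 * n) M (Phi_inv n S') \<and> Phi_inv n S' = Phi_inv n T)"
        \<comment> \<open>The tableau \<open>T\<close> of the remaining chain is the witness for
          S'.\<close>
        unfolding l Phi[OF T] using TS by metis
      show "\<forall>S. \<forall>S' \<in> SST (2 * n) (sub_cols lam M). S = prepend_cols (2 * n) M S' \<longrightarrow>
               (Phi_inv n S = Phi_inv n (prepend_cols (l + 1) M T) \<longleftrightarrow>
                  Phi_inv n S = prepend_cols (2 * n) M (Phi_inv n S') \<and> Phi_inv n S' = Phi_inv n T)"
        unfolding l Phi[OF T] using Phi[OF SSTD] cancel by metis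
      show "\<forall>S'. S' = T \<longrightarrow> wt_g n (Phi_inv n S') = wt_k n S' \<and> wt_k n S' = part_vec n mu"
        using wt wt' by simp
    qed
  qed
  have "ssyt [[1..<Suc (2 * n)]]"
    using assms(1) by (simp add: ssyt_Cons del: upt_Suc)
  then show "wt_g n (Phi_inv n [[1..<Suc (2 * n)]]) = wt_g n [[1..<Suc (2 * n)]]"
    by (simp only: wt_g_Phi_inv[OF assms(1)] wt_initial_column)
  show "wt_g n [[1..<Suc (2 * n)]] = replicate n 0" "wt_k n [[1..<Suc (2 * n)]] = replicate n 0"
    by (rule wt_initial_column)+
qed

end
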